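(* Write $L=\log\log x$. For any fixed integer $\ell\ge 1$ and any integer $k\ge 0$ with $k\ll L$ we have \[\sum_{\substack{n\le x\\ \omega^*(n)=k}}\binom{r_{\mathcal{R}'}^*(n)}{\ell}\ll_\ell\frac{xL^{O_\ell(1)}}{(\sqrt{\log x})^{\ell+1}}\cdot\frac{(2^{\ell-1}L)^k}{k!}.\] That is: for every integer $\ell\ge 1$ and every $C>0$ there are constants $K,A,x_0>0$, depending only on $\ell$ and $C$, such that for all $x\ge x_0$ and all integers $0\le k\le C\log\log x$, the left-hand side is at most $K\,\dfrac{x(\log\log x)^{A}}{(\log x)^{(\ell+1)/2}}\cdot\dfrac{(2^{\ell-1}\log\log x)^k}{k!}$.
   Context: The sum is over positive integers $n\le x$. For a positive integer $n$, $\omega^*(n)$ denotes the number of distinct odd prime factors of $n$. $\mathcal{R}'$ is the set of positive integers $k$ which can be written as a sum of two coprime squares, i.e. $k=a^2+b^2$ with integers $a\ge 0$, $b>0$ and $\gcd(a,b)=1$. For a set $S$ of positive integers, $r_S^*(n):=\#\{(a,b)\in\mathbb{Z}_{\ge 0}\times S:\ a^2+b^2=n,\ \gcd(a,b)=1\}$. So $r_{\mathcal{R}'}^*(n)$ counts the representations of $n$ as $a^2+b^2$ with $a\ge 0$ an integer, $b\in\mathcal{R}'$, and $\gcd(a,b)=1$. The logarithm is natural. *)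

theory Defs
  imports Complex_Main "HOL-Computational_Algebra.Primes"
begin

text \<open>The number of distinct odd prime factors of a positive integer.\<close>

definition omega_star :: "nat \<Rightarrow> nat" where
  "omega_star n = card {p. prime p \<and> odd p \<and> p dvd n}"

text \<open>The set \<open>\<R>'\<close> of positive integers that are sums of two coprime squares.
  Nonnegative integers are rendered as natural numbers throughout.\<close>

definition R_prime :: "nat set" where
  "R_prime = {k. \<exists>a b :: nat. b > 0 \<and> coprime a b \<and> k = a\<^sup>2 + b\<^sup>2}"

text \<open>The number of pairs \<open>(a, b)\<close> is finite for every \<open>n\<close>, since \<open>a, b \<le> n\<close>.\<close>

definition r_star :: "nat set \<Rightarrow> nat \<Rightarrow> nat" where
  "r_star S n = card {(a, b). b \<in> S \<and> a\<^sup>2 + b\<^sup>2 = n \<and> coprime a b}"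

end

theory Submission
  imports Defs "HOL-Number_Theory.Number_Theory"
    "HOL-Real_Asymp.Real_Asymp"
begin

text \<open>
  Put \<open>L = log log x\<close> and \<open>Y = exp (\<eta> * log x / L)\<close> with a small constant \<open>\<eta>\<close>. Integers \<open>n \<le> x\<close> with
  \<open>O(L)\<close> prime factors, all below \<open>Y\<close>, are too rare to matter, so let \<open>n = m * p\<close> with a prime \<open>p \<ge> Y\<close>. If \<open>n\<close>
  has a primitive representation, then \<open>p = c\<^sup>2 + d\<^sup>2\<close>, and every primitive representation \<open>n = a\<^sup>2 + b\<^sup>2\<close>
  has the form \<open>b = \<alpha> * c + \<beta> * d\<close> with coprime \<open>\<alpha>\<close>, \<open>\<beta>\<close> and \<open>\<alpha>\<^sup>2 + \<beta>\<^sup>2 = m\<close>, which leaves at most \<open>4 * 2 ^ \<omega>\<^sup>*(m)\<close>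
  pairs \<open>(\<alpha>, \<beta>)\<close>. For fixed \<open>m\<close>, fixed \<open>l\<close> such pairs and fixed \<open>d\<close>, sieve over \<open>c\<close>: the primes \<open>q \<equiv> 1 (mod 4)\<close> remove
  the two roots of \<open>c\<^sup>2 + d\<^sup>2\<close>, and the primes \<open>q \<equiv> 3 (mod 4)\<close>, which divide no element of \<open>\<R>'\<close>, remove the
  roots of the linear forms with \<open>\<alpha> \<noteq> 0\<close>, of which there are at least \<open>l - 1\<close>. The sieve has dimension
  \<open>(l + 1) / 2\<close>, and since powers of \<open>L\<close> are harmless, Brun's pure sieve with the Mertens estimates
  modulo 4 suffices. Summing \<open>2 ^ (l * \<omega>\<^sup>*(m)) / m\<close> over the possible \<open>m\<close>, whose odd prime factors are
  all \<open>1\<close> modulo 4, gives the factor \<open>(2 ^ (l - 1) * L) ^ k / k!\<close>.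
\<close>

section \<open>Mertens' theorems modulo 4\<close>

text \<open>The large prime \<open>p\<close> makes room for sifting: \<open>m * Y \<le> x\<close>
  leaves \<open>c\<close> an interval of length at least \<open>sqrt Y\<close>. In the pure sieve
  products of up to \<open>O(L)\<close> moduli must stay below that length, so it reaches only
  \<open>z = exp (\<zeta> * log x / L\<^sup>2)\<close>. As \<open>log z\<close> and
  \<open>log x\<close> differ by a factor \<open>O(L\<^sup>2)\<close>, this loses just a power of
  \<open>L\<close>. Local conditions degenerate at \<open>O(log x)\<close> primes at most, whose
  omission costs another power of \<open>L\<close>.

  Half of the mass in Mertens' theorem lies on the primes 1 modulo 4. The sum of
  \<open>1 / m\<close> over \<open>m\<close> with \<open>j\<close> odd prime factors is therefore
  governed by \<open>(L / 2) ^ j / j!\<close>, which turns \<open>2 ^ l\<close> into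
  \<open>2 ^ (l - 1)\<close>.

  The bound \<open>k \<le> C * L\<close> acts three times: it makes the integers without a large
  prime rare, it lets \<open>L + O(1)\<close> be replaced by \<open>L\<close> under a
  \<open>k\<close>-th power, and it compares the terms for \<open>k - 1\<close> and \<open>k\<close>
  (the prime \<open>p\<close> may or may not divide \<open>m\<close>).\<close>

lemma abs_sum_mult_antimono_le:
  fixes g f :: "nat \<Rightarrow> real"
  assumes G: "\<And>n. \<bar>\<Sum>i\<in>{m..<n}. g i\<bar> \<le> B"
    and f: "\<And>i. i \<ge> m \<Longrightarrow> f (Suc i) \<le> f i" "\<And>i. i \<ge> m \<Longrightarrow> f i \<ge> 0"
  shows "\<bar>\<Sum>i\<in>{m..<n}. g i * f i\<bar> \<le> B * f m"
proof (cases "n \<ge> m")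
  case True
  define S where "S = (\<lambda>n. \<Sum>i\<in>{m..<n}. g i)"
  \<comment> \<open>Summation by parts: the increments of the weight are nonnegative and telescope,
    so bounded partial sums of \<open>g\<close> cost only the initial weight
    \<open>f m\<close>.\<close>
  have parts: "(\<Sum>i\<in>{m..<n}. g i * f i) = S n * f n + (\<Sum>i\<in>{m..<n}. S (Suc i) * (f i - f (Suc i)))"
    using True
  proof (induction n rule: dec_induct)
    case base then show ?case by (simp add: S_def)
  next
    case (step n)
    have "S (Suc n) = S n + g n" using step by (simp add: S_def)
    then show ?case using step by (simp add: algebra_simps)
  qed
  have G': "\<bar>S n\<bar> \<le> B" for n
    using G unfolding S_def .
  have tel: "(\<Sum>i\<in>{m..<n}. f i - f (Suc i)) = f m - f n"
    using sum_Suc_diff'[OF True, of f] by (simp add: sum_subtractf algebra_simps)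
  have "\<bar>\<Sum>i\<in>{m..<n}. g i * f i\<bar> \<le> \<bar>S n * f n\<bar> + (\<Sum>i\<in>{m..<n}. \<bar>S (Suc i) * (f i - f (Suc i))\<bar>)"
    unfolding parts by (rule order_trans[OF abs_triangle_ineq add_left_mono[OF sum_abs]])
  also have "\<dots> \<le> B * f n + (\<Sum>i\<in>{m..<n}. B * (f i - f (Suc i)))"
    using f G' True
    by (intro add_mono sum_mono) (auto simp: abs_mult intro!: mult_right_mono)
  also have "\<dots> = B * f m" by (simp add: tel flip: sum_distrib_left) (simp add: algebra_simps)
  finally show ?thesis .
next
  case False
  have "B \<ge> 0" using G[of m] by simp
  then show ?thesis using False f(2)[of m] by simp
qed

text \<open>The nonprincipal Dirichlet character modulo 4. It separates the two classes of odd
  primes, at which the sieve removes different numbers of residues.\<close>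

definition chi4 :: "nat \<Rightarrow> real" where
  "chi4 n = (if n mod 4 = 1 then 1 else if n mod 4 = 3 then - 1 else 0)"

lemma chi4_mult: "chi4 (a * b) = chi4 a * chi4 b"
proof -
  have "a mod 4 \<in> {0,1,2,3}" "b mod 4 \<in> {0,1,2,3}" by auto
  moreover have "(a * b) mod 4 = ((a mod 4) * (b mod 4)) mod 4" by (simp add: mod_mult_eq)
  ultimately show ?thesis by (auto simp: chi4_def)
qed

lemma abs_chi4_le: "\<bar>chi4 n\<bar> \<le> 1"
  by (simp add: chi4_def)

lemma sum_chi4: "(\<Sum>i<n. chi4 i) = (if n mod 4 \<in> {2,3} then 1 else 0)"
proof (induction n)
  case (Suc n)
  have "n mod 4 \<in> {0,1,2,3}" by auto
  then show ?case using Suc by (auto simp: chi4_def mod_Suc)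
qed simp

lemma abs_sum_chi4_le: "\<bar>\<Sum>i\<in>{m..<n}. chi4 i\<bar> \<le> 1"
proof (cases "m \<le> n")
  case True
  have "(\<Sum>i<n. chi4 i) = (\<Sum>i<m. chi4 i) + (\<Sum>i\<in>{m..<n}. chi4 i)"
    using True by (simp add: lessThan_atLeast0 sum.atLeastLessThan_concat)
  then show ?thesis by (auto simp: sum_chi4 split: if_splits)
qed simp

lemma abs_sum_chi4_div_le:
  assumes "m \<ge> 1"
  shows "\<bar>\<Sum>i\<in>{m..<n}. chi4 i / real i\<bar> \<le> 1 / real m"
  using abs_sum_mult_antimono_le[where m = m and g = chi4 and B = 1 and f = "\<lambda>i. 1 / real i" and n = n] assms
  by (auto simp: abs_sum_chi4_le frac_le)

lemma ln_div_antimono: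
  assumes "3 \<le> x" "x \<le> (y::real)"
  shows "ln y / y \<le> ln x / x"
proof (rule DERIV_nonpos_imp_nonincreasing[of x y "\<lambda>x. ln x / x"])
  fix t assume t: "x \<le> t" "t \<le> y"
  then have "t > 0" using assms by simp
  then have "((\<lambda>x. ln x / x) has_real_derivative (1 - ln t) / t^2) (at t)"
    by (auto intro!: derivative_eq_intros simp: power2_eq_square field_simps)
  moreover have "ln t \<ge> 1"
  proof -
    have "exp 1 \<le> t" using exp_le t assms by linarith
    then show ?thesis using ln_ge_iff[of t 1] \<open>t > 0\<close> by simp
  qed
  ultimately show "\<exists>d. ((\<lambda>x. ln x / x) has_real_derivative d) (at t) \<and> d \<le> 0"
    by (intro exI[of _ "(1 - ln t) / t^2"]) (auto simp: divide_nonpos_nonneg)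
qed (use assms in auto)

lemma sum_chi4_ln_div_le: "\<bar>\<Sum>i\<in>{1..n}. chi4 i * (ln (real i) / real i)\<bar> \<le> ln 3 / 3"
proof (cases "n \<ge> 3")
  case True
  \<comment> \<open>The terms 1 and 2 vanish (\<open>ln 1 = 0\<close>, \<open>chi4 2 = 0\<close>),
    so the sum may start at 3, past the maximum of \<open>ln t / t\<close> at e.\<close>
  have "{1..n} = {1,2} \<union> {3..<Suc n}" using True by auto
  then have "(\<Sum>i\<in>{1..n}. chi4 i * (ln (real i) / real i)) =
     (\<Sum>i\<in>{3..<Suc n}. chi4 i * (ln (real i) / real i))"
    by (simp add: sum.union_disjoint chi4_def)
  also have "\<bar>\<dots>\<bar> \<le> 1 * (ln (real 3) / real 3)"
    by (rule abs_sum_mult_antimono_le) (use abs_sum_chi4_le ln_div_antimono in auto)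
  finally show ?thesis by simp
next
  case False
  then have "n = 0 \<or> n = 1 \<or> n = 2" by auto
  moreover have "{1..2} = {1,2::nat}" by auto
  ultimately show ?thesis by (auto simp: chi4_def)
qed

section \<open>Chebyshev's bound and weighted sums of the von Mangoldt function\<close>

lemma sum_divisors_swap:
  fixes f :: "nat \<Rightarrow> nat \<Rightarrow> real"
  shows "(\<Sum>n\<in>{1..N}. \<Sum>d | d dvd n. f d (n div d)) = (\<Sum>d\<in>{1..N}. \<Sum>m\<in>{1..N div d}. f d m)"
proof -
  have le: "b \<le> N" if "0 < k" "b * k \<le> N" for b k
    using that by (cases k) auto
  have "(\<Sum>n\<in>{1..N}. \<Sum>d | d dvd n. f d (n div d)) = (\<Sum>(n,d)\<in>Sigma {1..N} (\<lambda>n. {d. d dvd n}). f d (n div d))"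
    by (subst sum.Sigma) auto
  also have "\<dots> = (\<Sum>(d,m)\<in>Sigma {1..N} (\<lambda>d. {1..N div d}). f d m)"
    by (rule sum.reindex_bij_witness[of _ "\<lambda>(d,m). (d * m, d)" "\<lambda>(n,d). (d, n div d)"])
       (auto simp: dvd_imp_le div_le_mono less_eq_div_iff_mult_less_eq mult.commute
         dvd_div_eq_0_iff Suc_le_eq intro: dvd_pos_nat le elim!: dvdE)
  also have "\<dots> = (\<Sum>d\<in>{1..N}. \<Sum>m\<in>{1..N div d}. f d m)"
    by (subst sum.Sigma) auto
  finally show ?thesis .
qed

lemma ln_fact_eq: "ln (fact N :: real) = (\<Sum>n\<in>{1..N}. ln (real n))"
  by (induction N) (auto simp: ln_mult sum.nat_ivl_Suc')

text \<open>Legendre's formula in logarithmic form: \<open>ln\<close> is the divisor sum of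
  \<open>mangoldt\<close>. Comparison with the size of \<open>ln (fact N)\<close> yields both
  Chebyshev's and Mertens' estimates.\<close>

lemma ln_fact_mangoldt: "ln (fact N :: real) = (\<Sum>d\<in>{1..N}. mangoldt d * real (N div d))"
proof -
  have "ln (fact N :: real) = (\<Sum>n\<in>{1..N}. \<Sum>d | d dvd n. mangoldt d)"
    unfolding ln_fact_eq using mangoldt_sum[where ?'a = real] by (intro sum.cong) auto
  also have "\<dots> = (\<Sum>d\<in>{1..N}. \<Sum>m\<in>{1..N div d}. mangoldt d)"
    by (rule sum_divisors_swap)
  finally show ?thesis by (simp add: mult.commute)
qed

text \<open>The weight \<open>2*n div d - 2 * (n div d)\<close> is nonnegative and equals 1 on
  \<open>{n<..2*n}\<close>. Summed against \<open>mangoldt\<close> it gives the logarithm of the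
  central binomial coefficient, which is at most \<open>4 ^ n\<close>.\<close>

lemma chebyshev_step: "(\<Sum>d\<in>{n<..2*n}. mangoldt d) \<le> real n * ln 4"
proof -
  have "(\<Sum>d\<in>{n<..2*n}. mangoldt d :: real) \<le>
      (\<Sum>d\<in>{1..2*n}. mangoldt d * (real (2*n div d) - 2 * real (n div d)))"
  proof -
    have ge: "real (2*n div d) - 2 * real (n div d) \<ge> 0" for d
    proof -
      have "2 * (n div d) \<le> 2 * n div d"
        by (cases "d = 0") (auto simp: less_eq_div_iff_mult_less_eq)
      then show ?thesis by linarith
    qed
    have "(\<Sum>d\<in>{n<..2*n}. mangoldt d :: real) \<le>
      (\<Sum>d\<in>{n<..2*n}. mangoldt d * (real (2*n div d) - 2 * real (n div d)))"
    proof (rule sum_mono)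
      fix d assume "d \<in> {n<..2*n}"
      then have "2*n div d \<ge> 1" "n div d = 0" by (auto simp: less_eq_div_iff_mult_less_eq Suc_le_eq div_greater_zero_iff)
      then show "mangoldt d \<le> mangoldt d * (real (2*n div d) - 2 * real (n div d))"
        using mangoldt_nonneg[of d] by (simp add: mult_le_cancel_left1)
    qed
    also have "\<dots> \<le> (\<Sum>d\<in>{1..2*n}. mangoldt d * (real (2*n div d) - 2 * real (n div d)))"
      by (rule sum_mono2) (use ge mangoldt_nonneg in auto)
    finally show ?thesis .
  qed
  also have "\<dots> = ln (fact (2*n)) - 2 * (\<Sum>d\<in>{1..2*n}. mangoldt d * real (n div d))"
    by (simp add: ln_fact_mangoldt sum_subtractf sum_distrib_left algebra_simps)
  also have "(\<Sum>d\<in>{1..2*n}. mangoldt d * real (n div d)) = ln (fact n)"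
    unfolding ln_fact_mangoldt by (rule sum.mono_neutral_right) auto
  also have "ln (fact (2*n)) - 2 * ln (fact n :: real) = ln (real ((2*n) choose n))"
    using binomial_fact[of n "2*n", where ?'a = real] by (simp add: ln_div ln_mult)
  also have "\<dots> \<le> ln (2 ^ (2 * n))"
  proof -
    have "real (2*n choose n) \<le> 2 ^ (2*n)" 
      using binomial_le_pow2[of "2*n" n] by (metis of_nat_le_iff of_nat_numeral of_nat_power)
    moreover have "real (2*n choose n) > 0" by (simp add: zero_less_binomial)
    ultimately show ?thesis by simp
  qed
  also have "\<dots> = real n * ln 4"
    using ln_realpow[of 2 2] by (simp add: ln_realpow)
  finally show ?thesis .
qed

lemma ln4_le: "ln (4::real) \<le> 2"
  using ln_realpow[of 2 2] ln_add_one_self_le_self[of 1] by simp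

text \<open>Dyadic induction with \<open>m = n div 2\<close>: the lower half costs
  \<open>4 * m\<close> and the upper half \<open>m * ln 4 \<le> 2 * m\<close>. The slack of
  \<open>2 * m\<close> absorbs the last term of an odd \<open>n\<close>.\<close>

lemma chebyshev_upper: "(\<Sum>d\<in>{1..n}. mangoldt d) \<le> 4 * real n"
proof (induction n rule: less_induct)
  case (less n)
  show ?case
  proof (cases "n \<le> 1")
    case True
    then show ?thesis by (cases n) auto
  next
    case False
    define m where "m = n div 2"
    have IH: "(\<Sum>d\<in>{1..m}. mangoldt d :: real) \<le> 4 * real m" using less[of m] False by (simp add: m_def)
    have 2: "(\<Sum>d\<in>{1..2*m}. mangoldt d :: real) \<le> 6 * real m"
    proof -
      have "{1..2*m} = {1..m} \<union> {m<..2*m}" by auto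
      then have "(\<Sum>d\<in>{1..2*m}. mangoldt d :: real) = (\<Sum>d\<in>{1..m}. mangoldt d) + (\<Sum>d\<in>{m<..2*m}. mangoldt d)"
        by (simp only: sum.union_disjoint[OF finite_atLeastAtMost finite_greaterThanAtMost])
        (subst sum.union_disjoint; auto)
      moreover have "real m * ln 4 \<le> real m * 2" using ln4_le by (intro mult_left_mono) auto
      ultimately show ?thesis using IH chebyshev_step[of m] by linarith
    qed
    consider "n = 2*m" | "n = Suc (2*m)" unfolding m_def by linarith
    then show ?thesis
    proof cases
      case 1 then show ?thesis using 2 by simp
    next
      case 2
      have "mangoldt (Suc (2*m)) \<le> ln (real (Suc (2*m)))" using mangoldt_le[of "Suc (2*m)"] by simp
      also have "\<dots> \<le> 2 * real m" using ln_add_one_self_le_self[of "2 * real m"] by simp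
      finally show ?thesis using \<open>_ \<le> 6 * real m\<close> 2 by simp
    qed
  qed
qed

lemma ln_fact_ge: "ln (fact n :: real) \<ge> real n * ln (real n) - real n"
proof (induction n)
  case (Suc n)
  show ?case
  proof (cases "n = 0")
    case False
    have "ln (1 + 1 / real n) \<le> 1 / real n" by (rule ln_add_one_self_le_self) simp
    moreover have "1 + 1 / real n = real (Suc n) / real n" using False by (simp add: field_simps)
    ultimately have "ln (real (Suc n)) - ln (real n) \<le> 1 / real n" using False by (simp add: ln_div)
    then have "real n * (ln (real (Suc n)) - ln (real n)) \<le> 1" using False by (simp add: field_simps)
    moreover have "ln (fact (Suc n) :: real) = ln (real (Suc n)) + ln (fact n)" by (simp add: ln_mult)
    ultimately show ?thesis using Suc by (simp add: algebra_simps)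
  qed simp
qed simp

lemma ln_fact_le: "ln (fact n :: real) \<le> real n * ln (real n)"
proof (cases "n = 0")
  case False
  have "ln (fact n :: real) \<le> ln (real n ^ n)"
    using fact_le_power[of n, where ?'a=real] False by (subst ln_le_cancel_iff) auto
  then show ?thesis using False by (simp add: ln_realpow)
qed simp

text \<open>Replacing \<open>n div d\<close> by \<open>n / d\<close> in Legendre's formula costs at
  most the Chebyshev sum \<open>4 * n\<close>, while \<open>ln (fact n)\<close> is
  \<open>n * ln n\<close> up to an error of at most \<open>n\<close>; then divide by
  \<open>n\<close>.\<close>

lemma mertens_mangoldt:
  assumes "n \<ge> 1"
  shows "\<bar>(\<Sum>d\<in>{1..n}. mangoldt d / real d) - ln (real n)\<bar> \<le> 4"
proof -
  define M where "M = (\<Sum>d\<in>{1..n}. mangoldt d / real d :: real)"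
  have "real n * M - 4 * real n \<le> real n * M - (\<Sum>d\<in>{1..n}. mangoldt d)"
    using chebyshev_upper by simp
  also have "\<dots> = (\<Sum>d\<in>{1..n}. mangoldt d * (real n / real d - 1))"
    by (simp add: M_def sum_distrib_left sum_subtractf algebra_simps)
  also have "\<dots> \<le> ln (fact n)"
    unfolding ln_fact_mangoldt
  proof (intro sum_mono mult_left_mono mangoldt_nonneg)
    fix d assume d: "d \<in> {1..n}"
    have "n < (n div d + 1) * d" using d by (metis Suc_eq_plus1 atLeastAtMost_iff dividend_less_div_times mult_Suc not_one_le_zero neq0_conv add.commute)
    then have "real n < (real (n div d) + 1) * real d" by (metis of_nat_1 of_nat_add of_nat_less_iff of_nat_mult)
    then show "real n / real d - 1 \<le> real (n div d)" using d by (simp add: field_simps)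
  qed
  also have "\<dots> \<le> real n * ln (real n)" by (rule ln_fact_le)
  finally have "real n * (M - 4) \<le> real n * ln (real n)" by (simp add: algebra_simps)
  then have up: "M - 4 \<le> ln (real n)" using assms by simp
  have "real n * ln (real n) - real n \<le> ln (fact n)" by (rule ln_fact_ge)
  also have "\<dots> \<le> (\<Sum>d\<in>{1..n}. mangoldt d * (real n / real d))"
    unfolding ln_fact_mangoldt
    by (intro sum_mono mult_left_mono mangoldt_nonneg of_nat_div_le_of_nat)
  also have "\<dots> = real n * M" by (simp add: M_def sum_distrib_left algebra_simps)
  finally have "real n * (ln (real n) - 1) \<le> real n * M" by (simp add: algebra_simps)
  then have "ln (real n) - 1 \<le> M" using assms by simp
  with up show ?thesis unfolding M_def by linarith
qed

text \<open>Convolving \<open>chi4 * mangoldt\<close> with \<open>chi4\<close> gives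
  \<open>chi4 * ln\<close>. The inner sums \<open>A (n div d)\<close> of \<open>chi4 m / m\<close>
  differ from \<open>A n\<close> by at most \<open>d / n\<close>, which Chebyshev's bound turns into
  a total error of 4. So \<open>A n\<close> times the wanted sum is bounded, and it remains to keep
  \<open>A n\<close> away from 0.\<close>

lemma mertens_chi4_mangoldt: "\<bar>\<Sum>d\<in>{1..n}. chi4 d * mangoldt d / real d\<bar> \<le> 8"
proof (cases "n \<ge> 1")
  case True
  define A where "A = (\<lambda>k. \<Sum>m\<in>{1..k}. chi4 m / real m)"
  define S where "S = (\<Sum>d\<in>{1..n}. chi4 d * mangoldt d / real d)"
  have A_diff: "\<bar>A k - A j\<bar> \<le> 1 / real (Suc k)" if "k \<le> j" for k j
  proof -
    have "{1..j} = {1..k} \<union> {Suc k..<Suc j}" using that by auto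
    then have "A j = A k + (\<Sum>i\<in>{Suc k..<Suc j}. chi4 i / real i)"
      unfolding A_def by (simp only:) (subst sum.union_disjoint; auto)
    then show ?thesis using abs_sum_chi4_div_le[of "Suc k" "Suc j"] by simp
  qed
  have "A 2 = 1"
  proof -
    have "{1..2} = {1,2::nat}" by auto
    then show ?thesis by (simp add: A_def chi4_def)
  qed
  \<comment> \<open>The nonvanishing of L(1, chi4) in explicit form: the partial sum up to 2 is 1
    and the later terms add up to at most 1/3 in absolute value.\<close>
  have A_ge: "A n \<ge> 2/3"
  proof (cases "n = 1")
    case True then show ?thesis by (simp add: A_def chi4_def)
  next
    case False
    then have "\<bar>A 2 - A n\<bar> \<le> 1/3" using A_diff[of 2 n] \<open>n \<ge> 1\<close> by simp
    then show ?thesis using \<open>A 2 = 1\<close> by linarith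
  qed
  have "(\<Sum>i\<in>{1..n}. chi4 i * (ln (real i) / real i)) = 
      (\<Sum>i\<in>{1..n}. \<Sum>d | d dvd i. (chi4 d * mangoldt d / real d) * (chi4 (i div d) / real (i div d)))"
  proof (rule sum.cong[OF refl])
    fix i assume i: "i \<in> {1..n}"
    have "chi4 i * (ln (real i) / real i) = (\<Sum>d | d dvd i. chi4 i / real i * mangoldt d)"
      using i mangoldt_sum[of i, where ?'a = real] unfolding sum_distrib_left[symmetric] by simp
    also have "\<dots> = (\<Sum>d | d dvd i. (chi4 d * mangoldt d / real d) * (chi4 (i div d) / real (i div d)))"
    proof (rule sum.cong[OF refl])
      fix d assume "d \<in> {d. d dvd i}"
      then obtain e where e: "i = d * e" by auto
      with i have "d > 0" "e > 0" by auto
      then show "chi4 i / real i * mangoldt d = (chi4 d * mangoldt d / real d) * (chi4 (i div d) / real (i div d))"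
        by (simp add: e chi4_mult)
    qed
    finally show "chi4 i * (ln (real i) / real i) = (\<Sum>d | d dvd i. (chi4 d * mangoldt d / real d) * (chi4 (i div d) / real (i div d)))" .
  qed
  also have "\<dots> = (\<Sum>d\<in>{1..n}. \<Sum>m\<in>{1..n div d}. (chi4 d * mangoldt d / real d) * (chi4 m / real m))"
    by (rule sum_divisors_swap)
  also have "\<dots> = (\<Sum>d\<in>{1..n}. (chi4 d * mangoldt d / real d) * A (n div d))"
    by (simp add: A_def sum_distrib_left)
  also have "\<dots> = A n * S + (\<Sum>d\<in>{1..n}. (chi4 d * mangoldt d / real d) * (A (n div d) - A n))"
    unfolding S_def sum_distrib_left sum.distrib[symmetric] by (rule sum.cong) (auto simp: algebra_simps diff_divide_distrib)
  finally have eq: "A n * S = (\<Sum>i\<in>{1..n}. chi4 i * (ln (real i) / real i)) - (\<Sum>d\<in>{1..n}. (chi4 d * mangoldt d / real d) * (A (n div d) - A n))"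
    by simp
  have "\<bar>\<Sum>d\<in>{1..n}. (chi4 d * mangoldt d / real d) * (A (n div d) - A n)\<bar> \<le> (\<Sum>d\<in>{1..n}. mangoldt d / real n)"
  proof (rule order_trans[OF sum_abs sum_mono])
    fix d assume d: "d \<in> {1..n}"
    have "n < (n div d + 1) * d" using d by (metis Suc_eq_plus1 atLeastAtMost_iff dividend_less_div_times mult_Suc not_one_le_zero neq0_conv add.commute)
    then have n: "real n < real (Suc (n div d)) * real d" by (metis of_nat_less_iff of_nat_mult Suc_eq_plus1)
    have "\<bar>A (n div d) - A n\<bar> \<le> 1 / real (Suc (n div d))" by (rule A_diff) simp
    also have "\<dots> \<le> real d / real n"
      using d n by (simp add: field_simps)
    finally have *: "\<bar>A (n div d) - A n\<bar> \<le> real d / real n" .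
    have "\<bar>(chi4 d * mangoldt d / real d) * (A (n div d) - A n)\<bar> = \<bar>chi4 d\<bar> * (mangoldt d / real d) * \<bar>A (n div d) - A n\<bar>"
      by (simp add: abs_mult)
    also have "\<dots> \<le> 1 * (mangoldt d / real d) * (real d / real n)"
      using * abs_chi4_le[of d] mangoldt_nonneg[of d] by (intro mult_mono) auto
    also have "\<dots> = mangoldt d / real n" using d by simp
    finally show "\<bar>(chi4 d * mangoldt d / real d) * (A (n div d) - A n)\<bar> \<le> mangoldt d / real n" .
  qed
  also have "\<dots> \<le> 4" using chebyshev_upper[of n] True by (simp add: field_simps flip: sum_divide_distrib)
  finally have "\<bar>A n * S\<bar> \<le> ln 3 / 3 + 4" using eq sum_chi4_ln_div_le[of n] by linarith
  moreover have "ln 3 \<le> (2::real)" using ln_add_one_self_le_self[of 2] by simp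
  ultimately have "\<bar>A n\<bar> * \<bar>S\<bar> \<le> 14/3" by (simp add: abs_mult)
  moreover have "2/3 * \<bar>S\<bar> \<le> \<bar>A n\<bar> * \<bar>S\<bar>" using A_ge by (intro mult_right_mono) auto
  ultimately show ?thesis unfolding S_def by linarith
qed simp


section \<open>From von Mangoldt sums to reciprocals of primes\<close>

lemma sum_inverse_mult_pred: "n \<ge> 1 \<Longrightarrow> (\<Sum>p\<in>{2..n}. 1 / (real p * (real p - 1))) = 1 - 1 / real n"
proof (induction n rule: dec_induct)
  case (step n)
  have "1 / (real (Suc n) * (real (Suc n) - 1)) = 1 / real n - 1 / real (Suc n)"
    using step by (simp add: field_simps)
  moreover have "{2..Suc n} = insert (Suc n) {2..n}" using step by auto
  ultimately show ?case using step by simp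
qed simp

lemma sum_inverse_power_le:
  assumes "p \<ge> 2"
  shows "(\<Sum>k\<in>{2..n}. 1 / real p ^ k) \<le> 1 / (real p * (real p - 1))"
proof (cases "n \<ge> 1")
  case True
  have "(\<Sum>k\<in>{2..n}. 1 / real p ^ k) = 1 / (real p * (real p - 1)) - 1 / (real p ^ n * (real p - 1))"
    using True
  proof (induction n rule: dec_induct)
    case (step n)
    have "1 / real p ^ Suc n = 1 / (real p ^ n * (real p - 1)) - 1 / (real p ^ Suc n * (real p - 1))"
      using assms by (simp add: divide_simps)
    moreover have "{2..Suc n} = insert (Suc n) {2..n}" using step by auto
    ultimately show ?case using step by simp
  qed simp
  moreover have "1 / (real p ^ n * (real p - 1)) \<ge> 0" using assms by simp
  ultimately show ?thesis by linarith
next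
  case False
  then show ?thesis using assms by simp
qed

text \<open>All powers \<open>p ^ k\<close> with \<open>p, k \<ge> 2\<close> serve as majorant,
  prime base or not; the geometric series leaves a telescoping sum.\<close>

lemma sum_proper_primepows_le:
  "(\<Sum>d | d \<in> {2..n} \<and> primepow d \<and> \<not> prime d. 1 / real d) \<le> 1"
proof (cases "n \<ge> 1")
  case True
  have sub: "{d. d \<in> {2..n} \<and> primepow d \<and> \<not> prime d} \<subseteq> (\<lambda>(p,k). p ^ k) ` ({2..n} \<times> {2..n})"
  proof
    fix d assume d: "d \<in> {d. d \<in> {2..n} \<and> primepow d \<and> \<not> prime d}"
    then obtain p k where pk: "prime p" "k > 0" "d = p ^ k" by (auto simp: primepow_def)
    have "k \<noteq> 1" using d pk by auto
    then have "k \<ge> 2" using pk by simp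
    have "p \<ge> 2" using pk prime_ge_2_nat by auto
    have "k < p ^ k" using \<open>p \<ge> 2\<close> by (metis less_exp order_less_le_trans power_mono zero_le)
    moreover have "p \<le> p ^ k" using pk \<open>p \<ge> 2\<close> by (simp add: self_le_power)
    ultimately show "d \<in> (\<lambda>(p,k). p ^ k) ` ({2..n} \<times> {2..n})"
      using d pk \<open>p \<ge> 2\<close> \<open>k \<ge> 2\<close> by (auto intro!: image_eqI[of _ _ "(p,k)"])
  qed
  have "(\<Sum>d | d \<in> {2..n} \<and> primepow d \<and> \<not> prime d. 1 / real d) \<le> (\<Sum>d\<in>(\<lambda>(p,k). p ^ k) ` ({2..n} \<times> {2..n}). 1 / real d)"
    by (rule sum_mono2[OF _ sub]) auto
  also have "\<dots> \<le> (\<Sum>x\<in>{2..n} \<times> {2..n}. 1 / real ((\<lambda>(p,k). p ^ k) x))"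
    using sum_image_le[of "{2..n} \<times> {2..n}" "\<lambda>d. 1 / real d" "\<lambda>(p,k). p ^ k"] by (simp add: o_def)
  also have "\<dots> = (\<Sum>p\<in>{2..n}. \<Sum>k\<in>{2..n}. 1 / real p ^ k)"
    by (subst sum.cartesian_product) (simp add: case_prod_unfold)
  also have "\<dots> \<le> (\<Sum>p\<in>{2..n}. 1 / (real p * (real p - 1)))"
    by (intro sum_mono sum_inverse_power_le) auto
  also have "\<dots> \<le> 1" using sum_inverse_mult_pred[OF True] by simp
  finally show ?thesis .
next
  case False then show ?thesis by (simp add: not_le)
qed

text \<open>\<open>mangoldt d / ln d\<close> is 1 at primes and at most 1 at proper prime powers,
  whose reciprocals sum to at most 1. The weight \<open>e\<close> is general so that it can be both
  1 and \<open>chi4\<close>.\<close>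

lemma sum_primes_mangoldt:
  fixes e :: "nat \<Rightarrow> real"
  assumes "\<And>d. \<bar>e d\<bar> \<le> 1"
  shows "\<bar>(\<Sum>p | prime p \<and> p \<le> n. e p / real p) - (\<Sum>d\<in>{2..n}. e d * mangoldt d / real d * (1 / ln (real d)))\<bar> \<le> 1"
proof -
  let ?h = "\<lambda>d. e d * mangoldt d / real d * (1 / ln (real d))"
  have "(\<Sum>d\<in>{2..n}. ?h d) = (\<Sum>d | d \<in> {2..n} \<and> primepow d. ?h d)"
    by (rule sum.mono_neutral_right) (auto simp: mangoldt_def)
  also have "{d. d \<in> {2..n} \<and> primepow d} = {p. prime p \<and> p \<le> n} \<union> {d. d \<in> {2..n} \<and> primepow d \<and> \<not> prime d}"
    using prime_ge_2_nat by auto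
  also have "(\<Sum>d\<in>\<dots>. ?h d) = (\<Sum>p | prime p \<and> p \<le> n. ?h p) + (\<Sum>d | d \<in> {2..n} \<and> primepow d \<and> \<not> prime d. ?h d)"
    by (rule sum.union_disjoint) auto
  also have "(\<Sum>p | prime p \<and> p \<le> n. ?h p) = (\<Sum>p | prime p \<and> p \<le> n. e p / real p)"
  proof (rule sum.cong[OF refl])
    fix p assume p: "p \<in> {p. prime p \<and> p \<le> n}"
    then have "p \<ge> 2" using prime_ge_2_nat by auto
    then have "ln (real p) > 0" by simp
    then show "?h p = e p / real p" using p by simp
  qed
  finally have "\<bar>(\<Sum>p | prime p \<and> p \<le> n. e p / real p) - (\<Sum>d\<in>{2..n}. ?h d)\<bar> = \<bar>\<Sum>d | d \<in> {2..n} \<and> primepow d \<and> \<not> prime d. ?h d\<bar>"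
    by simp
  also have "\<dots> \<le> (\<Sum>d | d \<in> {2..n} \<and> primepow d \<and> \<not> prime d. 1 / real d)"
  proof (rule order_trans[OF sum_abs sum_mono])
    fix d assume "d \<in> {d. d \<in> {2..n} \<and> primepow d \<and> \<not> prime d}"
    then have d: "d \<ge> 2" by simp
    then have ln: "ln (real d) > 0" by simp
    have "\<bar>?h d\<bar> = \<bar>e d\<bar> * (mangoldt d / ln (real d)) * (1 / real d)"
      using d ln by (simp add: abs_mult)
    also have "\<dots> \<le> 1 * 1 * (1 / real d)"
      using assms[of d] mangoldt_le[of d] mangoldt_nonneg[of d] d ln by (intro mult_mono) auto
    finally show "\<bar>?h d\<bar> \<le> 1 / real d" by simp
  qed
  also have "\<dots> \<le> 1" by (rule sum_proper_primepows_le)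
  finally show ?thesis .
qed

lemma ln2_ge: "ln (2::real) \<ge> 1/2"
  using ln_one_minus_pos_lower_bound[of "1/2"] ln_div[of 1 "2::real"] ln_add_one_self_le_self2[of "-1/2"]
  by simp

lemma sum_ln_diff_div_ln:
  assumes "n \<ge> 2"
  shows "\<bar>(\<Sum>d\<in>{2..n}. (ln (real d) - ln (real d - 1)) / ln (real d)) - ln (ln (real n))\<bar> \<le> 4"
proof -
  define D where "D = (\<lambda>n::nat. \<Sum>d\<in>{2..n}. (ln (real d) - ln (real d - 1)) / ln (real d))"
  \<comment> \<open>\<open>D\<close> is a Riemann sum for the integral of
    \<open>1 / (t * ln t)\<close>. The lower bound carries the telescoping error
    \<open>1 / ln 2 - 1 / ln n\<close>, because the error of each step is at most
    \<open>1 / v - 1 / u\<close> for consecutive logarithms with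
    \<open>u - v \<le> 1\<close>.\<close>
  have "D n \<le> 1 + (ln (ln (real n)) - ln (ln 2)) \<and> ln (ln (real n)) - ln (ln 2) + 1 - (1 / ln 2 - 1 / ln (real n)) \<le> D n"
    using assms
  proof (induction n rule: dec_induct)
    case base then show ?case by (simp add: D_def)
  next
    case (step n)
    define u v where "u = ln (real (Suc n))" and "v = ln (real n)"
    have v: "v > 0" and uv: "u > v" using step by (auto simp: u_def v_def)
    have "u - v \<le> 1 / real n"
    proof -
      have "ln (1 + 1 / real n) \<le> 1 / real n" by (rule ln_add_one_self_le_self) simp
      moreover have "1 + 1 / real n = real (Suc n) / real n" using step by (simp add: field_simps)
      ultimately show ?thesis using step by (simp add: ln_div u_def v_def)
    qed
    also have "\<dots> \<le> 1" using step by simp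
    finally have uv1: "u - v \<le> 1" .
    have DS: "D (Suc n) = D n + (u - v) / u" using step by (simp add: D_def sum.nat_ivl_Suc' u_def v_def)
    have "ln (v / u) \<le> v / u - 1" using v uv by (intro ln_le_minus_one) simp
    then have 1: "(u - v) / u \<le> ln u - ln v" using v uv by (simp add: ln_div diff_divide_distrib)
    have "ln (u / v) \<le> u / v - 1" using v uv by (intro ln_le_minus_one) simp
    then have 2: "ln u - ln v \<le> (u - v) / v" using v uv by (simp add: ln_div diff_divide_distrib)
    have "(u - v) * (1 / v - 1 / u) \<le> 1 * (1 / v - 1 / u)"
      using v uv uv1 by (intro mult_right_mono) (auto simp: field_simps)
    moreover have "(u - v) / v - (u - v) / u = (u - v) * (1 / v - 1 / u)" by (simp add: algebra_simps)
    ultimately have 3: "(u - v) / v - (u - v) / u \<le> 1 / v - 1 / u" by (simp only: mult_1)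
    define q r where "q = (u - v) / u" and "r = (u - v) / v"
    show ?case using step.IH 1 2 3 DS unfolding u_def[symmetric] v_def[symmetric] q_def[symmetric] r_def[symmetric]
      by auto
  qed
  moreover have "1 / ln 2 \<le> (2::real)" using ln2_ge by (simp add: field_simps)
  moreover have "ln (ln 2) \<le> (0::real)" using ln_add_one_self_le_self[of 1] ln2_ge by (simp add: ln_le_zero_iff)
  moreover have "- ln (ln 2) \<le> (1::real)"
  proof -
    have "ln (1 / ln 2) \<le> 1 / ln 2 - (1::real)" using ln2_ge by (intro ln_le_minus_one) auto
    then show ?thesis using \<open>1 / ln 2 \<le> 2\<close> ln2_ge by (simp add: ln_div)
  qed
  moreover have "1 / ln (real n) \<ge> 0" using assms by simp
  ultimately have "\<bar>D n - ln (ln (real n))\<bar> \<le> 4" by - (elim conjE, linarith)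
  then show ?thesis by (simp add: D_def)
qed

theorem mertens_primes:
  assumes "n \<ge> 2"
  shows "\<bar>(\<Sum>p | prime p \<and> p \<le> n. 1 / real p) - ln (ln (real n))\<bar> \<le> 13"
proof -
  \<comment> \<open>Subtracting the increments of \<open>ln\<close> makes the partial sums bounded,
    so summation by parts with the weight \<open>1 / ln d\<close> applies. The final 13 is 8 from
    here, 1 from prime powers and 4 from the Riemann sum.\<close>
  define g where "g = (\<lambda>d. mangoldt d / real d - (ln (real d) - ln (real d - 1)))"
  have "\<bar>\<Sum>d\<in>{2..<Suc n}. g d * (1 / ln (real d))\<bar> \<le> 4 * (1 / ln (real 2))"
  proof (rule abs_sum_mult_antimono_le)
    fix n :: nat
    show "\<bar>\<Sum>i\<in>{2..<n}. g i\<bar> \<le> 4"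
    proof (cases "n \<ge> 2")
      case True
      then obtain m where m: "n = Suc m" "m \<ge> 1" by (cases n) auto
      have "{1..m} = insert 1 {2..<n}" using m by auto
      then have "(\<Sum>d\<in>{2..<n}. mangoldt d / real d) = (\<Sum>d\<in>{1..m}. mangoldt d / real d :: real)" by simp
      moreover have "(\<Sum>d\<in>{2..<Suc m}. ln (real d) - ln (real d - 1)) = ln (real m)"
        using m(2) by (induction m rule: dec_induct) (auto)
      ultimately show ?thesis using mertens_mangoldt[OF m(2)] m unfolding g_def by (simp add: sum_subtractf)
    qed simp
  next
    fix i :: nat assume "2 \<le> i"
    then have "0 < ln (real i)" "ln (real i) \<le> ln (real (Suc i))" by auto
    then show "1 / ln (real (Suc i)) \<le> 1 / ln (real i)" by (intro frac_le) auto
  qed auto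
  also have "\<dots> \<le> 8" using ln2_ge by (simp add: field_simps)
  finally have "\<bar>\<Sum>d\<in>{2..n}. g d * (1 / ln (real d))\<bar> \<le> 8" 
    by (simp add: atLeastLessThanSuc_atLeastAtMost)
  then have 1: "\<bar>(\<Sum>d\<in>{2..n}. mangoldt d / real d * (1 / ln (real d))) - (\<Sum>d\<in>{2..n}. (ln (real d) - ln (real d - 1)) / ln (real d))\<bar> \<le> 8"
    unfolding g_def by (simp add: sum_subtractf diff_divide_distrib)
  have 2: "\<bar>(\<Sum>p | prime p \<and> p \<le> n. 1 / real p) - (\<Sum>d\<in>{2..n}. mangoldt d / real d * (1 / ln (real d)))\<bar> \<le> 1"
    using sum_primes_mangoldt[of "\<lambda>_. 1" n] by simp
  show ?thesis using 1 2 sum_ln_diff_div_ln[OF assms] by linarith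
qed

theorem mertens_primes_chi4: "\<bar>\<Sum>p | prime p \<and> p \<le> n. chi4 p / real p\<bar> \<le> 17"
proof -
  have "\<bar>\<Sum>d\<in>{2..<Suc n}. (chi4 d * mangoldt d / real d) * (1 / ln (real d))\<bar> \<le> 8 * (1 / ln (real 2))"
  proof (rule abs_sum_mult_antimono_le)
    fix n :: nat
    show "\<bar>\<Sum>i\<in>{2..<n}. chi4 i * mangoldt i / real i\<bar> \<le> 8"
    proof (cases "n \<ge> 2")
      case True
      then obtain m where m: "n = Suc m" "m \<ge> 1" by (cases n) auto
      have "{1..m} = insert 1 {2..<n}" using m by auto
      then have "(\<Sum>d\<in>{2..<n}. chi4 d * mangoldt d / real d) = (\<Sum>d\<in>{1..m}. chi4 d * mangoldt d / real d :: real)" by simp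
      then show ?thesis using mertens_chi4_mangoldt[of m] by simp
    qed simp
  next
    fix i :: nat assume "2 \<le> i"
    then have "0 < ln (real i)" "ln (real i) \<le> ln (real (Suc i))" by auto
    then show "1 / ln (real (Suc i)) \<le> 1 / ln (real i)" by (intro frac_le) auto
  qed auto
  also have "\<dots> \<le> 16" using ln2_ge by (simp add: field_simps)
  finally have "\<bar>\<Sum>d\<in>{2..n}. (chi4 d * mangoldt d / real d) * (1 / ln (real d))\<bar> \<le> 16" 
    by (simp add: atLeastLessThanSuc_atLeastAtMost)
  then show ?thesis using sum_primes_mangoldt[of chi4 n, OF abs_chi4_le] by linarith
qed

lemma sum_primes_eq_1_3:
  "(\<Sum>p | prime p \<and> p \<le> n. 1 / real p) + (\<Sum>p | prime p \<and> p \<le> n. chi4 p / real p) =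
     (if n \<ge> 2 then 1/2 else 0) + 2 * (\<Sum>p | prime p \<and> p \<le> n \<and> p mod 4 = 1. 1 / real p)"
  "(\<Sum>p | prime p \<and> p \<le> n. 1 / real p) - (\<Sum>p | prime p \<and> p \<le> n. chi4 p / real p) =
     (if n \<ge> 2 then 1/2 else 0) + 2 * (\<Sum>p | prime p \<and> p \<le> n \<and> p mod 4 = 3. 1 / real p)"
proof -
  let ?P = "{p. prime p \<and> p \<le> n}"
  have split: "(\<Sum>p\<in>?P. f p) = (if n \<ge> 2 then f 2 else 0) + (\<Sum>p | prime p \<and> p \<le> n \<and> p mod 4 = 1. f p) + (\<Sum>p | prime p \<and> p \<le> n \<and> p mod 4 = 3. f p)"
    for f :: "nat \<Rightarrow> real"
  proof -
    have P: "?P = {p. p = 2 \<and> p \<le> n} \<union> {p. prime p \<and> p \<le> n \<and> p mod 4 = 1} \<union> {p. prime p \<and> p \<le> n \<and> p mod 4 = 3}"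
    proof -
      have "p mod 4 = 1 \<or> p mod 4 = 3" if "prime p" "p \<noteq> 2" for p :: nat
        proof -
        have "odd p" using prime_odd_nat[of p] that prime_ge_2_nat[of p] by linarith
        then show ?thesis by presburger
      qed
      then show ?thesis by auto
    qed
    have "finite {p. p = 2 \<and> p \<le> n}" by simp
    then have "(\<Sum>p\<in>?P. f p) = (\<Sum>p | p = 2 \<and> p \<le> n. f p) + (\<Sum>p | prime p \<and> p \<le> n \<and> p mod 4 = 1. f p) + (\<Sum>p | prime p \<and> p \<le> n \<and> p mod 4 = 3. f p)"
      unfolding P by (subst sum.union_disjoint; (subst sum.union_disjoint)?) auto
    moreover have "{p. p = 2 \<and> p \<le> n} = (if n \<ge> 2 then {2} else {})" by auto
    ultimately show ?thesis by simp
  qed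
  have c2: "chi4 2 = 0" by (simp add: chi4_def)
  have c1: "(\<Sum>p | prime p \<and> p \<le> n \<and> p mod 4 = 1. chi4 p / real p) = (\<Sum>p | prime p \<and> p \<le> n \<and> p mod 4 = 1. 1 / real p)"
    by (rule sum.cong) (auto simp: chi4_def)
  have c3: "(\<Sum>p | prime p \<and> p \<le> n \<and> p mod 4 = 3. chi4 p / real p) = - (\<Sum>p | prime p \<and> p \<le> n \<and> p mod 4 = 3. 1 / real p)"
    unfolding sum_negf[symmetric] by (rule sum.cong) (auto simp: chi4_def)
  show "(\<Sum>p\<in>?P. 1 / real p) + (\<Sum>p\<in>?P. chi4 p / real p) =
     (if n \<ge> 2 then 1/2 else 0) + 2 * (\<Sum>p | prime p \<and> p \<le> n \<and> p mod 4 = 1. 1 / real p)"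
   "(\<Sum>p\<in>?P. 1 / real p) - (\<Sum>p\<in>?P. chi4 p / real p) =
     (if n \<ge> 2 then 1/2 else 0) + 2 * (\<Sum>p | prime p \<and> p \<le> n \<and> p mod 4 = 3. 1 / real p)"
    unfolding split[of "\<lambda>p. 1 / real p"] split[of "\<lambda>p. chi4 p / real p"] c1 c3 by (simp_all add: c2)
qed

text \<open>Half the sum and half the difference of the two estimates, since \<open>1 + chi4\<close>
  and \<open>1 - chi4\<close> pick out the classes; 16 rounds up \<open>(13 + 17 + 1/2) / 2\<close>,
  where 1/2 is the share of the prime 2.\<close>

lemma mertens_mod_4:
  assumes "n \<ge> 2"
  shows "\<bar>(\<Sum>p | prime p \<and> p \<le> n \<and> p mod 4 = 1. 1 / real p) - ln (ln (real n)) / 2\<bar> \<le> 16"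
    and "\<bar>(\<Sum>p | prime p \<and> p \<le> n \<and> p mod 4 = 3. 1 / real p) - ln (ln (real n)) / 2\<bar> \<le> 16"
  using mertens_primes[OF assms] mertens_primes_chi4[of n] sum_primes_eq_1_3[of n] assms
  by (auto simp: abs_le_iff)

section \<open>Brun's pure sieve\<close>

lemma card_residue_class:
  assumes "x < Q"
  shows "\<bar>real (card {i. i < N \<and> i mod Q = x}) - real N / real Q\<bar> \<le> 1"
proof -
  \<comment> \<open>The number of \<open>k\<close> with \<open>k * Q + x < N\<close>. As
    \<open>x < Q\<close>, the subtraction on natural numbers does not truncate.\<close>
  define c where "c = (N + Q - 1 - x) div Q"
  have Q: "Q > 0" using assms by simp
  have lt_c: "k < c \<longleftrightarrow> k * Q + x < N" for k
  proof -
    have "k < c \<longleftrightarrow> Suc k \<le> c" by auto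
    also have "\<dots> \<longleftrightarrow> Suc k * Q \<le> N + Q - 1 - x" unfolding c_def using Q by (simp add: less_eq_div_iff_mult_less_eq)
    also have "\<dots> \<longleftrightarrow> k * Q + x < N" using assms by auto
    finally show ?thesis .
  qed
  have "{i. i < N \<and> i mod Q = x} = (\<lambda>k. k * Q + x) ` {..<c}"
  proof (intro equalityI subsetI)
    fix i assume i: "i \<in> {i. i < N \<and> i mod Q = x}"
    then have "i = i div Q * Q + x" by auto
    then show "i \<in> (\<lambda>k. k * Q + x) ` {..<c}" using i lt_c by (metis (mono_tags, lifting) image_eqI lessThan_iff mem_Collect_eq)
  next
    fix i assume "i \<in> (\<lambda>k. k * Q + x) ` {..<c}"
    then obtain k where "k < c" "i = k * Q + x" by auto
    then show "i \<in> {i. i < N \<and> i mod Q = x}" using iffD1[OF lt_c, of k] assms by simp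
  qed
  moreover have "inj_on (\<lambda>k. k * Q + x) {..<c}" using Q by (auto simp: inj_on_def)
  ultimately have card: "card {i. i < N \<and> i mod Q = x} = c" by (simp add: card_image)
  have "c * Q \<le> N + Q - 1 - x" unfolding c_def by simp
  then have "c * Q \<le> N + Q" by simp
  moreover have "N + Q - 1 - x < (c + 1) * Q" unfolding c_def using Q
    by (metis Suc_eq_plus1 dividend_less_div_times mult_Suc add.commute)
  then have "N \<le> (c + 1) * Q" using assms by simp
  ultimately have "real c * real Q \<le> real N + real Q" "real N \<le> (real c + 1) * real Q"
    by (metis of_nat_add of_nat_le_iff of_nat_mult, metis of_nat_1 of_nat_add of_nat_le_iff of_nat_mult)
  then show ?thesis unfolding card using Q by (simp add: abs_le_iff field_simps)
qed

lemma card_crt: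
  assumes "finite T" "\<And>q. q \<in> T \<Longrightarrow> prime q" "\<And>q. q \<in> T \<Longrightarrow> f q < q"
  shows "\<bar>real (card {i. i < N \<and> (\<forall>q\<in>T. i mod q = f q)}) - real N / real (\<Prod>T)\<bar> \<le> 1"
proof -
  have cop: "\<forall>i\<in>T. \<forall>j\<in>T. i \<noteq> j \<longrightarrow> coprime i j"
    using assms(2) primes_coprime by blast
  obtain x where x: "x < \<Prod>T" "\<forall>i\<in>T. [x = f i] (mod i)"
    using chinese_remainder_unique_nat[of T "\<lambda>i. i" f] cop assms prime_gt_0_nat by auto
  have xq: "x mod q = f q" if "q \<in> T" for q
    using bspec[OF x(2) that] assms(3)[OF that] by (simp add: unique_euclidean_semiring_class.cong_def)
  have "(\<forall>q\<in>T. i mod q = f q) \<longleftrightarrow> i mod \<Prod>T = x" for i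
  proof -
    have "(\<forall>q\<in>T. i mod q = f q) \<longleftrightarrow> (\<forall>q\<in>T. [i = x] (mod q))"
      using xq by (auto simp: unique_euclidean_semiring_class.cong_def)
    also have "\<dots> \<longleftrightarrow> [i = x] (mod \<Prod>T)"
      using coprime_cong_prod_nat[of T "\<lambda>i. i" i x] cop assms(1)
      by (auto intro: cong_dvd_modulus_nat simp: dvd_prod_eqI[OF assms(1)])
    also have "\<dots> \<longleftrightarrow> i mod \<Prod>T = x" using x by (simp add: unique_euclidean_semiring_class.cong_def)
    finally show ?thesis .
  qed
  then show ?thesis using card_residue_class[OF x(1)] by simp
qed

text \<open>Choosing one residue from each \<open>\<Omega> q\<close> splits the count into single
  classes modulo the product of \<open>T\<close>. Each choice has error at most 1, so the total
  error is the number of choices.\<close>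

lemma card_sifted_multiples:
  assumes "finite T" "\<And>q. q \<in> T \<Longrightarrow> prime q" "\<And>q. q \<in> T \<Longrightarrow> \<Omega> q \<subseteq> {..<q}"
  shows "\<bar>real (card {i. i < N \<and> (\<forall>q\<in>T. i mod q \<in> \<Omega> q)}) - real N * (\<Prod>q\<in>T. real (card (\<Omega> q)) / real q)\<bar>
     \<le> (\<Prod>q\<in>T. real (card (\<Omega> q)))"
proof -
  let ?F = "PiE T \<Omega>"
  have fin: "finite (\<Omega> q)" if "q \<in> T" for q using assms(3)[OF that] finite_subset by blast
  have finF: "finite ?F" using assms(1) fin by (simp add: finite_PiE)
  have cardF: "card ?F = (\<Prod>q\<in>T. card (\<Omega> q))" using assms(1) by (simp add: card_PiE)
  have un: "{i. i < N \<and> (\<forall>q\<in>T. i mod q \<in> \<Omega> q)} = (\<Union>f\<in>?F. {i. i < N \<and> (\<forall>q\<in>T. i mod q = f q)})"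
  proof (intro equalityI subsetI)
    fix i assume i: "i \<in> {i. i < N \<and> (\<forall>q\<in>T. i mod q \<in> \<Omega> q)}"
    then show "i \<in> (\<Union>f\<in>?F. {i. i < N \<and> (\<forall>q\<in>T. i mod q = f q)})"
      by (auto intro!: bexI[of _ "restrict (\<lambda>q. i mod q) T"])
  qed (auto simp: PiE_iff)
  have "card {i. i < N \<and> (\<forall>q\<in>T. i mod q \<in> \<Omega> q)} = (\<Sum>f\<in>?F. card {i. i < N \<and> (\<forall>q\<in>T. i mod q = f q)})"
    unfolding un
  proof (rule card_UN_disjoint[OF finF])
    show "\<forall>f\<in>?F. \<forall>g\<in>?F. f \<noteq> g \<longrightarrow>
       {i. i < N \<and> (\<forall>q\<in>T. i mod q = f q)} \<inter> {i. i < N \<and> (\<forall>q\<in>T. i mod q = g q)} = {}"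
      by (auto simp: disjoint_iff) (metis PiE_ext)
  qed auto
  then have "real (card {i. i < N \<and> (\<forall>q\<in>T. i mod q \<in> \<Omega> q)}) - real N * (\<Prod>q\<in>T. real (card (\<Omega> q)) / real q)
     = (\<Sum>f\<in>?F. real (card {i. i < N \<and> (\<forall>q\<in>T. i mod q = f q)}) - real N / real (\<Prod>T))"
    by (simp add: sum_subtractf cardF prod_dividef of_nat_prod)
  also have "\<bar>\<dots>\<bar> \<le> (\<Sum>f\<in>?F. 1)"
  proof (rule order_trans[OF sum_abs sum_mono])
    fix f assume "f \<in> ?F"
    then show "\<bar>real (card {i. i < N \<and> (\<forall>q\<in>T. i mod q = f q)}) - real N / real (\<Prod>T)\<bar> \<le> 1"
      using assms by (intro card_crt) (auto simp: PiE_iff)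
  qed
  also have "\<dots> = (\<Prod>q\<in>T. real (card (\<Omega> q)))" by (simp add: cardF)
  finally show ?thesis .
qed

lemma prod_one_plus:
  fixes u :: "'a \<Rightarrow> real"
  assumes "finite P"
  shows "(\<Prod>q\<in>P. 1 + u q) = (\<Sum>T\<in>Pow P. \<Prod>q\<in>T. u q)"
  using prod_add[OF assms, of u "\<lambda>_. 1"] by (simp add: add.commute)

lemma sum_alternating_binomial:
  "(\<Sum>j\<le>J. (-1) ^ j * real (Suc r choose j)) = (-1) ^ J * real (r choose J)"
  by (induction J) (auto simp: algebra_simps)

text \<open>For nonempty \<open>R\<close> the truncated alternating sum collapses to
  \<open>(-1) ^ J\<close> times a binomial coefficient, which is nonnegative for even
  \<open>J\<close>.\<close>

lemma bonferroni_upper: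
  assumes "finite R" "even J"
  shows "(if R = {} then 1 else 0) \<le> (\<Sum>T | T \<subseteq> R \<and> card T \<le> J. (-1::real) ^ card T)"
proof -
  have "(\<Sum>T | T \<subseteq> R \<and> card T \<le> J. (-1::real) ^ card T) = (\<Sum>j\<le>J. \<Sum>T | T \<subseteq> R \<and> card T = j. (-1) ^ card T)"
  proof -
    have "{T. T \<subseteq> R \<and> card T \<le> J} = (\<Union>j\<in>{..J}. {T. T \<subseteq> R \<and> card T = j})" by auto
    moreover have "finite {T. T \<subseteq> R \<and> card T = j}" for j using assms by simp
    ultimately show ?thesis by (simp only:) (rule sum.UNION_disjoint, auto)
  qed
  also have "\<dots> = (\<Sum>j\<le>J. (-1) ^ j * real (card R choose j))"
  proof (rule sum.cong[OF refl])
    fix j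
    show "(\<Sum>T | T \<subseteq> R \<and> card T = j. (-1) ^ card T) = (-1) ^ j * real (card R choose j)"
      using n_subsets[OF assms(1), of j] by simp
  qed
  finally have eq: "(\<Sum>T | T \<subseteq> R \<and> card T \<le> J. (-1::real) ^ card T) = (\<Sum>j\<le>J. (-1) ^ j * real (card R choose j))" .
  show ?thesis
  proof (cases "R = {}")
    case True
    have "(\<Sum>j\<le>J. (-1) ^ j * real (0 choose j)) = (\<Sum>j\<in>{0}. (-1) ^ j * real (0 choose j))"
      by (rule sum.mono_neutral_right) auto
    then show ?thesis unfolding eq using True by simp
  next
    case False
    then obtain r where "card R = Suc r" using assms by (metis card_0_eq not0_implies_Suc)
    then show ?thesis unfolding eq using False assms sum_alternating_binomial[of r J] by simp
  qed
qed

text \<open>Both error terms of Brun's pure sieve are estimated by Rankin's trick: subsets with more than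
  \<open>J\<close> elements get the weight \<open>exp (card T - J)\<close>, those with at most \<open>J\<close> the weight \<open>w ^ (J - card T)\<close>.\<close>

lemma brun_pure_sieve:
  fixes P :: "nat set" and w :: real
  assumes P: "finite P" "\<And>q. q \<in> P \<Longrightarrow> prime q" and \<Omega>: "\<And>q. q \<in> P \<Longrightarrow> \<Omega> q \<subseteq> {..<q}"
    and J: "even J" and w: "w \<ge> 1" "(\<Sum>q\<in>P. real (card (\<Omega> q))) \<le> w"
  defines "V \<equiv> \<Sum>q\<in>P. real (card (\<Omega> q)) / real q"
  shows "real (card {i. i < N \<and> (\<forall>q\<in>P. i mod q \<notin> \<Omega> q)})
     \<le> real N * exp (- V) + real N * exp (exp 1 * V - real J) + exp 1 * w ^ J"
proof -
  define \<rho> where "\<rho> = (\<lambda>q. real (card (\<Omega> q)))"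
  define x where "x = (\<lambda>q. \<rho> q / real q)"
  define c where "c = (\<lambda>T. card {i. i < N \<and> (\<forall>q\<in>T. i mod q \<in> \<Omega> q)})"
  define B where "B = {T. T \<subseteq> P \<and> card T \<le> J}"
  have finB: "finite B" unfolding B_def using P by simp
  have B_sub: "B \<subseteq> Pow P" unfolding B_def by auto
  have \<rho>0: "\<rho> q \<ge> 0" for q by (simp add: \<rho>_def)
  have x0: "x q \<ge> 0" for q by (simp add: x_def \<rho>_def)
  have V: "V = (\<Sum>q\<in>P. x q)" by (simp add: V_def x_def \<rho>_def)
  have x1: "x q \<le> 1" if "q \<in> P" for q
  proof -
    have "card (\<Omega> q) \<le> q" using card_mono[OF _ \<Omega>[OF that]] by simp
    then show ?thesis using P(2)[OF that] prime_gt_0_nat by (simp add: x_def \<rho>_def)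
  qed
  have "real (card {i. i < N \<and> (\<forall>q\<in>P. i mod q \<notin> \<Omega> q)}) =
      (\<Sum>i<N. if {q\<in>P. i mod q \<in> \<Omega> q} = {} then 1 else 0)"
  proof -
    have "{i. i < N \<and> (\<forall>q\<in>P. i mod q \<notin> \<Omega> q)} = {i\<in>{..<N}. {q\<in>P. i mod q \<in> \<Omega> q} = {}}" by auto
    then show ?thesis by (simp only: sum.If_cases finite_lessThan) (simp add: Int_def)
  qed
  also have "\<dots> \<le> (\<Sum>i<N. \<Sum>T | T \<subseteq> {q\<in>P. i mod q \<in> \<Omega> q} \<and> card T \<le> J. (-1) ^ card T)"
    using P J by (intro sum_mono bonferroni_upper) auto
  also have "\<dots> = (\<Sum>i<N. \<Sum>T\<in>B. if \<forall>q\<in>T. i mod q \<in> \<Omega> q then (-1) ^ card T else 0)"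
  proof (rule sum.cong[OF refl])
    fix i
    have "{T. T \<subseteq> {q\<in>P. i mod q \<in> \<Omega> q} \<and> card T \<le> J} = {T\<in>B. \<forall>q\<in>T. i mod q \<in> \<Omega> q}"
      unfolding B_def by auto
    then show "(\<Sum>T | T \<subseteq> {q\<in>P. i mod q \<in> \<Omega> q} \<and> card T \<le> J. (-1::real) ^ card T)
       = (\<Sum>T\<in>B. if \<forall>q\<in>T. i mod q \<in> \<Omega> q then (-1) ^ card T else 0)"
      using finB by (simp add: sum.inter_filter)
  qed
  also have "\<dots> = (\<Sum>T\<in>B. \<Sum>i<N. if \<forall>q\<in>T. i mod q \<in> \<Omega> q then (-1) ^ card T else 0)"
    by (rule sum.swap)
  also have "\<dots> = (\<Sum>T\<in>B. (-1) ^ card T * real (c T))"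
  proof (rule sum.cong[OF refl])
    fix T
    have "c T = card {i\<in>{..<N}. \<forall>q\<in>T. i mod q \<in> \<Omega> q}" by (simp add: c_def)
    then show "(\<Sum>i<N. if \<forall>q\<in>T. i mod q \<in> \<Omega> q then (-1::real) ^ card T else 0) = (-1) ^ card T * real (c T)"
      by (simp flip: sum.inter_filter)
  qed
  also have "\<dots> \<le> (\<Sum>T\<in>B. (-1) ^ card T * (real N * (\<Prod>q\<in>T. x q)) + (\<Prod>q\<in>T. \<rho> q))"
  proof (rule sum_mono)
    fix T assume T: "T \<in> B"
    then have "finite T" using B_sub P(1) by (auto intro: finite_subset)
    have "T \<subseteq> P" using T B_sub by auto
    have "\<bar>real (c T) - real N * (\<Prod>q\<in>T. x q)\<bar> \<le> (\<Prod>q\<in>T. \<rho> q)"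
      unfolding c_def x_def \<rho>_def
      by (intro card_sifted_multiples) (use \<open>finite T\<close> \<open>T \<subseteq> P\<close> P \<Omega> in blast)+
    moreover have "(-1::real) ^ card T = 1 \<or> (-1::real) ^ card T = -1" by (cases "even (card T)") auto
    ultimately show "(-1) ^ card T * real (c T) \<le> (-1) ^ card T * (real N * (\<Prod>q\<in>T. x q)) + (\<Prod>q\<in>T. \<rho> q)"
      by (auto simp: abs_le_iff)
  qed
  also have "\<dots> = real N * (\<Sum>T\<in>B. (-1) ^ card T * (\<Prod>q\<in>T. x q)) + (\<Sum>T\<in>B. \<Prod>q\<in>T. \<rho> q)"
    by (simp add: sum.distrib sum_distrib_left algebra_simps)
  finally have main: "real (card {i. i < N \<and> (\<forall>q\<in>P. i mod q \<notin> \<Omega> q)})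
     \<le> real N * (\<Sum>T\<in>B. (-1) ^ card T * (\<Prod>q\<in>T. x q)) + (\<Sum>T\<in>B. \<Prod>q\<in>T. \<rho> q)" .
  have sum1: "(\<Sum>T\<in>B. (-1) ^ card T * (\<Prod>q\<in>T. x q)) \<le> exp (- V) + exp (exp 1 * V - real J)"
  proof -
    have "(\<Sum>T\<in>Pow P. (-1) ^ card T * (\<Prod>q\<in>T. x q)) = (\<Prod>q\<in>P. 1 - x q)"
      using prod_one_plus[OF P(1), of "\<lambda>q. - x q"] by (simp add: prod_uminus)
    also have "\<dots> \<le> (\<Prod>q\<in>P. exp (- x q))"
    proof (rule prod_mono)
      fix q assume "q \<in> P"
      then show "0 \<le> 1 - x q \<and> 1 - x q \<le> exp (- x q)" using x1 exp_ge_add_one_self[of "- x q"] by auto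
    qed
    also have "\<dots> = exp (- V)" unfolding V sum_negf[symmetric] by (rule exp_sum[symmetric]) fact
    finally have 1: "(\<Sum>T\<in>Pow P. (-1) ^ card T * (\<Prod>q\<in>T. x q)) \<le> exp (- V)" .
    have "- (\<Sum>T\<in>Pow P - B. (-1) ^ card T * (\<Prod>q\<in>T. x q)) \<le> (\<Sum>T\<in>Pow P - B. exp (- real J) * (\<Prod>q\<in>T. exp 1 * x q))"
      unfolding sum_negf[symmetric]
    proof (rule sum_mono)
      fix T assume T: "T \<in> Pow P - B"
      have "(-1::real) ^ card T = 1 \<or> (-1::real) ^ card T = -1" by (cases "even (card T)") auto
      moreover have p0: "(\<Prod>q\<in>T. x q) \<ge> 0" using x0 by (intro prod_nonneg) auto
      ultimately have "- ((-1) ^ card T * (\<Prod>q\<in>T. x q)) \<le> (\<Prod>q\<in>T. x q)" by auto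
      also have "\<dots> \<le> exp (real (card T) - real J) * (\<Prod>q\<in>T. x q)"
        using T p0 by (auto simp: B_def mult_le_cancel_right1)
      also have "\<dots> = exp (- real J) * (\<Prod>q\<in>T. exp 1 * x q)"
        using exp_of_nat_mult[of "card T" "1::real"]
        by (simp add: prod.distrib diff_conv_add_uminus exp_add mult.commute mult.assoc del: add_uminus_conv_diff)
      finally show "- ((-1) ^ card T * (\<Prod>q\<in>T. x q)) \<le> exp (- real J) * (\<Prod>q\<in>T. exp 1 * x q)" .
    qed
    also have "\<dots> \<le> (\<Sum>T\<in>Pow P. exp (- real J) * (\<Prod>q\<in>T. exp 1 * x q))"
      using P x0 by (intro sum_mono2) (auto intro!: mult_nonneg_nonneg prod_nonneg)
    also have "\<dots> = exp (- real J) * (\<Prod>q\<in>P. 1 + exp 1 * x q)"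
      using prod_one_plus[OF P(1), of "\<lambda>q. exp 1 * x q"] by (simp add: sum_distrib_left)
    also have "\<dots> \<le> exp (- real J) * (\<Prod>q\<in>P. exp (exp 1 * x q))"
      using x0 by (intro mult_left_mono prod_mono) auto
    also have "\<dots> = exp (exp 1 * V - real J)"
      unfolding V sum_distrib_left diff_conv_add_uminus exp_add exp_sum[OF P(1)] by (rule mult.commute)
    finally have 2: "- (\<Sum>T\<in>Pow P - B. (-1) ^ card T * (\<Prod>q\<in>T. x q)) \<le> exp (exp 1 * V - real J)" .
    have "(\<Sum>T\<in>Pow P. (-1) ^ card T * (\<Prod>q\<in>T. x q)) = (\<Sum>T\<in>Pow P - B. (-1) ^ card T * (\<Prod>q\<in>T. x q)) + (\<Sum>T\<in>B. (-1) ^ card T * (\<Prod>q\<in>T. x q))"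
      using P B_sub by (intro sum.subset_diff) auto
    then show ?thesis using 1 2 by linarith
  qed
  have sum2: "(\<Sum>T\<in>B. \<Prod>q\<in>T. \<rho> q) \<le> exp 1 * w ^ J"
  proof -
    have "(\<Sum>T\<in>B. \<Prod>q\<in>T. \<rho> q) \<le> (\<Sum>T\<in>B. w ^ J * (\<Prod>q\<in>T. \<rho> q / w))"
    proof (rule sum_mono)
      fix T assume T: "T \<in> B"
      have "(\<Prod>q\<in>T. \<rho> q) = w ^ card T * (\<Prod>q\<in>T. \<rho> q / w)" using w by (simp add: prod_dividef)
      also have "\<dots> \<le> w ^ J * (\<Prod>q\<in>T. \<rho> q / w)"
        using T w \<rho>0 by (intro mult_right_mono power_increasing prod_nonneg) (auto simp: B_def)
      finally show "(\<Prod>q\<in>T. \<rho> q) \<le> w ^ J * (\<Prod>q\<in>T. \<rho> q / w)" .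
    qed
    also have "\<dots> \<le> (\<Sum>T\<in>Pow P. w ^ J * (\<Prod>q\<in>T. \<rho> q / w))"
      using P B_sub w \<rho>0 by (intro sum_mono2) (auto intro!: mult_nonneg_nonneg prod_nonneg)
    also have "\<dots> = w ^ J * (\<Prod>q\<in>P. 1 + \<rho> q / w)"
      using prod_one_plus[OF P(1), of "\<lambda>q. \<rho> q / w"] by (simp add: sum_distrib_left)
    also have "\<dots> \<le> w ^ J * (\<Prod>q\<in>P. exp (\<rho> q / w))"
      using \<rho>0 w by (intro mult_left_mono prod_mono) auto
    also have "\<dots> = w ^ J * exp ((\<Sum>q\<in>P. \<rho> q) / w)"
      unfolding sum_divide_distrib exp_sum[OF P(1)] ..
    also have "\<dots> \<le> w ^ J * exp 1" using w by (intro mult_left_mono) (auto simp: \<rho>_def)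
    finally show ?thesis by (simp add: mult.commute)
  qed
  show ?thesis
    using main sum2 mult_left_mono[OF sum1, of "real N"] by (simp add: distrib_left)
qed

section \<open>The sieve with different local densities at the primes 1 and 3 modulo 4\<close>

lemma sum_inverse_primes_le:
  assumes "finite E" "\<And>q. q \<in> E \<Longrightarrow> prime q" "real (card E) \<le> G * y" "y \<ge> 2"
  shows "(\<Sum>q\<in>E. 1 / real q) \<le> ln (ln y) + 13 + G"
proof -
  define n where "n = nat \<lfloor>y\<rfloor>"
  have n: "n \<ge> 2" "real n \<le> y" using assms(4) by (auto simp: n_def le_nat_iff le_floor_iff)
  have n_iff: "q \<le> n \<longleftrightarrow> real q \<le> y" for q using assms(4) by (auto simp: n_def le_nat_iff le_floor_iff)
  \<comment> \<open>Primes up to \<open>y\<close> cost at most the whole Mertens sum, the others at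
    most \<open>card E / y \<le> G\<close>. With \<open>y = ln x\<close>, a set of
    \<open>O(ln x)\<close> primes thus costs only \<open>ln (ln (ln x)) + O(1)\<close>.\<close>
  have "(\<Sum>q\<in>E. 1 / real q) = (\<Sum>q\<in>{q\<in>E. q \<le> n}. 1 / real q) + (\<Sum>q\<in>{q\<in>E. \<not> q \<le> n}. 1 / real q)"
  proof -
    have "E = {q\<in>E. q \<le> n} \<union> {q\<in>E. \<not> q \<le> n}" by auto
    then show ?thesis using assms(1) by (subst (1) \<open>E = _\<close>, subst sum.union_disjoint) auto
  qed
  also have "(\<Sum>q\<in>{q\<in>E. q \<le> n}. 1 / real q) \<le> (\<Sum>p | prime p \<and> p \<le> n. 1 / real p)"
    by (rule sum_mono2) (use assms(2) in auto)
  also have "\<dots> \<le> ln (ln (real n)) + 13" using mertens_primes[OF n(1)] by (simp add: abs_le_iff)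
  also have "\<dots> \<le> ln (ln y) + 13" using n by (simp add: ln_mono)
  also have "(\<Sum>q\<in>{q\<in>E. \<not> q \<le> n}. 1 / real q) \<le> (\<Sum>q\<in>{q\<in>E. \<not> q \<le> n}. 1 / y)"
    using assms(4) by (intro sum_mono) (auto simp: n_iff frac_le)
  also have "\<dots> \<le> (\<Sum>q\<in>E. 1 / y)" using assms by (intro sum_mono2) auto
  also have "\<dots> \<le> G" using assms(3,4) by (simp add: field_simps)
  finally show ?thesis by (simp add: algebra_simps)
qed

lemma sieve_mod_4:
  fixes l :: nat and \<eta> G :: real
  assumes l: "l \<ge> 1" and \<eta>: "\<eta> > 0"
  obtains K A x0 :: real where "K > 0" "A > 0"
    "\<And>x N E \<Omega>. \<lbrakk>x \<ge> x0; exp (\<eta> * ln x / (2 * ln (ln x))) \<le> real N; finite E; \<And>q. q \<in> E \<Longrightarrow> prime q;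
        real (card E) \<le> G * ln x;
        \<And>q. \<lbrakk>prime q; odd q; real q < exp (\<eta> * ln x / ln (ln x)); q \<notin> E\<rbrakk> \<Longrightarrow>
           \<Omega> q \<subseteq> {..<q} \<and> (if q mod 4 = 1 then 2 else l - 1) \<le> card (\<Omega> q)\<rbrakk> \<Longrightarrow>
      real (card {i. i < N \<and> (\<forall>q. prime q \<and> odd q \<and> real q < exp (\<eta> * ln x / ln (ln x)) \<and> q \<notin> E \<longrightarrow> i mod q \<notin> \<Omega> q)})
        \<le> K * real N * ln (ln x) powr A / ln x powr ((real l + 1) / 2)"
proof -
  \<comment> \<open>\<open>\<kappa>\<close> is twice the sieve dimension. The 48 is fitted to
    \<open>J \<le> 6 * \<kappa> * L\<close> and \<open>w \<le> z\<^sup>2\<close> below: it gives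
    \<open>w ^ J \<le> exp (\<eta> * ln x / (4 * L))\<close>, the square root of the assumed lower
    bound for \<open>N\<close>.\<close>
  define \<kappa> where "\<kappa> = real l + 1"
  define \<zeta> where "\<zeta> = \<eta> / (48 * \<kappa>)"
  have \<kappa>: "\<kappa> \<ge> 2" using l by (simp add: \<kappa>_def)
  have \<zeta>: "\<zeta> > 0" "\<zeta> < \<eta>" using \<kappa> \<eta> by (auto simp: \<zeta>_def field_simps)
  define B where "B = \<kappa> * (30 + \<bar>G\<bar> + \<bar>ln \<zeta>\<bar>)"
  define K where "K = exp B + exp (39 * \<kappa>) + 1"
  \<comment> \<open>One \<open>\<kappa>\<close> pays for sifting only up to \<open>z\<close> with
    \<open>ln z = \<zeta> * ln x / L\<^sup>2\<close>, the other for omitting the exceptional primes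
    \<open>E\<close>.\<close>
  define A where "A = 2 * \<kappa>"
  have "eventually (\<lambda>x::real. ln (ln x) \<ge> 1) at_top" by real_asymp
  moreover have "eventually (\<lambda>x::real. ln x \<ge> 2) at_top" by real_asymp
  moreover have "eventually (\<lambda>x::real. \<zeta> * ln x / ln (ln x) ^ 2 \<ge> ln (\<kappa> + 4)) at_top"
    using \<zeta> by real_asymp
  moreover have "eventually (\<lambda>x::real. 1 + \<kappa> / 2 * ln (ln x) \<le> \<eta> * ln x / (4 * ln (ln x))) at_top"
    using \<eta> by real_asymp
  moreover have "eventually (\<lambda>x::real. \<zeta> \<le> ln (ln x) ^ 2) at_top" by real_asymp
  ultimately have "eventually (\<lambda>x::real. \<zeta> \<le> ln (ln x) ^ 2 \<and> ln (ln x) \<ge> 1 \<and> ln x \<ge> 2 \<and> \<zeta> * ln x / ln (ln x) ^ 2 \<ge> ln (\<kappa> + 4)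
     \<and> 1 + \<kappa> / 2 * ln (ln x) \<le> \<eta> * ln x / (4 * ln (ln x))) at_top"
    by eventually_elim auto
  then obtain x0 where x0: "\<And>x. x \<ge> x0 \<Longrightarrow> \<zeta> \<le> ln (ln x) ^ 2 \<and> ln (ln x) \<ge> 1 \<and> ln x \<ge> 2 \<and> \<zeta> * ln x / ln (ln x) ^ 2 \<ge> ln (\<kappa> + 4)
     \<and> 1 + \<kappa> / 2 * ln (ln x) \<le> \<eta> * ln x / (4 * ln (ln x))"
    unfolding eventually_at_top_linorder by blast
  show ?thesis
  proof (rule that[of K A x0])
    show "K > 0" unfolding K_def by (intro add_pos_pos) auto
    show "A > 0" using \<kappa> by (simp add: A_def)
    fix x :: real and N :: nat and E :: "nat set" and \<Omega> :: "nat \<Rightarrow> nat set"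
    assume x: "x \<ge> x0" and N: "exp (\<eta> * ln x / (2 * ln (ln x))) \<le> real N" and E: "finite E" "\<And>q. q \<in> E \<Longrightarrow> prime q"
      and cardE: "real (card E) \<le> G * ln x"
      and \<Omega>: "\<And>q. \<lbrakk>prime q; odd q; real q < exp (\<eta> * ln x / ln (ln x)); q \<notin> E\<rbrakk> \<Longrightarrow>
           \<Omega> q \<subseteq> {..<q} \<and> (if q mod 4 = 1 then 2 else l - 1) \<le> card (\<Omega> q)"
    define L where "L = ln (ln x)"
    define u where "u = ln x"
    have c3: "\<zeta> \<le> L ^ 2" and L1: "L \<ge> 1" and u2: "u \<ge> 2" and c1: "\<zeta> * u / L ^ 2 \<ge> ln (\<kappa> + 4)" and c2: "1 + \<kappa> / 2 * L \<le> \<eta> * u / (4 * L)"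
      using x0[OF x] by (auto simp: L_def u_def)
    have Lu: "L = ln u" by (simp add: L_def u_def)
    define z where "z = exp (\<zeta> * u / L ^ 2)"
    have z: "z \<ge> \<kappa> + 4" 
    proof -
      have "exp (ln (\<kappa> + 4)) \<le> z" unfolding z_def using c1 by simp
      then show ?thesis using \<kappa> by simp
    qed
    have z0: "z > 0" "z \<ge> 6" using z \<kappa> by linarith+
    have zY: "z < exp (\<eta> * u / L)"
    proof -
      have "\<zeta> * u / L ^ 2 \<le> \<zeta> * u / L" using L1 \<zeta> u2 by (intro divide_left_mono) (auto simp: power2_eq_square)
      also have "\<dots> < \<eta> * u / L" using \<zeta> L1 u2 by (intro divide_strict_right_mono) auto
      finally show ?thesis by (simp add: z_def)
    qed
    define n where "n = nat \<lfloor>z\<rfloor>"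
    have n_iff: "q \<le> n \<longleftrightarrow> real q \<le> z" for q using z0 z \<kappa> by (auto simp: n_def le_nat_iff le_floor_iff)
    have n2: "n \<ge> 2" "real n \<le> z" using n_iff[of 2] n_iff[of n] z \<kappa> by auto
    have nz: "real n \<ge> z / 2" using z0 z \<kappa> unfolding n_def by linarith
    define P where "P = {q. prime q \<and> odd q \<and> q \<le> n \<and> q \<notin> E}"
    have finP: "finite P" by (simp add: P_def)
    define r where "r = (\<lambda>q::nat. if q mod 4 = 1 then 2 else l - 1)"
    \<comment> \<open>Forbidding fewer residues only enlarges the sifted set. With exactly
      \<open>r q\<close> residues at each prime, Mertens' estimates bound \<open>V\<close> from both
      sides, and the truncation error needs the upper bound.\<close>
    have "\<forall>q\<in>P. \<exists>S. S \<subseteq> \<Omega> q \<and> card S = r q"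
    proof
      fix q assume "q \<in> P"
      then have "r q \<le> card (\<Omega> q)" using \<Omega>[of q] zY n_iff[of q] by (auto simp: P_def r_def L_def u_def)
      then show "\<exists>S. S \<subseteq> \<Omega> q \<and> card S = r q" by (meson obtain_subset_with_card_n)
    qed
    then obtain \<Omega>' where \<Omega>': "\<And>q. q \<in> P \<Longrightarrow> \<Omega>' q \<subseteq> \<Omega> q \<and> card (\<Omega>' q) = r q" by metis
    have r_le: "real (r q) \<le> \<kappa>" for q using l by (auto simp: r_def \<kappa>_def of_nat_diff)
    define V where "V = (\<Sum>q\<in>P. real (card (\<Omega>' q)) / real q)"
    have V: "V = (\<Sum>q\<in>P. real (r q) / real q)" unfolding V_def using \<Omega>' by (intro sum.cong) auto
    have lnz: "ln (ln z) = ln \<zeta> + L - 2 * ln L"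
      using \<zeta> u2 L1 by (simp add: z_def ln_div ln_mult ln_realpow Lu)
    have lnn: "ln (ln (real n)) \<ge> ln (ln z) - 1" "ln (ln (real n)) \<le> L"
    proof -
      have "sqrt z \<le> z / 2"
      proof -
        have "2 \<le> sqrt z" using z0 z \<kappa> by (simp add: real_le_rsqrt)
        then have "2 * sqrt z \<le> sqrt z * sqrt z" using z0 by (intro mult_right_mono) auto
        then show ?thesis using z0 z \<kappa> by simp
      qed
      then have "sqrt z \<le> real n" using nz by linarith
      moreover have z1: "sqrt z > 1" using z0 z \<kappa> by simp
      ultimately have "ln (sqrt z) \<le> ln (real n)" by (intro ln_mono) auto
      then have "ln (ln (sqrt z)) \<le> ln (ln (real n))" using z1 by - (rule ln_mono, assumption, simp)
      moreover have "ln (ln (sqrt z)) = ln (ln z) - ln 2" using z0 z \<kappa> by (simp add: ln_sqrt ln_div)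
      moreover have "ln 2 \<le> (1::real)" using ln_add_one_self_le_self[of 1] by simp
      ultimately show "ln (ln (real n)) \<ge> ln (ln z) - 1" by linarith
      have "ln (real n) \<le> ln z" using n2 by simp
      also have "\<dots> \<le> u"
      proof -
        have "\<zeta> \<le> L ^ 2 * 1"
          using c3 by simp
        then have "\<zeta> * u \<le> L ^ 2 * 1 * u" using u2 by (intro mult_right_mono) auto
        then show ?thesis using L1 by (simp add: z_def field_simps)
      qed
      finally show "ln (ln (real n)) \<le> L" unfolding Lu using n2 by (intro ln_mono) auto
    qed
    have V_up: "V \<le> \<kappa> * (L + 13)"
    proof -
      have "V \<le> (\<Sum>q\<in>P. \<kappa> * (1 / real q))"
        unfolding V using r_le by (intro sum_mono) (auto intro: divide_right_mono)
      also have "\<dots> \<le> (\<Sum>q | prime q \<and> q \<le> n. \<kappa> * (1 / real q))"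
        using \<kappa> by (intro sum_mono2) (auto simp: P_def)
      also have "\<dots> = \<kappa> * (\<Sum>q | prime q \<and> q \<le> n. 1 / real q)" by (simp add: sum_distrib_left)
      also have "\<dots> \<le> \<kappa> * (L + 13)" using mertens_primes[OF n2(1)] lnn \<kappa> by (intro mult_left_mono) (auto simp: abs_le_iff)
      finally show ?thesis .
    qed
    have V_lo: "V \<ge> \<kappa> / 2 * L - 2 * \<kappa> * ln L - B"
    proof -
      let ?P1 = "{q. prime q \<and> q \<le> n \<and> q mod 4 = 1}" and ?P3 = "{q. prime q \<and> q \<le> n \<and> q mod 4 = 3}"
      have sub: "?P1 \<union> ?P3 \<subseteq> P \<union> E"
      proof -
        have "odd q" if "q mod 4 = 1 \<or> q mod 4 = 3" for q :: nat using that by presburger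
        then show ?thesis unfolding P_def by auto
      qed
      \<comment> \<open>\<open>\<kappa> - 2\<close> is \<open>l - 1\<close>. The two weights add up
        to \<open>\<kappa>\<close> and each class has half the mass, hence the main term
        \<open>\<kappa> / 2 * L\<close>.\<close>
      have "2 * (\<Sum>q\<in>?P1. 1 / real q) + (\<kappa> - 2) * (\<Sum>q\<in>?P3. 1 / real q) = (\<Sum>q\<in>?P1. real (r q) / real q) + (\<Sum>q\<in>?P3. real (r q) / real q)"
        unfolding sum_distrib_left
        by (intro arg_cong2[where f = "(+)"] sum.cong) (use l in \<open>auto simp: r_def \<kappa>_def of_nat_diff\<close>)
      also have "\<dots> = (\<Sum>q\<in>?P1 \<union> ?P3. real (r q) / real q)"
        by (rule sum.union_disjoint[symmetric]) auto
      also have "\<dots> \<le> (\<Sum>q\<in>P \<union> E. real (r q) / real q)"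
        using finP E sub by (intro sum_mono2) auto
      also have "\<dots> \<le> V + (\<Sum>q\<in>E. real (r q) / real q)"
        unfolding V using sum.union_inter[OF finP E(1), of "\<lambda>q. real (r q) / real q"] 
          sum_nonneg[of "P \<inter> E" "\<lambda>q. real (r q) / real q"] by simp
      also have "(\<Sum>q\<in>E. real (r q) / real q) \<le> (\<Sum>q\<in>E. \<kappa> * (1 / real q))"
        using r_le by (intro sum_mono) (auto intro: divide_right_mono)
      also have "\<dots> = \<kappa> * (\<Sum>q\<in>E. 1 / real q)" by (simp add: sum_distrib_left)
      also have "\<dots> \<le> \<kappa> * (ln L + 13 + G)"
        using sum_inverse_primes_le[OF E, of G u] cardE u2 \<kappa> by (intro mult_left_mono) (auto simp: u_def[symmetric] Lu)
      finally have 1: "2 * (\<Sum>q\<in>?P1. 1 / real q) + (\<kappa> - 2) * (\<Sum>q\<in>?P3. 1 / real q) \<le> V + \<kappa> * (ln L + 13 + G)"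
        by simp
      have "ln (ln (real n)) / 2 - 16 \<le> (\<Sum>q\<in>?P1. 1 / real q)" "ln (ln (real n)) / 2 - 16 \<le> (\<Sum>q\<in>?P3. 1 / real q)"
        using mertens_mod_4[OF n2(1)] unfolding abs_le_iff by linarith+
      then have "2 * (ln (ln (real n)) / 2 - 16) + (\<kappa> - 2) * (ln (ln (real n)) / 2 - 16) \<le> 
         2 * (\<Sum>q\<in>?P1. 1 / real q) + (\<kappa> - 2) * (\<Sum>q\<in>?P3. 1 / real q)"
        using \<kappa> by (intro add_mono mult_left_mono) auto
      then have "2 * (ln (ln (real n)) / 2 - 16) + (\<kappa> - 2) * (ln (ln (real n)) / 2 - 16) \<le> V + \<kappa> * (ln L + 13 + G)"
        using 1 by (rule order_trans)
      then have "\<kappa> * (ln (ln (real n)) / 2 - 16) \<le> V + \<kappa> * (ln L + 13 + G)" by (simp add: algebra_simps diff_divide_distrib)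
      moreover have "\<kappa> * ((ln \<zeta> + L - 2 * ln L - 1) / 2 - 16) \<le> \<kappa> * (ln (ln (real n)) / 2 - 16)"
        using lnn lnz \<kappa> by (intro mult_left_mono) auto
      ultimately have "\<kappa> * ((ln \<zeta> + L - 2 * ln L - 1) / 2 - 16 - ln L - 13 - G) \<le> V" by (simp add: algebra_simps)
      moreover have "\<kappa> * (L / 2 - 2 * ln L - (30 + \<bar>G\<bar> + \<bar>ln \<zeta>\<bar>)) \<le> \<kappa> * ((ln \<zeta> + L - 2 * ln L - 1) / 2 - 16 - ln L - 13 - G)"
        using \<kappa> by (intro mult_left_mono) (auto simp: field_simps)
      ultimately show ?thesis by (simp add: B_def algebra_simps)
    qed
    \<comment> \<open>Even, as the Bonferroni inequality requires, and at least
      \<open>4 * \<kappa> * L\<close>: since \<open>exp 1 * V \<le> 3 * \<kappa> * (L + 13)\<close>,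
      the truncation error is at most \<open>exp (39 * \<kappa> - \<kappa> * L)\<close>.\<close>
    define J where "J = 2 * nat \<lceil>2 * \<kappa> * L\<rceil>"
    have "2 * \<kappa> * L \<ge> 0" using \<kappa> L1 by simp
    then have J_lo: "real J \<ge> 4 * \<kappa> * L" and J_up': "real J \<le> 4 * \<kappa> * L + 2" unfolding J_def by linarith+
    have "2 * 1 \<le> \<kappa> * L" using \<kappa> L1 by (intro mult_mono) auto
    then have J_up: "real J \<le> 6 * \<kappa> * L" using J_up' by linarith
    define w where "w = \<kappa> * z"
    have "1 * 1 \<le> \<kappa> * z" using z0 \<kappa> z by (intro mult_mono) auto
    then have w1: "w \<ge> 1" by (simp add: w_def)
    have w2: "(\<Sum>q\<in>P. real (card (\<Omega>' q))) \<le> w"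
    proof -
      have "(\<Sum>q\<in>P. real (card (\<Omega>' q))) \<le> (\<Sum>q\<in>P. \<kappa>)" using \<Omega>' r_le by (intro sum_mono) auto
      also have "\<dots> = \<kappa> * real (card P)" by simp
      also have "\<dots> \<le> \<kappa> * real n"
      proof -
        have "P \<subseteq> {1..n}" using prime_gt_0_nat by (auto simp: P_def Suc_le_eq)
        then have "card P \<le> n" using card_mono[of "{1..n}" P] by simp
        then show ?thesis using \<kappa> by (intro mult_left_mono) auto
      qed
      also have "\<dots> \<le> w" unfolding w_def using n2 \<kappa> by (intro mult_left_mono) auto
      finally show ?thesis .
    qed
    let ?S = "{i. i < N \<and> (\<forall>q. prime q \<and> odd q \<and> real q < exp (\<eta> * ln x / ln (ln x)) \<and> q \<notin> E \<longrightarrow> i mod q \<notin> \<Omega> q)}"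
    have "?S \<subseteq> {i. i < N \<and> (\<forall>q\<in>P. i mod q \<notin> \<Omega>' q)}"
    proof
      fix i assume i: "i \<in> ?S"
      have "i mod q \<notin> \<Omega>' q" if "q \<in> P" for q
        using i that \<Omega>'[OF that] zY n_iff[of q] by (auto simp: P_def L_def u_def)
      then show "i \<in> {i. i < N \<and> (\<forall>q\<in>P. i mod q \<notin> \<Omega>' q)}" using i by auto
    qed
    then have "real (card ?S) \<le> real (card {i. i < N \<and> (\<forall>q\<in>P. i mod q \<notin> \<Omega>' q)})"
      by (intro of_nat_mono card_mono) auto
    also have "\<dots> \<le> real N * exp (- V) + real N * exp (exp 1 * V - real J) + exp 1 * w ^ J"
      unfolding V_def
    proof (rule brun_pure_sieve[OF finP _ _ _ w1 w2])
      show "prime q" if "q \<in> P" for q using that by (simp add: P_def)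
      show "\<Omega>' q \<subseteq> {..<q}" if "q \<in> P" for q
      proof -
        have "\<Omega> q \<subseteq> {..<q}" using that \<Omega>[of q] zY n_iff[of q] by (simp add: P_def L_def u_def)
        then show ?thesis using \<Omega>'[OF that] by (meson order_trans)
      qed
    qed (simp add: J_def)
    also have "\<dots> \<le> real N * (exp B * L powr A / u powr (\<kappa> / 2)) + real N * (exp (39 * \<kappa>) * L powr A / u powr (\<kappa> / 2)) + real N * (L powr A / u powr (\<kappa> / 2))"
    proof (intro add_mono mult_left_mono)
      have LA: "L powr A = exp (2 * \<kappa> * ln L)" using L1 by (simp add: A_def powr_def)
      have uA: "u powr (\<kappa> / 2) = exp (\<kappa> / 2 * L)" using u2 by (simp add: Lu powr_def)
      have LA1: "1 \<le> L powr A" using L1 \<kappa> by (simp add: A_def ge_one_powr_ge_zero)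
      have "exp (- V) \<le> exp (B + 2 * \<kappa> * ln L - \<kappa> / 2 * L)" using V_lo by simp
      also have "\<dots> = exp B * L powr A / u powr (\<kappa> / 2)" by (simp add: LA uA exp_add exp_diff)
      finally show "exp (- V) \<le> exp B * L powr A / u powr (\<kappa> / 2)" .
      have V0: "V \<ge> 0" unfolding V_def by (intro sum_nonneg) auto
      have "exp 1 * V \<le> 3 * V" using exp_le V0 by (intro mult_right_mono) auto
      also have "\<dots> \<le> 3 * (\<kappa> * (L + 13))" using V_up by simp
      finally have "exp 1 * V - real J \<le> 3 * \<kappa> * L + 39 * \<kappa> - 4 * \<kappa> * L" using J_lo by (simp add: algebra_simps)
      also have "\<dots> \<le> 39 * \<kappa> - \<kappa> / 2 * L" using \<kappa> L1 by simp
      finally have "exp (exp 1 * V - real J) \<le> exp (39 * \<kappa>) * 1 / u powr (\<kappa> / 2)" by (simp add: uA exp_diff[symmetric])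
      also have "\<dots> \<le> exp (39 * \<kappa>) * L powr A / u powr (\<kappa> / 2)" using LA1 by (intro divide_right_mono mult_left_mono) auto
      finally show "exp (exp 1 * V - real J) \<le> exp (39 * \<kappa>) * L powr A / u powr (\<kappa> / 2)" .
      have "w \<le> z ^ 2" unfolding w_def power2_eq_square using z0 z \<kappa> by (intro mult_right_mono) auto
      then have "w ^ J \<le> (z ^ 2) ^ J" using w1 by (intro power_mono) auto
      also have "\<dots> = exp (real J * (2 * \<zeta> * u / L ^ 2))" by (simp add: z_def exp_of_nat_mult[symmetric] flip: power_mult)
      also have "\<dots> \<le> exp (6 * \<kappa> * L * (2 * \<zeta> * u / L ^ 2))" by (subst exp_le_cancel_iff, intro mult_right_mono J_up) (use \<zeta> u2 in auto)
      also have "6 * \<kappa> * L * (2 * \<zeta> * u / L ^ 2) = \<eta> * u / (4 * L)" using L1 \<kappa> by (simp add: \<zeta>_def field_simps power2_eq_square)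
      finally have "exp 1 * w ^ J \<le> exp 1 * exp (\<eta> * u / (4 * L))" by simp
      also have "\<dots> = exp (1 + \<eta> * u / (4 * L))" by (simp add: exp_add)
      also have "\<dots> \<le> exp (\<eta> * u / (2 * L) - \<kappa> / 2 * L)" proof -
        have "\<eta> * u / (2 * L) = 2 * (\<eta> * u / (4 * L))" by simp
        then show ?thesis using c2 by (subst exp_le_cancel_iff) linarith
      qed
      also have "\<dots> = exp (\<eta> * u / (2 * L)) * (1 / u powr (\<kappa> / 2))" by (simp add: uA exp_diff)
      also have "\<dots> \<le> real N * (L powr A / u powr (\<kappa> / 2))"
        using N LA1 by (intro mult_mono divide_right_mono) (auto simp: u_def L_def)
      finally show "exp 1 * w ^ J \<le> real N * (L powr A / u powr (\<kappa> / 2))" .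
    qed auto
    also have "\<dots> = K * real N * L powr A / u powr (\<kappa> / 2)" by (simp add: K_def algebra_simps add_divide_distrib)
    finally show "real (card ?S) \<le> K * real N * ln (ln x) powr A / ln x powr ((real l + 1) / 2)"
      by (simp add: L_def u_def \<kappa>_def)
  qed
qed

section \<open>Primitive representations as sums of two squares\<close>

text \<open>Raising \<open>a\<^sup>2 = - b\<^sup>2\<close> to the power
  \<open>(q - 1) div 2\<close>, which is odd, keeps the sign, while Fermat's theorem makes both
  powers 1; so \<open>1 = -1\<close> modulo \<open>q\<close>.\<close>

lemma not_dvd_sum_squares_nat:
  fixes a b q :: nat
  assumes q: "prime q" "q mod 4 = 3" and cop: "coprime a b"
  shows "\<not> q dvd a\<^sup>2 + b\<^sup>2"
proof
  assume dvd: "q dvd a\<^sup>2 + b\<^sup>2"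
  have na: "\<not> q dvd a"
  proof
    assume "q dvd a"
    then have "q dvd a\<^sup>2" by (simp add: power2_eq_square)
    then have "q dvd b\<^sup>2" using dvd by (simp add: dvd_add_right_iff)
    then have "q dvd b" using q prime_dvd_power by blast
    then show False using \<open>q dvd a\<close> cop q by (meson coprime_common_divisor not_prime_unit)
  qed
  have nb: "\<not> q dvd b"
  proof
    assume "q dvd b"
    then have "q dvd b\<^sup>2" by (simp add: power2_eq_square)
    then have "q dvd a\<^sup>2" using dvd by (simp add: dvd_add_left_iff)
    then show False using na q prime_dvd_power by blast
  qed
  define h where "h = (q - 1) div 2"
  have h: "odd h" "2 * h = q - 1" using q(2) unfolding h_def by presburger+
  have "int q dvd (int a)\<^sup>2 - (- ((int b)\<^sup>2))" using dvd by (metis diff_minus_eq_add of_nat_add of_nat_dvd_iff of_nat_power)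
  then have "[(int a)\<^sup>2 = - ((int b)\<^sup>2)] (mod int q)" by (simp add: cong_iff_dvd_diff)
  then have "[((int a)\<^sup>2) ^ h = (- ((int b)\<^sup>2)) ^ h] (mod int q)" by (rule cong_pow)
  then have 1: "[int a ^ (q - 1) = - (int b ^ (q - 1))] (mod int q)"
    using h by (simp add: power_mult[symmetric])
  have 2: "[int a ^ (q - 1) = 1] (mod int q)" "[int b ^ (q - 1) = 1] (mod int q)"
    using fermat_theorem[OF q(1) na] fermat_theorem[OF q(1) nb]
    by (simp_all flip: cong_int_iff)
  have "[- (int b ^ (q - 1)) = - 1] (mod int q)" using 2(2) by (simp add: cong_minus_minus_iff)
  then have "[1 = -1] (mod int q)" using 1 2(1) cong_sym cong_trans by blast
  then have "int q dvd 2" by (simp add: cong_iff_dvd_diff)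
  then have "q \<le> 2" using zdvd_imp_le by fastforce
  then show False using q by (cases "q = 2") auto
qed

lemma not_dvd_sum_squares_int:
  fixes a b :: int and q :: nat
  assumes "prime q" "q mod 4 = 3" "coprime a b"
  shows "\<not> int q dvd a\<^sup>2 + b\<^sup>2"
proof -
  have "coprime (nat \<bar>a\<bar>) (nat \<bar>b\<bar>)" using assms(3) by (simp flip: coprime_int_iff)
  then have "\<not> q dvd (nat \<bar>a\<bar>)\<^sup>2 + (nat \<bar>b\<bar>)\<^sup>2" by (rule not_dvd_sum_squares_nat[OF assms(1,2)])
  moreover have "a\<^sup>2 + b\<^sup>2 = int ((nat \<bar>a\<bar>)\<^sup>2 + (nat \<bar>b\<bar>)\<^sup>2)" by simp
  ultimately show ?thesis by (metis of_nat_dvd_iff)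
qed

lemma minus_one_quad_res:
  fixes p :: nat
  assumes p: "prime p" "p mod 4 = 1"
  obtains y :: int where "int p dvd y\<^sup>2 + 1"
proof -
  have p2: "p > 2" using p prime_ge_2_nat[of p] by (cases "p = 2") auto
  have ev: "even ((p - 1) div 2)" using p(2) by presburger
  have "[Legendre (-1) (int p) = (-1) ^ ((p - 1) div 2)] (mod int p)"
    by (rule euler_criterion[OF p(1) p2])
  then have "[Legendre (-1) (int p) = 1] (mod int p)" using ev by simp
  moreover have "\<not> [-1 = 1] (mod int p)" "\<not> [0 = 1] (mod int p)"
    using p2 zdvd_imp_le[of "int p" 2] zdvd_imp_le[of "int p" 1] by (auto simp: cong_iff_dvd_diff)
  ultimately have "QuadRes (int p) (-1)" unfolding Legendre_def by (auto split: if_splits)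
  then obtain y where "[y\<^sup>2 = -1] (mod int p)" unfolding QuadRes_def by auto
  then show thesis using that by (simp add: cong_iff_dvd_diff)
qed

text \<open>Thue's pigeonhole argument with a square root \<open>y\<close> of -1: there are
  \<open>(s + 1)\<^sup>2 > p\<close> pairs but only \<open>p\<close> residues of
  \<open>i - y * j\<close>. The difference of two colliding pairs has a positive norm, divisible by
  \<open>p\<close> and below \<open>2 * p\<close>.\<close>

lemma prime_sum_two_squares:
  fixes p :: nat
  assumes p: "prime p" "p mod 4 = 1"
  obtains c d :: int where "c\<^sup>2 + d\<^sup>2 = int p"
proof -
  obtain y :: int where y: "int p dvd y\<^sup>2 + 1" using minus_one_quad_res[OF p] .
  define s where "s = nat \<lfloor>sqrt (real p)\<rfloor>"
  have p0: "p > 0" using p prime_gt_0_nat by simp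
  have "real s \<le> sqrt (real p)" unfolding s_def by simp
  then have "(real s)\<^sup>2 \<le> real p" by (metis of_nat_0_le_iff real_sqrt_le_iff real_sqrt_unique sqrt_le_D)
  then have "s\<^sup>2 \<le> p" by (metis of_nat_le_iff of_nat_power)
  moreover have "s\<^sup>2 \<noteq> p" using p(1) by (metis prime_power_iff numeral_eq_one_iff semiring_norm(85))
  ultimately have s: "s\<^sup>2 < p" by simp
  have "sqrt (real p) < real (s + 1)" unfolding s_def by linarith
  then have "real p < (real (s + 1))\<^sup>2" by (metis real_sqrt_less_iff real_sqrt_pow2_iff real_sqrt_abs abs_of_nat)
  then have s1: "p < (s + 1)\<^sup>2" by (metis of_nat_less_iff of_nat_power)
  define f where "f = (\<lambda>(i::int, j::int). (i - y * j) mod int p)"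
  let ?D = "{0..int s} \<times> {0..int s}"
  have "f ` ?D \<subseteq> {0..<int p}" using p0 by (auto simp: f_def)
  then have "card (f ` ?D) \<le> p" using card_mono[of "{0..<int p}" "f ` ?D"] by simp
  moreover have "card ?D = (s + 1)\<^sup>2" by (simp add: card_cartesian_product power2_eq_square nat_add_distrib)
  ultimately have "\<not> inj_on f ?D" using s1 card_image[of f ?D] by auto
  then obtain z z' where z: "z \<in> ?D" "z' \<in> ?D" "z \<noteq> z'" "f z = f z'"
    unfolding inj_on_def by blast
  obtain i j i' j' where "z = (i, j)" "z' = (i', j')" by (cases z, cases z')
  then have ij: "(i,j) \<in> ?D" "(i',j') \<in> ?D" "(i,j) \<noteq> (i',j')" "f (i,j) = f (i',j')"
    using z by simp_all
  define c d where "c = i - i'" and "d = j - j'"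
  have "int p dvd (i - y * j) - (i' - y * j')" using ij(4) unfolding f_def by (simp add: mod_eq_dvd_iff)
  then have 1: "int p dvd c - y * d" by (simp add: c_def d_def algebra_simps)
  have "c\<^sup>2 + d\<^sup>2 = (c - y * d) * (c + y * d) + (y\<^sup>2 + 1) * d\<^sup>2" by (simp add: algebra_simps power2_eq_square)
  then have dvd: "int p dvd c\<^sup>2 + d\<^sup>2" using 1 y by simp
  have "\<bar>c\<bar> \<le> int s" "\<bar>d\<bar> \<le> int s" using ij(1,2) by (auto simp: c_def d_def)
  then have "c\<^sup>2 \<le> (int s)\<^sup>2" "d\<^sup>2 \<le> (int s)\<^sup>2" by (metis abs_of_nat abs_le_square_iff)+
  moreover have "(int s)\<^sup>2 < int p" using s by (metis of_nat_less_iff of_nat_power)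
  ultimately have lt: "c\<^sup>2 + d\<^sup>2 < 2 * int p" by linarith
  have "c \<noteq> 0 \<or> d \<noteq> 0" using ij(3) by (auto simp: c_def d_def)
  then have pos: "c\<^sup>2 + d\<^sup>2 > 0" by (simp add: sum_power2_gt_zero_iff)
  obtain k where k: "c\<^sup>2 + d\<^sup>2 = int p * k" using dvd by auto
  then have "k > 0" "k < 2" using pos lt p0 by (auto simp: zero_less_mult_iff mult.commute)
  then have "c\<^sup>2 + d\<^sup>2 = int p" using k by simp
  then show thesis by (rule that)
qed

text \<open>Both signs are allowed, unlike in \<open>r_star\<close>, because division by a Gaussian
  prime does not preserve nonnegative coordinates.\<close>

definition prim_reps :: "nat \<Rightarrow> (int \<times> int) set" where
  "prim_reps m = {(a, b). coprime a b \<and> a\<^sup>2 + b\<^sup>2 = int m}"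

text \<open>With \<open>u + v * \<i> = (a + b * \<i>) / (c \<plusminus> d * \<i>)\<close> one has \<open>b = v * c \<plusminus> u * d\<close>.\<close>

lemma prim_reps_divide_prime:
  fixes a b c d :: int and p m :: nat
  assumes p: "prime p" "c\<^sup>2 + d\<^sup>2 = int p" and ab: "coprime a b" "a\<^sup>2 + b\<^sup>2 = int (m * p)"
  obtains \<alpha> \<beta> where "(\<alpha>, \<beta>) \<in> prim_reps m" "b = \<alpha> * c + \<beta> * d"
proof -
  have p0: "int p \<noteq> 0" "int p > 0" using p prime_gt_0_nat by auto
  have pi: "prime (int p)" using p by simp
  \<comment> \<open>Here \<open>u\<close> and \<open>v\<close> are the real and imaginary part of
    \<open>(a + b * \<i>) / (c + d * \<i>)\<close>. As \<open>p\<close> divides one of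
    \<open>a * c + b * d\<close> and \<open>a * c - b * d\<close>, the other case follows by
    conjugating the Gaussian prime, that is with \<open>- d\<close>.\<close>
  have key: "\<exists>u v. (u, v) \<in> prim_reps m \<and> b = v * c + u * d"
    if cd: "c\<^sup>2 + d\<^sup>2 = int p" and dvd: "int p dvd a * c + b * d" for c d
  proof -
    obtain u where u: "a * c + b * d = int p * u" using dvd by auto
    have "(b * c - a * d)\<^sup>2 = (a\<^sup>2 + b\<^sup>2) * (c\<^sup>2 + d\<^sup>2) - (a * c + b * d)\<^sup>2" by (simp add: algebra_simps power2_eq_square)
    also have "\<dots> = int p * (int m * int p - int p * u\<^sup>2)" unfolding ab(2) cd u by (simp add: power2_eq_square algebra_simps)
    finally have "int p dvd (b * c - a * d)\<^sup>2" by simp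
    then have "int p dvd b * c - a * d" using pi prime_dvd_power by blast
    then obtain v where v: "b * c - a * d = int p * v" by auto
    have "int p * b = (a * c + b * d) * d + (b * c - a * d) * c"
      unfolding cd[symmetric] by (simp add: algebra_simps power2_eq_square)
    also have "\<dots> = int p * (v * c + u * d)" unfolding u v by (simp add: algebra_simps)
    finally have b: "b = v * c + u * d" using p0 by simp
    have "int p * a = (a * c + b * d) * c - (b * c - a * d) * d"
      unfolding cd[symmetric] by (simp add: algebra_simps power2_eq_square)
    also have "\<dots> = int p * (u * c - v * d)" unfolding u v by (simp add: algebra_simps)
    finally have a: "a = u * c - v * d" using p0 by simp
    have "coprime u v"
    proof (rule coprimeI)
      fix e assume "e dvd u" "e dvd v"
      then have "e dvd a" "e dvd b" unfolding a b by auto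
      then show "is_unit e" using ab(1) coprime_common_divisor by blast
    qed
    moreover have "int p * (u\<^sup>2 + v\<^sup>2) = int p * int m"
    proof -
      have "(u\<^sup>2 + v\<^sup>2) * (c\<^sup>2 + d\<^sup>2) = a\<^sup>2 + b\<^sup>2" unfolding a b by (simp add: algebra_simps power2_eq_square)
      then show ?thesis using ab cd by (simp add: mult.commute)
    qed
    then have "u\<^sup>2 + v\<^sup>2 = int m" using p0 by simp
    ultimately show ?thesis using b unfolding prim_reps_def by blast
  qed
  have "(a * c + b * d) * (a * c - b * d) = a\<^sup>2 * (c\<^sup>2 + d\<^sup>2) - d\<^sup>2 * (a\<^sup>2 + b\<^sup>2)"
    by (simp add: algebra_simps power2_eq_square)
  also have "\<dots> = int p * (a\<^sup>2 - d\<^sup>2 * int m)" by (simp add: ab p algebra_simps)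
  finally have "int p dvd (a * c + b * d) * (a * c - b * d)" by simp
  then consider "int p dvd a * c + b * d" | "int p dvd a * c - b * d" using pi prime_dvd_mult_iff by blast
  then show thesis
  proof cases
    case 1
    then obtain u v where "(u, v) \<in> prim_reps m" "b = v * c + u * d" using key[OF p(2)] by blast
    then show thesis using that[of v u] by (simp add: prim_reps_def coprime_commute add.commute)
  next
    case 2
    then obtain u v where "(u, v) \<in> prim_reps m" "b = v * c + u * (- d)" using key[of c "- d"] p(2) by auto
    then show thesis using that[of v "- u"] by (simp add: prim_reps_def coprime_commute add.commute)
  qed
qed

lemma prim_reps_abs_le:
  assumes "(a, b) \<in> prim_reps m"
  shows "\<bar>a\<bar> \<le> int m" "\<bar>b\<bar> \<le> int m"
proof -
  have sq: "\<bar>t\<bar> \<le> t\<^sup>2" for t :: int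
  proof -
    have "\<bar>t\<bar> * 1 \<le> \<bar>t\<bar> * \<bar>t\<bar>" if "t \<noteq> 0" using that by (intro mult_left_mono) auto
    then show ?thesis by (cases "t = 0") (auto simp: power2_eq_square)
  qed
  show "\<bar>a\<bar> \<le> int m" "\<bar>b\<bar> \<le> int m"
    using sq[of a] sq[of b] assms zero_le_power2[of a] zero_le_power2[of b] unfolding prim_reps_def by auto
qed

lemma finite_prim_reps: "finite (prim_reps m)"
proof (rule finite_subset)
  show "prim_reps m \<subseteq> {- int m..int m} \<times> {- int m..int m}"
    using prim_reps_abs_le by fastforce
qed simp

lemma prim_reps_prime_not_dvd:
  assumes "(a, b) \<in> prim_reps m" "prime p" "p dvd m"
  shows "\<not> int p dvd a" "\<not> int p dvd b"
proof -
  have pi: "prime (int p)" using assms by simp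
  have s: "int p dvd a\<^sup>2 + b\<^sup>2" using assms by (auto simp: prim_reps_def)
  have "int p dvd a \<longleftrightarrow> int p dvd b"
  proof
    assume "int p dvd a"
    then have "int p dvd a\<^sup>2" by (simp add: power2_eq_square)
    then have "int p dvd b\<^sup>2" using s by (simp add: dvd_add_right_iff)
    then show "int p dvd b" using pi prime_dvd_power by blast
  next
    assume "int p dvd b"
    then have "int p dvd b\<^sup>2" by (simp add: power2_eq_square)
    then have "int p dvd a\<^sup>2" using s by (simp add: dvd_add_left_iff)
    then show "int p dvd a" using pi prime_dvd_power by blast
  qed
  moreover have "\<not> (int p dvd a \<and> int p dvd b)"
    using assms(1) pi by (auto simp: prim_reps_def dest: coprime_common_divisor)
  ultimately show "\<not> int p dvd a" "\<not> int p dvd b" by auto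
qed

lemma prim_reps_not_4_dvd:
  assumes "(a, b) \<in> prim_reps m"
  shows "\<not> 4 dvd m"
proof
  assume "4 dvd m"
  then have "int 4 dvd int m" by (simp only: int_dvd_int_iff)
  then have "4 dvd a\<^sup>2 + b\<^sup>2" using assms by (simp add: prim_reps_def)
  then have "(a\<^sup>2 mod 4 + b\<^sup>2 mod 4) mod 4 = 0" by (simp only: mod_add_eq dvd_eq_mod_eq_0)
  moreover have "t\<^sup>2 mod 4 = (if even t then 0 else 1)" for t :: int
  proof (cases "even t")
    case False
    then obtain k where "t = 2 * k + 1" by (elim oddE)
    then have "t\<^sup>2 = 1 + 4 * (k * k + k)" by (simp add: power2_eq_square algebra_simps)
    then show ?thesis using False by (simp only: mod_mult_self2) simp
  qed (auto elim!: evenE simp: power2_eq_square)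
  ultimately have "even a" "even b" by (simp_all split: if_splits)
  then show False using assms by (auto simp: prim_reps_def dest: coprime_common_divisor)
qed

lemma prim_reps_prime_mod_4:
  assumes "(a, b) \<in> prim_reps m" "prime p" "odd p" "p dvd m"
  shows "p mod 4 = 1"
proof -
  have "p mod 4 \<noteq> 3"
    using not_dvd_sum_squares_int[of p a b] assms by (auto simp: prim_reps_def)
  then show ?thesis using assms(3) by presburger
qed

text \<open>Two primitive representations of \<open>m\<close> that agree up to sign with a fixed third one modulo the
  same prime powers of \<open>m\<close> differ by a unit of the Gaussian integers.\<close>

lemma card_prim_reps_le:
  assumes m: "m > 0"
  shows "card (prim_reps m) \<le> 4 * 2 ^ omega_star m"
proof (cases "prim_reps m = {}")
  case False
  then obtain a0 b0 where ab0: "(a0, b0) \<in> prim_reps m" by auto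
  let ?Q = "{p. prime p \<and> odd p \<and> p dvd m}"
  have finQ: "finite ?Q" by (rule finite_subset[of _ "{..m}"]) (use m dvd_imp_le in auto)
  \<comment> \<open>At an odd prime power exactly dividing \<open>m\<close>, the ratio of the
    coordinates is one of two square roots of -1. \<open>\<Phi>\<close> records where it agrees with
    that of the reference \<open>(a0, b0)\<close>, which leaves \<open>2 ^ omega_star m\<close>
    patterns.\<close>
  define \<Phi> where "\<Phi> = (\<lambda>(a, b). {p\<in>?Q. int (p ^ multiplicity p m) dvd a * b0 - a0 * b})"
  have dvd: "int m dvd a * b' - a' * b"
    if ab: "(a, b) \<in> prim_reps m" and ab': "(a', b') \<in> prim_reps m" and eq: "\<Phi> (a, b) = \<Phi> (a', b')" for a b a' b'
  proof (cases "a * b' - a' * b = 0")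
    case D0: False
    have "m dvd nat \<bar>a * b' - a' * b\<bar>"
    proof (rule multiplicity_le_imp_dvd)
      fix p :: nat assume p: "prime p"
      let ?v = "multiplicity p m"
      have "int (p ^ ?v) dvd a * b' - a' * b"
      proof (cases "p dvd m")
        case pm: True
        have pi: "prime (int p)" using p by simp
        show ?thesis
        proof (cases "p = 2")
          case True
          \<comment> \<open>The prime 2 occurs at most once in \<open>m\<close>, so parity settles
            it and it contributes no binary choice.\<close>
          have "?v < 2"
          proof (rule ccontr)
            assume "\<not> ?v < 2"
            then have "p ^ 2 dvd m" using multiplicity_dvd'[where n = 2 and p = p and x = m] by simp
            then show False using prim_reps_not_4_dvd[OF ab0] True by simp
          qed
          then have "int (p ^ ?v) dvd int p" using True by (cases ?v) auto
          moreover have "even (a * b' - a' * b)"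
            using prim_reps_prime_not_dvd[OF ab p pm] prim_reps_prime_not_dvd[OF ab' p pm] True by simp
          ultimately show ?thesis using True by (metis dvd_trans of_nat_numeral)
        next
          case False
          then have "odd p" using p prime_odd_nat prime_ge_2_nat[of p] by (metis le_neq_implies_less)
          then have pQ: "p \<in> ?Q" using p pm by simp
          have nd0: "\<not> int p dvd a0" "\<not> int p dvd b0" by (rule prim_reps_prime_not_dvd[OF ab0 p pm])+
          \<comment> \<open>The product of both factors is a multiple of \<open>m\<close>. An odd
            \<open>p\<close> dividing both would divide \<open>2 * x * b0\<close>, so the full prime
            power goes into one of them.\<close>
          have alt: "int (p ^ ?v) dvd x * b0 - a0 * y \<or> int (p ^ ?v) dvd x * b0 + a0 * y"
            if xy: "(x, y) \<in> prim_reps m" for x y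
          proof -
            have "(x * b0 - a0 * y) * (x * b0 + a0 * y) = x\<^sup>2 * (a0\<^sup>2 + b0\<^sup>2) - a0\<^sup>2 * (x\<^sup>2 + y\<^sup>2)"
              by (simp add: algebra_simps power2_eq_square)
            also have "\<dots> = int m * (x\<^sup>2 - a0\<^sup>2)" using xy ab0 by (simp add: prim_reps_def algebra_simps)
            finally have eq': "(x * b0 - a0 * y) * (x * b0 + a0 * y) = int m * (x\<^sup>2 - a0\<^sup>2)" .
            have "int (p ^ ?v) dvd int m" by (simp only: int_dvd_int_iff multiplicity_dvd)
            then have d: "int (p ^ ?v) dvd (x * b0 - a0 * y) * (x * b0 + a0 * y)" unfolding eq' by simp
            have "\<not> (int p dvd x * b0 - a0 * y \<and> int p dvd x * b0 + a0 * y)"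
            proof
              assume "int p dvd x * b0 - a0 * y \<and> int p dvd x * b0 + a0 * y"
              then have "int p dvd (x * b0 - a0 * y) + (x * b0 + a0 * y)" by (elim conjE) (rule dvd_add)
              then have "int p dvd 2 * (x * b0)" by (simp add: algebra_simps)
              moreover have "\<not> int p dvd 2" using \<open>odd p\<close> p False
                by (metis int_dvd_int_iff of_nat_numeral primes_dvd_imp_eq two_is_prime_nat)
              ultimately show False
                using pi prim_reps_prime_not_dvd[OF xy p pm] nd0 by (simp add: prime_dvd_mult_iff)
            qed
            then consider "coprime (int (p ^ ?v)) (x * b0 - a0 * y)" | "coprime (int (p ^ ?v)) (x * b0 + a0 * y)"
              using prime_imp_coprime[OF pi] by (auto simp: coprime_power_left_iff)
            then show ?thesis
              using d by cases (auto simp: coprime_dvd_mult_right_iff coprime_dvd_mult_left_iff)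
          qed
          have mem: "p \<in> \<Phi> (a, b) \<longleftrightarrow> p \<in> \<Phi> (a', b')" using eq by simp
          have "int (p ^ ?v) dvd a0 * b0 * (a * b' - a' * b)"
          proof (cases "p \<in> \<Phi> (a, b)")
            case True
            then have "int (p ^ ?v) dvd a * b0 - a0 * b" "int (p ^ ?v) dvd a' * b0 - a0 * b'"
              using mem unfolding \<Phi>_def by auto
            then have "int (p ^ ?v) dvd (a * b0 - a0 * b) * (a0 * b') - (a' * b0 - a0 * b') * (a0 * b)"
              by (rule dvd_diff[OF dvd_mult2 dvd_mult2])
            then show ?thesis by (simp add: algebra_simps)
          next
            case False
            then have "int (p ^ ?v) dvd a * b0 + a0 * b" "int (p ^ ?v) dvd a' * b0 + a0 * b'"
              using mem alt[OF ab] alt[OF ab'] pQ unfolding \<Phi>_def by auto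
            then have "int (p ^ ?v) dvd (a * b0 + a0 * b) * (a0 * b') - (a' * b0 + a0 * b') * (a0 * b)"
              by (rule dvd_diff[OF dvd_mult2 dvd_mult2])
            then show ?thesis by (simp add: algebra_simps)
          qed
          moreover have "coprime (int (p ^ ?v)) (a0 * b0)"
            using pi nd0 by (simp add: coprime_power_left_iff prime_imp_coprime)
          ultimately show ?thesis by (simp add: coprime_dvd_mult_right_iff)
        qed
      qed (simp add: not_dvd_imp_multiplicity_0)
      then have "p ^ ?v dvd nat \<bar>a * b' - a' * b\<bar>" by (metis dvd_abs_iff int_dvd_int_iff int_nat_eq abs_ge_zero)
      then show "multiplicity p m \<le> multiplicity p (nat \<bar>a * b' - a' * b\<bar>)"
        using D0 p by (intro multiplicity_geI) (auto simp: prime_gt_Suc_0_nat)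
    qed (use m D0 in auto)
    then show ?thesis by (metis dvd_abs_iff int_dvd_int_iff int_nat_eq abs_ge_zero)
  qed simp
  have fiber: "card {z\<in>prim_reps m. \<Phi> z = T} \<le> 4" for T
  proof (cases "{z\<in>prim_reps m. \<Phi> z = T} = {}")
    case False
    then obtain a' b' where ab': "(a', b') \<in> prim_reps m" "\<Phi> (a', b') = T" by auto
    let ?U = "{(1,0), (-1,0), (0,1), (0,-1)} :: (int \<times> int) set"
    \<comment> \<open>Up to conjugation the quotient by the reference \<open>a' + b' * \<i>\<close>.
      Equal patterns make both coordinates divisible by \<open>m\<close>, so it is a Gaussian
      integer of norm 1, hence one of four units.\<close>
    define g where "g = (\<lambda>(a::int, b::int). ((a * a' + b * b') div int m, (a * b' - a' * b) div int m))"
    have s': "a'\<^sup>2 + b'\<^sup>2 = int m" using ab' by (simp add: prim_reps_def)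
    have g: "\<exists>s t. g (a, b) = (s, t) \<and> a * a' + b * b' = int m * s \<and> a * b' - a' * b = int m * t \<and> (s, t) \<in> ?U"
      if ab: "(a, b) \<in> prim_reps m" "\<Phi> (a, b) = T" for a b
    proof -
      have "int m dvd a * b' - a' * b" using dvd[OF ab(1) ab'(1)] ab(2) ab'(2) by simp
      then obtain t where t: "a * b' - a' * b = int m * t" by auto
      have s: "a\<^sup>2 + b\<^sup>2 = int m" using ab by (simp add: prim_reps_def)
      have "(a * a' + b * b')\<^sup>2 = (a\<^sup>2 + b\<^sup>2) * (a'\<^sup>2 + b'\<^sup>2) - (a * b' - a' * b)\<^sup>2"
        by (simp add: algebra_simps power2_eq_square)
      also have "\<dots> = (int m)\<^sup>2 * (1 - t\<^sup>2)" unfolding s s' t by (simp add: algebra_simps power2_eq_square)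
      finally have sq: "(a * a' + b * b')\<^sup>2 = (int m)\<^sup>2 * (1 - t\<^sup>2)" .
      then have "(int m)\<^sup>2 dvd (a * a' + b * b')\<^sup>2" by simp
      then have "int m dvd a * a' + b * b'" by (simp add: pow_divides_pow_iff)
      then obtain r where r: "a * a' + b * b' = int m * r" by auto
      have "(int m)\<^sup>2 * r\<^sup>2 = (int m)\<^sup>2 * (1 - t\<^sup>2)" using sq r by (simp add: power_mult_distrib)
      then have rt: "r\<^sup>2 + t\<^sup>2 = 1" using m by simp
      have "(r, t) \<in> ?U"
      proof -
        have "r\<^sup>2 \<le> 1" "t\<^sup>2 \<le> 1" using rt zero_le_power2[of r] zero_le_power2[of t] by linarith+
        then have "\<bar>r\<bar> \<le> 1" "\<bar>t\<bar> \<le> 1" by (simp_all add: abs_square_le_1)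
        then have "r \<in> {-1,0,1}" "t \<in> {-1,0,1}" by auto
        then show ?thesis using rt by auto
      qed
      moreover have "g (a, b) = (r, t)" using m by (simp add: g_def r t)
      ultimately show ?thesis using r t by blast
    qed
    have "inj_on g {z\<in>prim_reps m. \<Phi> z = T}"
    proof (rule inj_onI)
      fix z w assume z: "z \<in> {z\<in>prim_reps m. \<Phi> z = T}" and w: "w \<in> {z\<in>prim_reps m. \<Phi> z = T}" and eq: "g z = g w"
      obtain a b where ab: "z = (a, b)" by (cases z)
      obtain c d where cd: "w = (c, d)" by (cases w)
      obtain s t where 1: "g (a, b) = (s, t)" "a * a' + b * b' = int m * s" "a * b' - a' * b = int m * t"
        using g[of a b] z ab by auto
      obtain s2 t2 where 2: "g (c, d) = (s2, t2)" "c * a' + d * b' = int m * s2" "c * b' - a' * d = int m * t2"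
        using g[of c d] w cd by auto
      have st: "s2 = s" "t2 = t" using eq ab cd 1(1) 2(1) by auto
      have "a * int m = (a * a' + b * b') * a' + (a * b' - a' * b) * b'" "b * int m = (a * a' + b * b') * b' - (a * b' - a' * b) * a'"
        "c * int m = (c * a' + d * b') * a' + (c * b' - a' * d) * b'" "d * int m = (c * a' + d * b') * b' - (c * b' - a' * d) * a'"
        unfolding s'[symmetric] by (simp_all add: algebra_simps power2_eq_square)
      then have "a * int m = c * int m" "b * int m = d * int m" using 1 2 st by simp_all
      then show "z = w" using m ab cd by simp
    qed
    then have "card {z\<in>prim_reps m. \<Phi> z = T} = card (g ` {z\<in>prim_reps m. \<Phi> z = T})" by (simp add: card_image)
    also have "\<dots> \<le> card ?U" using g by (intro card_mono) fastforce+
    also have "\<dots> \<le> 4" by simp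
    finally show ?thesis .
  next
    case True
    then show ?thesis by (simp only: card.empty)
  qed
  have "\<Phi> z \<subseteq> ?Q" for z unfolding \<Phi>_def by (auto split: prod.splits)
  then have "prim_reps m \<subseteq> (\<Union>T\<in>Pow ?Q. {z\<in>prim_reps m. \<Phi> z = T})" by (intro subsetI UN_I[of "\<Phi> _"]) (simp_all only: Pow_iff mem_Collect_eq simp_thms)
  then have "prim_reps m = (\<Union>T\<in>Pow ?Q. {z\<in>prim_reps m. \<Phi> z = T})" by (intro equalityI UN_least) (simp_all only: Collect_subset)
  then have "card (prim_reps m) = card (\<Union>T\<in>Pow ?Q. {z\<in>prim_reps m. \<Phi> z = T})" by simp
  also have "\<dots> \<le> (\<Sum>T\<in>Pow ?Q. card {z\<in>prim_reps m. \<Phi> z = T})" using finQ by (intro card_UN_le) simp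
  also have "\<dots> \<le> (\<Sum>T\<in>Pow ?Q. 4)" by (intro sum_mono fiber)
  also have "\<dots> = 4 * 2 ^ omega_star m" using finQ by (simp add: card_Pow omega_star_def)
  finally show ?thesis .
qed simp


section \<open>Reciprocal sums over integers composed of primes 1 modulo 4\<close>

definition norm_set :: "nat \<Rightarrow> nat \<Rightarrow> nat set" where
  "norm_set y j = {m. 0 < m \<and> m \<le> y \<and> \<not> 4 dvd m \<and> (\<forall>p. prime p \<and> odd p \<and> p dvd m \<longrightarrow> p mod 4 = 1) \<and> omega_star m = j}"

lemma finite_odd_prime_divisors: "m > 0 \<Longrightarrow> finite {p. prime p \<and> odd p \<and> p dvd (m::nat)}"
  by (rule finite_subset[of _ "{..m}"]) (auto dest: dvd_imp_le)

lemma finite_norm_set: "finite (norm_set y j)"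
  by (rule finite_subset[of _ "{..y}"]) (auto simp: norm_set_def)

lemma norm_set_0: "norm_set y 0 \<subseteq> {1, 2}"
proof
  fix m assume m: "m \<in> norm_set y 0"
  then have "{p. prime p \<and> odd p \<and> p dvd m} = {}"
    using finite_odd_prime_divisors[of m] unfolding norm_set_def omega_star_def by (auto simp only: mem_Collect_eq card_0_eq)
  then have no: "\<not> (prime p \<and> odd p \<and> p dvd m)" for p by blast
  have k1: "k = 1" if "odd k" "k dvd m" for k
  proof (rule ccontr)
    assume "k \<noteq> 1"
    then obtain p where p: "prime p" "p dvd k" using prime_factor_nat by auto
    then have "odd p" using that(1) by (meson dvd_trans)
    then show False using no p that(2) dvd_trans by blast
  qed
  show "m \<in> {1, 2}"
  proof (cases "even m")
    case True
    then obtain k where k: "m = 2 * k" by auto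
    then have "odd k" using m by (auto simp: norm_set_def)
    then show ?thesis using k1[of k] k by simp
  qed (use k1[of m] in simp)
qed

lemma sum_inverse_power_from_1_le: 
  fixes p :: nat
  assumes "p \<ge> 2"
  shows "(\<Sum>e\<in>{1..n}. 1 / real p ^ e) \<le> 1 / (real p - 1)"
proof -
  have "(\<Sum>e\<in>{1..n}. 1 / real p ^ e) = 1 / (real p - 1) - 1 / (real p ^ n * (real p - 1))"
  proof (induction n)
    case (Suc n)
    have "1 / real p ^ Suc n = 1 / (real p ^ n * (real p - 1)) - 1 / (real p ^ Suc n * (real p - 1))"
      using assms by (simp add: divide_simps)
    then show ?case using Suc by simp
  qed simp
  moreover have "1 / (real p ^ n * (real p - 1)) \<ge> 0" using assms by simp
  ultimately show ?thesis by linarith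
qed

text \<open>\<open>norm_set\<close> contains every \<open>m \<le> y\<close> with a primitive
  representation and \<open>j\<close> odd prime factors, but refers to prime factors only, which
  permits induction on their number. Marking one of the \<open>Suc j\<close> odd primes of
  \<open>m\<close> and splitting off its full power produces the factor \<open>1 / Suc j\<close>.
  The 3/2 is \<open>1 + 1/2\<close>, from \<open>m = 1\<close> and \<open>m = 2\<close>.\<close>

lemma sum_inverse_norm_set_le:
  "(\<Sum>m\<in>norm_set y j. 1 / real m)
     \<le> 3 / 2 * (\<Sum>p | prime p \<and> p \<le> y \<and> p mod 4 = 1. 1 / (real p - 1)) ^ j / fact j"
proof (induction j)
  case 0
  have "(\<Sum>m\<in>norm_set y 0. 1 / real m) \<le> (\<Sum>m\<in>{1,2}. 1 / real m)"
    by (rule sum_mono2) (use norm_set_0 in auto)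
  then show ?case by simp
next
  case (Suc j)
  define S where "S = (\<Sum>p | prime p \<and> p \<le> y \<and> p mod 4 = 1. 1 / (real p - 1))"
  let ?A = "{p. prime p \<and> p \<le> y \<and> p mod 4 = 1}"
  let ?Q = "\<lambda>m. {p. prime p \<and> odd p \<and> p dvd m}"
  let ?X = "Sigma (norm_set y (Suc j)) ?Q"
  define h where "h = (\<lambda>(m::nat, p::nat). ((p, multiplicity p m), m div p ^ multiplicity p m))"
  let ?w = "\<lambda>((p::nat, e), m'::nat). 1 / real p ^ e * (1 / real m')"
  have dec: "m = p ^ multiplicity p m * (m div p ^ multiplicity p m)" for m p :: nat
    by (simp add: multiplicity_dvd)
  have inj: "inj_on h ?X"
  proof (rule inj_onI)
    fix a b assume "a \<in> ?X" "b \<in> ?X" "h a = h b"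
    then show "a = b" using dec[of "fst a" "snd a"] dec[of "fst b" "snd b"]
      by (auto simp: h_def case_prod_unfold prod_eq_iff)
  qed
  have img: "h ` ?X \<subseteq> (?A \<times> {1..y}) \<times> norm_set y j"
  proof (safe)
    fix p e m' m q assume h: "((p, e), m') = h (m, q)" and m: "m \<in> norm_set y (Suc j)" and q: "prime q" "odd q" "q dvd m"
    define e0 where "e0 = multiplicity q m"
    have eqs: "p = q" "e = e0" "m' = m div q ^ e0" using h by (auto simp: h_def e0_def)
    have m0: "m > 0" "m \<le> y" using m by (auto simp: norm_set_def)
    have m_eq: "m = q ^ e0 * m'" unfolding eqs e0_def by (rule dec)
    have m'0: "m' > 0" using m_eq m0 by (cases m') auto
    have e1: "e0 \<ge> 1" using q m0 unfolding e0_def by (simp add: Suc_le_eq prime_multiplicity_gt_zero_iff)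
    show "prime p" "p \<le> y" "p mod 4 = 1" using q m0 dvd_imp_le[of q m] m eqs by (auto simp: norm_set_def)
    have "e0 < q ^ e0" using prime_ge_2_nat[OF q(1)] by (metis less_exp order_less_le_trans power_mono zero_le)
    also have "\<dots> \<le> m" using m_eq m0 by (intro dvd_imp_le) auto
    finally show "e \<in> {1..y}" using eqs e1 m0 by simp
    have ndvd: "\<not> q dvd m'"
      using multiplicity_decompose[of m q] m0 not_prime_unit q(1) unfolding eqs e0_def by blast
    have dvd: "r dvd m' \<Longrightarrow> r dvd m" for r using m_eq by simp
    have "?Q m = insert q (?Q m')"
    proof (intro equalityI subsetI)
      fix r assume r: "r \<in> ?Q m"
      then have "r dvd q ^ e0 \<or> r dvd m'" using m_eq prime_dvd_mult_iff by auto
      then show "r \<in> insert q (?Q m')" using r q by (metis (mono_tags, lifting) insert_iff mem_Collect_eq prime_dvd_power primes_dvd_imp_eq)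
    qed (use q dvd in auto)
    then have "card (?Q m) = Suc (card (?Q m'))" using ndvd finite_odd_prime_divisors[OF m'0] by simp
    then have "omega_star m' = j" using m by (simp add: norm_set_def omega_star_def)
    moreover have "m' \<le> y" using m0 dvd_imp_le[OF dvd, of m'] by simp
    ultimately show "m' \<in> norm_set y j" using m m'0 dvd by (auto simp: norm_set_def)
  qed
  have "real (Suc j) * (\<Sum>m\<in>norm_set y (Suc j). 1 / real m) = (\<Sum>m\<in>norm_set y (Suc j). \<Sum>p\<in>?Q m. 1 / real m)"
    unfolding sum_distrib_left by (rule sum.cong) (auto simp: norm_set_def omega_star_def)
  also have "\<dots> = (\<Sum>(m, p)\<in>?X. 1 / real m)"
    using finite_norm_set finite_odd_prime_divisors by (intro sum.Sigma) (auto simp: norm_set_def)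
  also have "\<dots> = (\<Sum>x\<in>?X. ?w (h x))"
  proof (rule sum.cong[OF refl], clarify)
    fix m p
    have "1 / real m = 1 / real (p ^ multiplicity p m * (m div p ^ multiplicity p m))" using dec[of m p] by simp
    then show "1 / real m = ?w (h (m, p))" by (simp add: h_def)
  qed
  also have "\<dots> = (\<Sum>z\<in>h ` ?X. ?w z)" by (simp add: sum.reindex[OF inj])
  also have "\<dots> \<le> (\<Sum>z\<in>(?A \<times> {1..y}) \<times> norm_set y j. ?w z)"
    using finite_norm_set by (intro sum_mono2[OF _ img]) auto
  also have "\<dots> = (\<Sum>x\<in>?A \<times> {1..y}. case x of (p, e) \<Rightarrow> 1 / real p ^ e) * (\<Sum>m\<in>norm_set y j. 1 / real m)"
    by (simp add: sum_product sum.cartesian_product case_prod_unfold)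
  also have "(\<Sum>x\<in>?A \<times> {1..y}. case x of (p, e) \<Rightarrow> 1 / real p ^ e) = (\<Sum>p\<in>?A. \<Sum>e\<in>{1..y}. 1 / real p ^ e)"
    by (simp add: sum.cartesian_product)
  also have "\<dots> * (\<Sum>m\<in>norm_set y j. 1 / real m) \<le> S * (3 / 2 * S ^ j / fact j)"
  proof (rule mult_mono)
    show "(\<Sum>p\<in>?A. \<Sum>e\<in>{1..y}. 1 / real p ^ e) \<le> S" unfolding S_def
      by (intro sum_mono sum_inverse_power_from_1_le) (auto simp: prime_ge_2_nat)
    show "(\<Sum>m\<in>norm_set y j. 1 / real m) \<le> 3 / 2 * S ^ j / fact j" using Suc unfolding S_def .
    show "0 \<le> S" unfolding S_def using prime_ge_2_nat by (intro sum_nonneg) fastforce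
  qed (auto intro: sum_nonneg)
  finally have "(\<Sum>m\<in>norm_set y (Suc j). 1 / real m) \<le> S * (3 / 2 * S ^ j / fact j) / real (Suc j)"
    by (simp only: pos_le_divide_eq of_nat_0_less_iff zero_less_Suc mult.commute)
  also have "\<dots> = 3 / 2 * S ^ Suc j / fact (Suc j)" by (simp add: mult_ac)
  finally show ?case unfolding S_def .
qed

section \<open>Exceptional primes and the sifting problem for fixed \<open>m\<close> and
  \<open>d\<close>\<close>

lemma two_power_card_prime_factors_le: "n > 0 \<Longrightarrow> 2 ^ card (prime_factors n) \<le> (n::nat)"
proof -
  assume n: "n > 0"
  have "2 ^ card (prime_factors n) = (\<Prod>p\<in>prime_factors n. 2::nat)" by simp
  also have "\<dots> \<le> (\<Prod>p\<in>prime_factors n. p ^ multiplicity p n)"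
  proof (rule prod_mono)
    fix p assume p: "p \<in> prime_factors n"
    then have "multiplicity p n > 0" "p \<ge> 2" using n
      by (auto simp: prime_factors_multiplicity prime_ge_2_nat)
    then have "p \<le> p ^ multiplicity p n" by (intro self_le_power) auto
    then show "0 \<le> (2::nat) \<and> 2 \<le> p ^ multiplicity p n" using \<open>p \<ge> 2\<close> by simp
  qed
  also have "\<dots> = n" using prime_factorization_nat[OF n] by simp
  finally show ?thesis .
qed

text \<open>The exponent 3 makes room for determinants of two vectors in \<open>prim_reps m\<close>,
  of size up to \<open>2 * m\<^sup>2\<close>; the 6 comes from
  \<open>ln 2 \<ge> 1/2\<close>.\<close>

lemma card_prime_divisors_int:
  fixes k :: int
  assumes "k \<noteq> 0" "real_of_int \<bar>k\<bar> \<le> x ^ 3" "x \<ge> 1"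
  shows "finite {q. prime q \<and> int q dvd k}" "real (card {q. prime q \<and> int q dvd k}) \<le> 6 * ln x"
proof -
  have eq: "{q. prime q \<and> int q dvd k} = prime_factors (nat \<bar>k\<bar>)"
    using assms(1) by (auto simp: in_prime_factors_iff)
  then show "finite {q. prime q \<and> int q dvd k}" by simp
  have "nat \<bar>k\<bar> > 0" using assms(1) by simp
  then have "2 ^ card (prime_factors (nat \<bar>k\<bar>)) \<le> nat \<bar>k\<bar>" by (rule two_power_card_prime_factors_le)
  then have "(2::real) ^ card (prime_factors (nat \<bar>k\<bar>)) \<le> real (nat \<bar>k\<bar>)"
    by (metis of_nat_le_iff of_nat_numeral of_nat_power)
  also have "\<dots> \<le> x ^ 3" using assms(2) by simp
  finally have "ln ((2::real) ^ card (prime_factors (nat \<bar>k\<bar>))) \<le> ln (x ^ 3)" using assms(3) by (intro ln_mono) auto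
  then have le: "real (card (prime_factors (nat \<bar>k\<bar>))) * ln 2 \<le> 3 * ln x" using assms(3) by (simp add: ln_realpow)
  have "real (card (prime_factors (nat \<bar>k\<bar>))) * (1/2) \<le> real (card (prime_factors (nat \<bar>k\<bar>))) * ln 2"
    using ln2_ge by (intro mult_left_mono) auto
  then show "real (card {q. prime q \<and> int q dvd k}) \<le> 6 * ln x" using le eq by simp
qed

text \<open>Proportional primitive vectors agree up to sign. So in a set without opposite vectors
  all determinants are nonzero, and two linear forms share a root only modulo few primes.\<close>

lemma prim_reps_det_eq_0:
  assumes w: "(a, b) \<in> prim_reps m" "(a', b') \<in> prim_reps m" and det: "a * b' - a' * b = 0"
  shows "(a', b') = (a, b) \<or> (a', b') = (- a, - b)"
proof -
  have c: "coprime a b" "coprime a' b'" using w by (auto simp: prim_reps_def)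
  have e: "a * b' = a' * b" using det by simp
  have "a dvd a' * b" "a' dvd a * b'" by (metis e dvd_triv_left)+
  then have "a dvd a'" "a' dvd a" using c by (simp_all add: coprime_dvd_mult_left_iff)
  then have A: "\<bar>a\<bar> = \<bar>a'\<bar>" by (metis zdvd_antisym_abs)
  have "b dvd a * b'" "b' dvd a' * b" by (metis e dvd_triv_right)+
  then have "b dvd b'" "b' dvd b" using c by (simp_all add: coprime_dvd_mult_right_iff coprime_commute)
  then have B: "\<bar>b\<bar> = \<bar>b'\<bar>" by (metis zdvd_antisym_abs)
  show ?thesis
  proof (cases "a = 0")
    case True
    then show ?thesis using A B by (auto simp: abs_eq_iff)
  next
    case False
    consider "a' = a" | "a' = - a" using A by (auto simp: abs_eq_iff)
    then show ?thesis
    proof cases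
      case 1
      then show ?thesis using e False by simp
    next
      case 2
      then have "a * b' = a * (- b)" using e by simp
      then show ?thesis using 2 False by (simp only: mult_cancel_left) simp
    qed
  qed
qed

lemma R_prime_not_dvd:
  assumes "k \<in> R_prime" "prime q" "q mod 4 = 3"
  shows "\<not> q dvd k"
  using assms not_dvd_sum_squares_nat by (auto simp: R_prime_def)

text \<open>\<open>W\<close> holds the coefficients of linear forms in \<open>c\<close> whose values
  are the second coordinates of the chosen representations of \<open>m * p\<close>.\<close>

definition sift :: "real \<Rightarrow> nat \<Rightarrow> int \<Rightarrow> (int \<times> int) set \<Rightarrow> int set" where
  "sift Y s d W = {c. \<bar>c\<bar> \<le> int s \<and> (\<exists>p. prime p \<and> real p \<ge> Y \<and> c\<^sup>2 + d\<^sup>2 = int p)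
      \<and> (\<forall>(a, b)\<in>W. nat \<bar>a * c + b * d\<bar> \<in> R_prime)}"

text \<open>\<open>E\<close> consists of the primes at which residues can be lost: divisors of
  \<open>d\<close>, where the roots of \<open>c\<^sup>2 + d\<^sup>2\<close> merge, divisors of a
  leading coefficient, where a form may have no root, and divisors of a determinant, where two forms
  share a root. These are at most \<open>1 + l + l\<^sup>2\<close> integers of size at most
  \<open>x ^ 3\<close>.\<close>

lemma sieve_setup:
  fixes m s l :: nat and d :: int and x Y :: real and W :: "(int \<times> int) set"
  assumes m: "m > 0" "real m \<le> x" and d: "d \<noteq> 0" "real_of_int \<bar>d\<bar> \<le> x" and x: "x \<ge> 2"
    and W: "W \<subseteq> prim_reps m" "card W = l" "\<And>a b. (a, b) \<in> W \<Longrightarrow> (- a, - b) \<notin> W"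
  obtains E \<Omega> where "finite E" "\<And>q. q \<in> E \<Longrightarrow> prime q" "real (card E) \<le> 6 * (1 + real l + (real l)\<^sup>2) * ln x"
    "\<And>q. \<lbrakk>prime q; odd q; real q < Y; q \<notin> E\<rbrakk> \<Longrightarrow> \<Omega> q \<subseteq> {..<q} \<and> (if q mod 4 = 1 then 2 else l - 1) \<le> card (\<Omega> q)"
    "card (sift Y s d W) \<le> card {i. i < 2 * s + 1 \<and> (\<forall>q. prime q \<and> odd q \<and> real q < Y \<and> q \<notin> E \<longrightarrow> i mod q \<notin> \<Omega> q)}"
proof -
  define T where "T = sift Y s d W"
  define pd where "pd = (\<lambda>k::int. {q::nat. prime q \<and> int q dvd k})"
  define W' where "W' = {w\<in>W. fst w \<noteq> 0}"
  define det where "det = (\<lambda>w w'::int \<times> int. fst w * snd w' - fst w' * snd w)"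
  define D where "D = {(w, w'). w \<in> W \<and> w' \<in> W \<and> w \<noteq> w'}"
  define E where "E = pd d \<union> (\<Union>w\<in>W'. pd (fst w)) \<union> (\<Union>(w, w')\<in>D. pd (det w w'))"
  \<comment> \<open>The sieve variable is \<open>i = c + s\<close>, which moves
    \<open>- s \<le> c \<le> s\<close> to \<open>i < 2 * s + 1\<close>; hence the shifts by
    \<open>s\<close>.\<close>
  define \<Omega> where "\<Omega> = (\<lambda>q::nat. if q mod 4 = 1 then {i. i < q \<and> int q dvd (int i - int s)\<^sup>2 + d\<^sup>2}
     else {i. i < q \<and> (\<exists>w\<in>W'. int q dvd fst w * (int i - int s) + snd w * d)})"
  have finW: "finite W" using W(1) finite_prim_reps finite_subset by blast
  have finW': "finite W'" "card W' \<le> l" using finW W(2) by (auto simp: W'_def intro!: card_mono)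
  have D_sub: "D \<subseteq> W \<times> W" by (auto simp: D_def)
  have finD: "finite D" using D_sub finW finite_subset by blast
  have cardD: "card D \<le> l\<^sup>2" using card_mono[OF _ D_sub] finW W(2) by (simp add: card_cartesian_product power2_eq_square)
  have x3: "x \<le> x ^ 3" using x self_le_power[of x 3] by simp
  have pd: "finite (pd k)" "real (card (pd k)) \<le> 6 * ln x" if "k \<noteq> 0" "real_of_int \<bar>k\<bar> \<le> x ^ 3" for k
    unfolding pd_def using card_prime_divisors_int[OF that] x by auto
  have pd_d: "finite (pd d)" "real (card (pd d)) \<le> 6 * ln x" using pd[of d] d x3 by auto
  have pd_a: "finite (pd (fst w))" "real (card (pd (fst w))) \<le> 6 * ln x" if "w \<in> W'" for w
  proof -
    have "\<bar>fst w\<bar> \<le> int m" using that W(1) prim_reps_abs_le[of "fst w" "snd w" m] by (auto simp: W'_def)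
    then have "real_of_int \<bar>fst w\<bar> \<le> real m" by linarith
    then show "finite (pd (fst w))" "real (card (pd (fst w))) \<le> 6 * ln x"
      using pd[of "fst w"] that m x3 by (auto simp: W'_def)
  qed
  have det0: "det w w' \<noteq> 0" if "(w, w') \<in> D" for w w'
  proof
    assume "det w w' = 0"
    then have "w' = w \<or> w' = (- fst w, - snd w)"
      using prim_reps_det_eq_0[of "fst w" "snd w" m "fst w'" "snd w'"] that W(1) by (auto simp: D_def det_def)
    then show False using that W(3)[of "fst w" "snd w"] by (auto simp: D_def)
  qed
  have pd_det: "finite (pd (det w w'))" "real (card (pd (det w w'))) \<le> 6 * ln x" if "(w, w') \<in> D" for w w'
  proof -
    have bd: "\<bar>fst w\<bar> \<le> int m" "\<bar>snd w\<bar> \<le> int m" "\<bar>fst w'\<bar> \<le> int m" "\<bar>snd w'\<bar> \<le> int m"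
      using that W(1) prim_reps_abs_le[of "fst w" "snd w" m] prim_reps_abs_le[of "fst w'" "snd w'" m] by (auto simp: D_def)
    have "\<bar>det w w'\<bar> \<le> \<bar>fst w\<bar> * \<bar>snd w'\<bar> + \<bar>fst w'\<bar> * \<bar>snd w\<bar>" unfolding det_def by (simp flip: abs_mult)
    also have "\<dots> \<le> int m * int m + int m * int m" using bd by (intro add_mono mult_mono) auto
    finally have "real_of_int \<bar>det w w'\<bar> \<le> real_of_int (int m * int m + int m * int m)" by (simp only: of_int_le_iff)
    also have "\<dots> = 2 * (real m * real m)" by simp
    also have "\<dots> \<le> x * (x * x)" using m x by (intro mult_mono) auto
    finally show "finite (pd (det w w'))" "real (card (pd (det w w'))) \<le> 6 * ln x"
      using pd[of "det w w'"] det0[OF that] by (auto simp: power3_eq_cube)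
  qed
  have lnx: "ln x \<ge> 0" using x by simp
  have cardE: "real (card E) \<le> 6 * (1 + real l + (real l)\<^sup>2) * ln x"
  proof -
    have "card E \<le> card (pd d) + card (\<Union>w\<in>W'. pd (fst w)) + card (\<Union>(w, w')\<in>D. pd (det w w'))"
      unfolding E_def by (meson add_right_mono card_Un_le order_trans)
    also have "\<dots> \<le> card (pd d) + (\<Sum>w\<in>W'. card (pd (fst w))) + (\<Sum>z\<in>D. card (case z of (w, w') \<Rightarrow> pd (det w w')))"
      using card_UN_le[OF finW'(1)] card_UN_le[OF finD] by (intro add_mono) auto
    finally have "real (card E) \<le> real (card (pd d)) + (\<Sum>w\<in>W'. real (card (pd (fst w)))) + (\<Sum>z\<in>D. real (card (case z of (w, w') \<Rightarrow> pd (det w w'))))"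
      by (simp flip: of_nat_sum of_nat_add)
    also have "\<dots> \<le> 6 * ln x + (\<Sum>w\<in>W'. 6 * ln x) + (\<Sum>z\<in>D. 6 * ln x)"
      using pd_d pd_a pd_det by (intro add_mono sum_mono) auto
    also have "\<dots> = 6 * (1 + real (card W') + real (card D)) * ln x" by (simp add: algebra_simps)
    also have "\<dots> \<le> 6 * (1 + real l + (real l)\<^sup>2) * ln x"
    proof -
      have "real (card D) \<le> (real l)\<^sup>2" using cardD by (metis of_nat_le_iff of_nat_power)
      then show ?thesis using finW'(2) lnx by (intro mult_right_mono mult_left_mono add_mono) auto
    qed
    finally show ?thesis .
  qed
  have finE: "finite E" unfolding E_def using pd_d pd_a pd_det finW' finD by auto
  have primeE: "prime q" if "q \<in> E" for q using that by (auto simp: E_def pd_def)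
  \<comment> \<open>A primitive vector with first coordinate 0 is \<open>(0, 1)\<close> or
    \<open>(0, -1)\<close>, and \<open>W\<close> contains at most one of them, so at most one form
    is constant in \<open>c\<close>.\<close>
  have cardW': "l - 1 \<le> card W'"
  proof -
    have "W - W' \<subseteq> {(0, 1), (0, -1)}"
    proof
      fix w assume w: "w \<in> W - W'"
      then have "fst w = 0" "w \<in> prim_reps m" using W(1) by (auto simp: W'_def)
      then show "w \<in> {(0, 1), (0, -1)}" by (cases w) (auto simp: prim_reps_def)
    qed
    moreover have "\<not> ((0, 1) \<in> W \<and> (0, -1) \<in> W)" using W(3)[of 0 1] by auto
    ultimately have "W - W' \<subseteq> {(0, 1)} \<or> W - W' \<subseteq> {(0, -1)}" by blast
    then have "card (W - W') \<le> 1"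
      using card_mono[of "{(0, 1)}" "W - W'"] card_mono[of "{(0, -1)}" "W - W'"] by fastforce
    moreover have "card (W - W') = l - card W'" using finW' W(2) by (subst card_Diff_subset) (auto simp: W'_def)
    ultimately show ?thesis by simp
  qed
  have modq: "int q dvd A * (int (nat (k mod int q)) - t) + B \<longleftrightarrow> int q dvd A * (k - t) + B" if "q > 0" for q :: nat and A k t B :: int
  proof -
    have "int (nat (k mod int q)) = k - int q * (k div int q)"
      using that by (simp add: minus_mult_div_eq_mod)
    then have "A * (int (nat (k mod int q)) - t) + B = A * (k - t) + B - int q * (A * (k div int q))"
      by (simp only:) (simp add: algebra_simps)
    then show ?thesis by (simp only: dvd_diff_left_iff dvd_triv_left)
  qed
  have \<Omega>: "\<Omega> q \<subseteq> {..<q} \<and> (if q mod 4 = 1 then 2 else l - 1) \<le> card (\<Omega> q)"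
    if q: "prime q" "odd q" "q \<notin> E" for q
  proof -
    have sub: "\<Omega> q \<subseteq> {..<q}" by (auto simp: \<Omega>_def)
    then have fin: "finite (\<Omega> q)" using finite_subset by blast
    have q0: "q > 0" using q prime_gt_0_nat by simp
    have qi: "prime (int q)" using q by simp
    have qd: "\<not> int q dvd d" using q by (auto simp: E_def pd_def)
    show ?thesis
    proof (cases "q mod 4 = 1")
      case True
      obtain y :: int where y: "int q dvd y\<^sup>2 + 1" using minus_one_quad_res[OF q(1) True] .
      \<comment> \<open>The roots \<open>y * d\<close> and \<open>- y * d\<close> of
        \<open>c\<^sup>2 + d\<^sup>2\<close>, shifted by \<open>s\<close>; they are distinct because
        the odd prime \<open>q\<close> divides neither \<open>y\<close> nor
        \<open>d\<close>.\<close>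
      define i1 i2 where "i1 = nat ((int s + y * d) mod int q)" and "i2 = nat ((int s - y * d) mod int q)"
      have lt: "i1 < q" "i2 < q" using q0 by (auto simp: i1_def i2_def nat_less_iff)
      have sq: "int q dvd (int (nat (k mod int q)) - int s)\<^sup>2 + d\<^sup>2" if "(k - int s)\<^sup>2 = (y * d)\<^sup>2" for k
      proof -
        have "int (nat (k mod int q)) = k mod int q" using q0 by simp
        then have "int (nat (k mod int q)) - int s = (k - int s) - int q * (k div int q)"
          by (simp add: minus_mult_div_eq_mod[symmetric])
        then have "(int (nat (k mod int q)) - int s)\<^sup>2 + d\<^sup>2 =
            (k - int s)\<^sup>2 + d\<^sup>2 + int q * (int q * (k div int q)\<^sup>2 - 2 * (k - int s) * (k div int q))"
          by (simp only:) (simp add: power2_eq_square algebra_simps)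
        also have "\<dots> = (y\<^sup>2 + 1) * d\<^sup>2 + int q * (int q * (k div int q)\<^sup>2 - 2 * (k - int s) * (k div int q))"
          unfolding that by (simp add: power_mult_distrib algebra_simps)
        finally show ?thesis using y by simp
      qed
      have mem: "i1 \<in> \<Omega> q" "i2 \<in> \<Omega> q"
        using True lt sq[of "int s + y * d"] sq[of "int s - y * d"] by (auto simp: \<Omega>_def i1_def i2_def)
      have ne: "i1 \<noteq> i2"
      proof
        assume "i1 = i2"
        then have "(int s + y * d) mod int q = (int s - y * d) mod int q"
          using q0 unfolding i1_def i2_def by (subst (asm) eq_nat_nat_iff) auto
        then have "int q dvd (int s + y * d) - (int s - y * d)" by (simp add: mod_eq_dvd_iff)
        then have "int q dvd 2 * y * d" by (simp add: algebra_simps)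
        moreover have "\<not> int q dvd 2"
          using q by (metis int_dvd_int_iff of_nat_numeral primes_dvd_imp_eq two_is_prime_nat dvd_refl)
        moreover have "\<not> int q dvd y"
        proof
          assume "int q dvd y"
          then have "int q dvd y\<^sup>2" by (simp add: power2_eq_square)
          then have "int q dvd 1" using y by (simp add: dvd_add_right_iff)
          then show False using qi not_prime_unit by blast
        qed
        ultimately show False using qi qd by (simp add: prime_dvd_mult_iff)
      qed
      have "card {i1, i2} \<le> card (\<Omega> q)" using mem fin by (intro card_mono) auto
      then show ?thesis using sub ne True by simp
    next
      case False
      have "\<exists>i\<in>\<Omega> q. int q dvd fst w * (int i - int s) + snd w * d" if w: "w \<in> W'" for w
      proof -
        have "\<not> int q dvd fst w" using q w by (auto simp: E_def pd_def)
        then have "coprime (fst w) (int q)" using prime_imp_coprime[OF qi, of "fst w"] by (metis coprime_commute)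
        then obtain g where "[fst w * g = 1] (mod int q)" using cong_solve_coprime_int by blast
        then have g: "int q dvd fst w * g - 1" by (simp add: cong_iff_dvd_diff)
        define i where "i = nat ((int s - snd w * d * g) mod int q)"
        have "fst w * ((int s - snd w * d * g) - int s) + snd w * d = - (snd w * d) * (fst w * g - 1)"
          by (simp add: algebra_simps)
        then have "int q dvd fst w * ((int s - snd w * d * g) - int s) + snd w * d" using g by simp
        then have dv: "int q dvd fst w * (int i - int s) + snd w * d" unfolding i_def using modq[OF q0] by blast
        have "i < q" unfolding i_def using q0 by (simp add: nat_less_iff)
        then have "i \<in> \<Omega> q" using False w dv by (auto simp: \<Omega>_def)
        then show ?thesis using dv by blast
      qed
      then obtain r where r: "\<And>w. w \<in> W' \<Longrightarrow> r w \<in> \<Omega> q \<and> int q dvd fst w * (int (r w) - int s) + snd w * d" by metis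
      \<comment> \<open>Eliminating a common root \<open>t\<close> from two forms leaves
        \<open>det w w' * d\<close>, and \<open>q \<notin> E\<close> keeps \<open>q\<close> from
        dividing either factor.\<close>
      have "inj_on r W'"
      proof (rule inj_onI, rule ccontr)
        fix w w' assume w: "w \<in> W'" "w' \<in> W'" "r w = r w'" "w \<noteq> w'"
        define t where "t = int (r w) - int s"
        have "int q dvd fst w * t + snd w * d" "int q dvd fst w' * t + snd w' * d"
          using r[OF w(1)] r[OF w(2)] w(3) unfolding t_def by auto
        then have "int q dvd (fst w' * t + snd w' * d) * fst w - (fst w * t + snd w * d) * fst w'"
          by (rule dvd_diff[OF dvd_mult2 dvd_mult2, rotated])
        also have "\<dots> = det w w' * d" by (simp add: det_def algebra_simps)
        finally have "int q dvd det w w'" using qi qd by (simp add: prime_dvd_mult_iff)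
        then show False using q w unfolding E_def D_def pd_def W'_def by blast
      qed
      then have "card W' = card (r ` W')" by (simp add: card_image)
      also have "\<dots> \<le> card (\<Omega> q)" using r fin by (intro card_mono) auto
      finally show ?thesis using sub cardW' False by simp
    qed
  qed
  have "card T \<le> card {i. i < 2 * s + 1 \<and> (\<forall>q. prime q \<and> odd q \<and> real q < Y \<and> q \<notin> E \<longrightarrow> i mod q \<notin> \<Omega> q)}"
  proof (rule card_inj_on_le[where f = "\<lambda>c. nat (c + int s)"])
    show "inj_on (\<lambda>c. nat (c + int s)) T" by (rule inj_onI) (auto simp: T_def sift_def)
    show "(\<lambda>c. nat (c + int s)) ` T \<subseteq> {i. i < 2 * s + 1 \<and> (\<forall>q. prime q \<and> odd q \<and> real q < Y \<and> q \<notin> E \<longrightarrow> i mod q \<notin> \<Omega> q)}"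
    proof safe
      fix c assume c: "c \<in> T"
      then have cs: "- int s \<le> c" "c \<le> int s" by (auto simp: T_def sift_def)
      then show "nat (c + int s) < 2 * s + 1" by linarith
      fix q assume q: "prime q" "odd q" "real q < Y" "q \<notin> E" and mem: "nat (c + int s) mod q \<in> \<Omega> q"
      have q0: "q > 0" using q prime_gt_0_nat by simp
      have eq: "int (nat (c + int s) mod q) = (c + int s) mod int q" using cs by (simp add: zmod_int)
      show False
      proof (cases "q mod 4 = 1")
        case True
        then have "int q dvd ((c + int s) mod int q - int s)\<^sup>2 + d\<^sup>2" using mem by (simp add: \<Omega>_def eq)
        also have "((c + int s) mod int q - int s)\<^sup>2 + d\<^sup>2 =
            c\<^sup>2 + d\<^sup>2 + int q * (int q * ((c + int s) div int q)\<^sup>2 - 2 * c * ((c + int s) div int q))"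
          by (simp add: minus_div_mult_eq_mod[symmetric] power2_eq_square algebra_simps)
        finally have "int q dvd c\<^sup>2 + d\<^sup>2" by (simp add: dvd_add_left_iff)
        moreover obtain p where p: "prime p" "real p \<ge> Y" "c\<^sup>2 + d\<^sup>2 = int p" using c by (auto simp: T_def sift_def)
        ultimately have "q dvd p" by simp
        \<comment> \<open>The lower bound on \<open>p\<close> acts here:
          \<open>q < Y \<le> p\<close> rules out that \<open>q\<close> is \<open>p\<close>
          itself.\<close>
        then have "q = p" using q(1) p(1) primes_dvd_imp_eq by blast
        then show False using q p by simp
      next
        case False
        then obtain w where w: "w \<in> W'" "int q dvd fst w * ((c + int s) mod int q - int s) + snd w * d"
          using mem by (auto simp: \<Omega>_def eq)
        have "int (nat ((c + int s) mod int q)) = (c + int s) mod int q" using q0 by simp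
        then have "int q dvd fst w * c + snd w * d"
          using w(2) modq[OF q0, of "fst w" "c + int s" "int s" "snd w * d"] by simp
        then have "q dvd nat \<bar>fst w * c + snd w * d\<bar>" by (metis dvd_abs_iff int_dvd_int_iff int_nat_eq abs_ge_zero)
        moreover have "nat \<bar>fst w * c + snd w * d\<bar> \<in> R_prime" using c w by (auto simp: T_def sift_def W'_def case_prod_unfold)
        moreover have "q mod 4 = 3" using q(2) False by presburger
        ultimately show False using R_prime_not_dvd q by blast
      qed
    qed
  qed simp
  then show thesis using that[of E \<Omega>] finE primeE cardE \<Omega> unfolding T_def by blast
qed

section \<open>Reduction to the sieve\<close>

definition reps :: "nat \<Rightarrow> (nat \<times> nat) set" where
  "reps n = {(a, b). b \<in> R_prime \<and> a\<^sup>2 + b\<^sup>2 = n \<and> coprime a b}"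

lemma r_star_eq: "r_star R_prime n = card (reps n)"
  by (simp add: r_star_def reps_def)

lemma reps_prim_reps: "(a, b) \<in> reps n \<Longrightarrow> (int a, int b) \<in> prim_reps n"
  by (auto simp: prim_reps_def reps_def simp flip: of_nat_power of_nat_add)

lemma finite_reps: "finite (reps n)"
proof -
  have "inj_on (\<lambda>(a, b). (int a, int b)) (reps n)" by (auto simp: inj_on_def)
  moreover have "(\<lambda>(a, b). (int a, int b)) ` reps n \<subseteq> prim_reps n" using reps_prim_reps by auto
  ultimately show ?thesis using finite_prim_reps inj_on_finite by blast
qed

lemma r_star_le:
  assumes "n > 0"
  shows "r_star R_prime n \<le> 4 * 2 ^ omega_star n"
proof -
  have "inj_on (\<lambda>(a, b). (int a, int b)) (reps n)" by (auto simp: inj_on_def)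
  moreover have "(\<lambda>(a, b). (int a, int b)) ` reps n \<subseteq> prim_reps n" using reps_prim_reps by auto
  ultimately have "card (reps n) \<le> card (prim_reps n)" using finite_prim_reps card_inj_on_le by blast
  then show ?thesis using card_prim_reps_le[OF assms] by (simp add: r_star_eq)
qed

lemma binomial_le_power: "n choose l \<le> n ^ l"
proof (cases "l \<le> n")
  case True then show ?thesis by (rule binomial_le_pow)
qed (simp add: binomial_eq_0)

text \<open>As \<open>p\<close> may already divide \<open>m\<close>, both counts occur; this is why
  the final sum has terms for \<open>k - 1\<close> and for \<open>k\<close>.\<close>

lemma omega_star_mult_prime:
  assumes "m > 0" "prime p"
  shows "omega_star (m * p) \<in> {omega_star m, Suc (omega_star m)}"
proof -
  define Q where "Q = (\<lambda>m. {p. prime p \<and> odd p \<and> p dvd (m::nat)})"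
  have fin: "finite (Q m)" unfolding Q_def using finite_odd_prime_divisors[OF assms(1)] .
  have "Q m \<subseteq> Q (m * p)" unfolding Q_def by auto
  moreover have "Q (m * p) \<subseteq> insert p (Q m)"
    unfolding Q_def using assms(2) by (auto simp: prime_dvd_mult_iff dest: primes_dvd_imp_eq)
  ultimately have "Q (m * p) = Q m \<or> Q (m * p) = insert p (Q m)" by blast
  then have "card (Q (m * p)) \<in> {card (Q m), Suc (card (Q m))}" using card_insert_if[OF fin, of p] by (auto split: if_splits)
  then show ?thesis unfolding omega_star_def Q_def .
qed

lemma R_prime_pos: "b \<in> R_prime \<Longrightarrow> b > 0"
  by (auto simp: R_prime_def)

text \<open>An \<open>l\<close>-subset of the representations of \<open>n = m * p\<close> becomes, after division by a fixed Gaussian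
  prime \<open>c + d * \<i>\<close> above \<open>p\<close>, an \<open>l\<close>-subset \<open>W\<close> of \<open>prim_reps m\<close>.\<close>

lemma sum_choose_le:
  fixes x Y Bd :: real and k l :: nat
  assumes l: "l \<ge> 1" and Y: "Y > 2" and x: "x \<ge> 2" and Bd: "Bd \<ge> 0"
    and Gd: "finite Gd" "\<And>n. n \<in> Gd \<Longrightarrow> 0 < n \<and> real n \<le> x \<and> omega_star n = k \<and> (\<exists>p. prime p \<and> real p \<ge> Y \<and> p dvd n)"
    and bound: "\<And>m s d W. \<lbrakk>m > 0; real m * Y \<le> x; s = nat \<lfloor>sqrt (x / real m)\<rfloor>; d \<noteq> 0; \<bar>d\<bar> \<le> int s;
        W \<subseteq> prim_reps m; card W = l; \<And>a b. (a, b) \<in> W \<Longrightarrow> (- a, - b) \<notin> W\<rbrakk> \<Longrightarrow>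
        real (card (sift Y s d W)) \<le> Bd * real (2 * s + 1)"
  shows "real (\<Sum>n\<in>Gd. r_star R_prime n choose l)
    \<le> 6 * Bd * x * (\<Sum>j\<in>{k - 1, k}. (4 * 2 ^ j) ^ l * (\<Sum>m\<in>norm_set (nat \<lfloor>x\<rfloor>) j. 1 / real m))"
proof -
  define I where "I = Sigma Gd (\<lambda>n. {B. B \<subseteq> reps n \<and> card B = l})"
  have cardI: "card I = (\<Sum>n\<in>Gd. r_star R_prime n choose l)"
  proof -
    have "finite {B. B \<subseteq> reps n \<and> card B = l}" for n using finite_reps[of n] by simp
    then show ?thesis unfolding I_def using Gd(1) n_subsets[OF finite_reps]
      by (simp add: card_SigmaI r_star_eq)
  qed
  have ex_pcd: "\<exists>p c d. prime p \<and> real p \<ge> Y \<and> p dvd n \<and> c\<^sup>2 + d\<^sup>2 = int p" if n: "n \<in> Gd" "reps n \<noteq> {}" for n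
  proof -
    obtain p where p: "prime p" "real p \<ge> Y" "p dvd n" using Gd(2)[OF n(1)] by blast
    have "odd p" using p Y prime_odd_nat[of p] by auto
    moreover obtain a b where "(a, b) \<in> reps n" using n(2) by auto
    ultimately have "p mod 4 = 1" using prim_reps_prime_mod_4[OF reps_prim_reps p(1)] p(3) by blast
    then obtain c d where "c\<^sup>2 + d\<^sup>2 = int p" using prime_sum_two_squares[OF p(1)] by blast
    then show ?thesis using p by blast
  qed
  have "\<forall>n. \<exists>t. n \<in> Gd \<and> reps n \<noteq> {} \<longrightarrow> prime (fst t) \<and> real (fst t) \<ge> Y \<and> fst t dvd n
      \<and> (fst (snd t))\<^sup>2 + (snd (snd t))\<^sup>2 = int (fst t)"
  proof
    fix n
    show "\<exists>t. n \<in> Gd \<and> reps n \<noteq> {} \<longrightarrow> prime (fst t) \<and> real (fst t) \<ge> Y \<and> fst t dvd n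
      \<and> (fst (snd t))\<^sup>2 + (snd (snd t))\<^sup>2 = int (fst t)"
    proof (cases "n \<in> Gd \<and> reps n \<noteq> {}")
      case True
      then obtain p c d where "prime p \<and> real p \<ge> Y \<and> p dvd n \<and> c\<^sup>2 + d\<^sup>2 = int p" using ex_pcd by blast
      then show ?thesis by (intro exI[of _ "(p, c, d)"]) simp
    next
      case False
      then show ?thesis by blast
    qed
  qed
  from choice[OF this] obtain t where t: "\<And>n. n \<in> Gd \<Longrightarrow> reps n \<noteq> {} \<Longrightarrow>
      prime (fst (t n)) \<and> real (fst (t n)) \<ge> Y \<and> fst (t n) dvd n
      \<and> (fst (snd (t n)))\<^sup>2 + (snd (snd (t n)))\<^sup>2 = int (fst (t n))" by blast
  define p c d where "p = (\<lambda>n. fst (t n))" and "c = (\<lambda>n. fst (snd (t n)))" and "d = (\<lambda>n. snd (snd (t n)))"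
  have pcd: "prime (p n) \<and> real (p n) \<ge> Y \<and> p n dvd n \<and> (c n)\<^sup>2 + (d n)\<^sup>2 = int (p n)"
    if "n \<in> Gd" "reps n \<noteq> {}" for n
    using t[OF that] by (simp add: p_def c_def d_def)
  define M where "M = (\<lambda>n. n div p n)"
  have nM: "n = M n * p n" if "n \<in> Gd" "reps n \<noteq> {}" for n using pcd[OF that] by (simp add: M_def)
  have ex_w: "\<exists>w. w \<in> prim_reps (M n) \<and> int (snd z) = fst w * c n + snd w * d n" if n: "n \<in> Gd" and z: "z \<in> reps n" for n z
  proof -
    have ne: "reps n \<noteq> {}" using z by blast
    obtain a b where ab: "z = (a, b)" by (cases z)
    have pr: "(int a, int b) \<in> prim_reps n" using reps_prim_reps z ab by blast
    then have "coprime (int a) (int b)" "(int a)\<^sup>2 + (int b)\<^sup>2 = int (M n * p n)"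
      using nM[OF n ne] by (auto simp: prim_reps_def)
    then obtain \<alpha> \<beta> where "(\<alpha>, \<beta>) \<in> prim_reps (M n)" "int b = \<alpha> * c n + \<beta> * d n"
      using prim_reps_divide_prime[of "p n" "c n" "d n" "int a" "int b" "M n"] pcd[OF n ne] by blast
    then show ?thesis using ab by (intro exI[of _ "(\<alpha>, \<beta>)"]) simp
  qed
  define w where "w = (\<lambda>n (z :: nat \<times> nat). SOME w. w \<in> prim_reps (M n) \<and> int (snd z) = fst w * c n + snd w * d n)"
  have w: "w n z \<in> prim_reps (M n) \<and> int (snd z) = fst (w n z) * c n + snd (w n z) * d n"
    if "n \<in> Gd" "z \<in> reps n" for n z
    unfolding w_def by (rule someI_ex[OF ex_w[OF that]])
  define s where "s = (\<lambda>m::nat. nat \<lfloor>sqrt (x / real m)\<rfloor>)"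
  define Ms where "Ms = {m. 0 < m \<and> real m * Y \<le> x \<and> prim_reps m \<noteq> {} \<and> omega_star m \<in> {k - 1, k}}"
  define Ws where "Ws = (\<lambda>m. {W. W \<subseteq> prim_reps m \<and> card W = l \<and> (\<forall>a b. (a, b) \<in> W \<longrightarrow> (- a, - b) \<notin> W)})"
  define Ds where "Ds = (\<lambda>m. {e::int. e \<noteq> 0 \<and> \<bar>e\<bar> \<le> int (s m)})"
  define J where "J = Sigma Ms (\<lambda>m. Sigma (Ws m) (\<lambda>W. Sigma (Ds m) (\<lambda>e. sift Y (s m) e W)))"
  \<comment> \<open>Nothing is lost: \<open>c\<close> and \<open>d\<close> determine
    \<open>p\<close>, hence \<open>n = M n * p n\<close>, and \<open>B\<close> is recovered from its
    image as the representations whose second coordinate is a value of one of the forms (the set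
    \<open>R\<close> below).\<close>
  define F where "F = (\<lambda>(n, B). (M n, w n ` B, d n, c n))"
  have Ms_norm: "m \<in> norm_set (nat \<lfloor>x\<rfloor>) (omega_star m)" if "m \<in> Ms" for m
  proof -
    have m: "m > 0" "real m * Y \<le> x" using that by (auto simp: Ms_def)
    have "prim_reps m \<noteq> {}" using that by (simp add: Ms_def)
    then obtain a b where ab: "(a, b) \<in> prim_reps m" by (metis ex_in_conv surj_pair)
    have "real m \<le> real m * Y" using Y mult_left_mono[of 1 Y "real m"] by simp
    then have "real m \<le> x" using m(2) by linarith
    then have "m \<le> nat \<lfloor>x\<rfloor>" by (simp add: le_nat_iff le_floor_iff)
    then show ?thesis using m prim_reps_not_4_dvd[OF ab] prim_reps_prime_mod_4[OF ab] by (auto simp: norm_set_def)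
  qed
  have finMs: "finite Ms"
    by (rule finite_subset[of _ "{..nat \<lfloor>x\<rfloor>}"]) (use Ms_norm in \<open>auto simp: norm_set_def\<close>)
  have finWs: "finite (Ws m)" for m
    by (rule finite_subset[of _ "Pow (prim_reps m)"]) (auto simp: Ws_def finite_prim_reps)
  have Ds_eq: "Ds m = {- int (s m)..int (s m)} - {0}" for m by (auto simp: Ds_def)
  have finDs: "finite (Ds m)" for m unfolding Ds_eq by simp
  have cardDs: "card (Ds m) = 2 * s m" for m
  proof -
    have "card {- int (s m)..int (s m)} = 2 * s m + 1" by (simp add: nat_add_distrib)
    then show ?thesis unfolding Ds_eq by (subst card_Diff_singleton) auto
  qed
  have fin_sift: "finite (sift Y q e W)" for q e W
    by (rule finite_subset[of _ "{- int q..int q}"]) (auto simp: sift_def)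
  have finJ: "finite J" unfolding J_def using finMs finWs finDs fin_sift by (intro finite_SigmaI) auto
  \<comment> \<open>First coordinates are natural numbers, so the second coordinate alone determines
    a representation of \<open>n\<close>.\<close>
  have wn_inj: "z = z'" if n: "n \<in> Gd" and z: "z \<in> reps n" "z' \<in> reps n" and b: "snd z = snd z'" for n z z'
  proof -
    have "(fst z)\<^sup>2 = (fst z')\<^sup>2" using z b by (cases z, cases z') (auto simp: reps_def)
    then show ?thesis using b by (simp add: prod_eq_iff)
  qed
  define R where "R = (\<lambda>n c d W. {z\<in>reps n. \<exists>v\<in>W. int (snd z) = fst v * c + snd v * d})"
  have B_eq: "B = R n (c n) (d n) (w n ` B)"
    if n: "n \<in> Gd" and B: "B \<subseteq> reps n" for n B
  proof (intro equalityI subsetI)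
    fix z assume "z \<in> R n (c n) (d n) (w n ` B)"
    then obtain z' where z': "z \<in> reps n" "z' \<in> B" "int (snd z) = fst (w n z') * c n + snd (w n z') * d n"
      unfolding R_def by blast
    have "z' \<in> reps n" using z' B by blast
    then have "snd z = snd z'" using w[OF n, of z'] z'(3) by simp
    then have "z = z'" using wn_inj[OF n z'(1) \<open>z' \<in> reps n\<close>] by simp
    then show "z \<in> B" using z' by simp
  next
    fix z assume z: "z \<in> B"
    then have "z \<in> reps n" using B by blast
    then show "z \<in> R n (c n) (d n) (w n ` B)"
      using w[OF n, of z] z unfolding R_def by blast
  qed
  have ne: "reps n \<noteq> {}" if "(n, B) \<in> I" for n B
  proof
    assume "reps n = {}"
    then have "B = {}" "card B = l" using that by (auto simp: I_def)
    then show False using l by simp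
  qed
  have injF: "inj_on F I"
  proof (rule inj_onI)
    fix u v assume u: "u \<in> I" and v: "v \<in> I" and eq: "F u = F v"
    obtain n B where uB: "u = (n, B)" by (cases u)
    obtain n' B' where vB: "v = (n', B')" by (cases v)
    have n: "n \<in> Gd" "B \<subseteq> reps n" "n' \<in> Gd" "B' \<subseteq> reps n'" using u v uB vB by (auto simp: I_def)
    have e: "M n = M n'" "w n ` B = w n' ` B'" "d n = d n'" "c n = c n'" using eq uB vB by (auto simp: F_def)
    have ne': "reps n \<noteq> {}" "reps n' \<noteq> {}" using ne u v uB vB by blast+
    have "int (p n) = int (p n')" using pcd[OF n(1) ne'(1)] pcd[OF n(3) ne'(2)] e by simp
    then have "n = n'" using nM[OF n(1) ne'(1)] nM[OF n(3) ne'(2)] e by simp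
    moreover have "B = B'"
    proof -
      have "R n (c n) (d n) (w n ` B) = R n' (c n') (d n') (w n' ` B')"
        unfolding e(2-4)[symmetric] unfolding \<open>n = n'\<close> ..
      then show ?thesis using B_eq[OF n(1,2)] B_eq[OF n(3,4)] by simp
    qed
    ultimately show "u = v" using uB vB by simp
  qed
  have imgF: "F ` I \<subseteq> J"
  proof
    fix v assume "v \<in> F ` I"
    then obtain n B where nB: "(n, B) \<in> I" "v = (M n, w n ` B, d n, c n)" by (auto simp: F_def)
    have n: "n \<in> Gd" and B: "B \<subseteq> reps n" "card B = l" using nB by (auto simp: I_def)
    note nn = ne[OF nB(1)]
    have P: "prime (p n)" "real (p n) \<ge> Y" "p n dvd n" "(c n)\<^sup>2 + (d n)\<^sup>2 = int (p n)" using pcd[OF n nn] by auto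
    have nx: "0 < n" "real n \<le> x" "omega_star n = k" using Gd(2)[OF n] by auto
    have n_eq: "n = M n * p n" by (rule nM[OF n nn])
    have M0: "M n > 0" using n_eq nx by (cases "M n") auto
    have "real (M n) * Y \<le> real (M n) * real (p n)" using P by (intro mult_left_mono) auto
    also have "\<dots> = real n" using n_eq by (metis of_nat_mult)
    finally have MY: "real (M n) * Y \<le> x" using nx by simp
    have "p n \<noteq> 0" using P by (metis not_prime_0)
    have om: "omega_star (M n) \<in> {k - 1, k}"
      using omega_star_mult_prime[OF M0 P(1)] nx n_eq by auto
    have Br: "z \<in> reps n" if "z \<in> B" for z using that B by blast
    have "w n ` B \<subseteq> prim_reps (M n)" using w[OF n] Br by blast
    moreover have "B \<noteq> {}" using B l by auto
    ultimately have Mn: "M n \<in> Ms" using M0 MY om unfolding Ms_def by blast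
    have winj: "inj_on (w n) B"
    proof (rule inj_onI)
      fix z z' assume z: "z \<in> B" "z' \<in> B" "w n z = w n z'"
      then have "int (snd z) = int (snd z')" using w[OF n Br, of z] w[OF n Br, of z'] by simp
      then show "z = z'" using wn_inj[OF n Br Br, of z z'] z by simp
    qed
    have W: "w n ` B \<in> Ws (M n)"
    proof -
      \<comment> \<open>Opposite vectors give opposite values of the form, but both values are
        positive elements of \<open>R_prime\<close>.\<close>
      have "(- a, - b) \<notin> w n ` B" if "(a, b) \<in> w n ` B" for a b
      proof
        assume "(- a, - b) \<in> w n ` B"
        then obtain z' where z': "z' \<in> B" "w n z' = (- a, - b)" by fastforce
        obtain z where z: "z \<in> B" "w n z = (a, b)" using \<open>(a, b) \<in> w n ` B\<close> by fastforce
        have "int (snd z) = a * c n + b * d n" "int (snd z') = - a * c n + - b * d n"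
          using w[OF n Br, of z] w[OF n Br, of z'] z z' by auto
        then have "int (snd z) = - int (snd z')" by simp
        moreover have "snd z > 0" using Br[OF z(1)] by (cases z) (auto simp: reps_def dest: R_prime_pos)
        ultimately show False by linarith
      qed
      then show ?thesis using \<open>w n ` B \<subseteq> prim_reps (M n)\<close> winj B(2) by (simp add: Ws_def card_image)
    qed
    have le_s: "\<bar>t\<bar> \<le> int (s (M n))" if "t\<^sup>2 \<le> int (p n)" for t :: int
    proof -
      have "(real_of_int \<bar>t\<bar>)\<^sup>2 \<le> real (p n)" using that by (metis of_int_le_iff of_int_of_nat_eq of_int_power power2_abs)
      also have "\<dots> \<le> x / real (M n)" using nx M0 n_eq by (simp add: field_simps) (metis of_nat_mult mult.commute)
      finally have "real_of_int \<bar>t\<bar> \<le> sqrt (x / real (M n))" by (rule real_le_rsqrt)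
      then have "\<bar>t\<bar> \<le> \<lfloor>sqrt (x / real (M n))\<rfloor>" by (simp add: le_floor_iff)
      then show ?thesis unfolding s_def by linarith
    qed
    \<comment> \<open>A prime is not a square, which excludes \<open>d = 0\<close>; otherwise every
      prime would be exceptional.\<close>
    have nsq: "int (p n) \<noteq> t\<^sup>2" for t :: int
    proof
      assume "int (p n) = t\<^sup>2"
      then have "p n = (nat \<bar>t\<bar>)\<^sup>2" by (metis nat_int nat_power_eq abs_ge_zero power2_abs)
      then show False using P(1) by (metis prime_power_iff numeral_eq_one_iff semiring_norm(85))
    qed
    have "d n \<in> Ds (M n)"
    proof -
      have "(d n)\<^sup>2 \<le> int (p n)" using P(4) zero_le_power2[of "c n"] by linarith
      moreover have "d n \<noteq> 0" using nsq[of "c n"] P(4) by auto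
      ultimately show ?thesis using le_s by (simp add: Ds_def)
    qed
    moreover have "c n \<in> sift Y (s (M n)) (d n) (w n ` B)"
    proof -
      have "(c n)\<^sup>2 \<le> int (p n)" using P(4) zero_le_power2[of "d n"] by linarith
      then have "\<bar>c n\<bar> \<le> int (s (M n))" by (rule le_s)
      moreover have "nat \<bar>fst (w n z) * c n + snd (w n z) * d n\<bar> \<in> R_prime" if "z \<in> B" for z
      proof -
        have "z \<in> reps n" by (rule Br[OF that])
        then have "snd z \<in> R_prime" by (cases z) (auto simp: reps_def)
        moreover have "fst (w n z) * c n + snd (w n z) * d n = int (snd z)" using w[OF n \<open>z \<in> reps n\<close>] by simp
        ultimately show ?thesis by simp
      qed
      ultimately show ?thesis using P by (auto simp: sift_def case_prod_unfold)
    qed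
    ultimately show "v \<in> J" using nB(2) Mn W by (simp add: J_def)
  qed
  have "real (card I) \<le> real (card J)" using card_inj_on_le[OF injF imgF finJ] by simp
  also have "\<dots> = (\<Sum>m\<in>Ms. \<Sum>W\<in>Ws m. \<Sum>e\<in>Ds m. real (card (sift Y (s m) e W)))"
    unfolding J_def using finMs finWs finDs fin_sift by (simp add: card_SigmaI finite_SigmaI)
  also have "\<dots> \<le> (\<Sum>m\<in>Ms. 6 * Bd * x * ((4 * 2 ^ omega_star m) ^ l * (1 / real m)))"
  proof (rule sum_mono)
    fix m assume m: "m \<in> Ms"
    then have m0: "m > 0" "real m * Y \<le> x" by (auto simp: Ms_def)
    define X where "X = x / real m"
    have "real m \<le> real m * Y" using Y mult_left_mono[of 1 Y "real m"] by simp
    then have "real m \<le> x" using m0(2) by linarith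
    then have X: "X \<ge> 1" using m0(1) by (simp add: X_def)
    have sX: "real (s m) \<le> sqrt X" "1 \<le> sqrt X" using X by (auto simp: s_def X_def[symmetric])
    have "(\<Sum>W\<in>Ws m. \<Sum>e\<in>Ds m. real (card (sift Y (s m) e W))) \<le> (\<Sum>W\<in>Ws m. \<Sum>e\<in>Ds m. Bd * real (2 * s m + 1))"
      using m0 by (intro sum_mono bound) (auto simp: s_def Ds_def Ws_def)
    \<comment> \<open>The \<open>2 * s m\<close> values of \<open>d\<close> times the length
      \<open>2 * s m + 1\<close> of the \<open>c\<close>-interval are at most
      \<open>6 * x / m\<close>: summing over \<open>d\<close> restores the full order
      \<open>x / m\<close>.\<close>
    also have "\<dots> = Bd * real (card (Ws m)) * (real (2 * s m) * real (2 * s m + 1))"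
      by (simp add: cardDs)
    also have "\<dots> \<le> Bd * (4 * 2 ^ omega_star m) ^ l * (6 * X)"
    proof -
      have "card (Ws m) \<le> card {W. W \<subseteq> prim_reps m \<and> card W = l}"
        by (intro card_mono) (auto simp: Ws_def finite_prim_reps)
      also have "\<dots> = card (prim_reps m) choose l" by (rule n_subsets[OF finite_prim_reps])
      also have "\<dots> \<le> card (prim_reps m) ^ l" by (rule binomial_le_power)
      also have "\<dots> \<le> (4 * 2 ^ omega_star m) ^ l" by (intro power_mono card_prim_reps_le m0) auto
      finally have "real (card (Ws m)) \<le> real ((4 * 2 ^ omega_star m) ^ l)" by (simp only: of_nat_le_iff)
      then have 1: "real (card (Ws m)) \<le> (4 * 2 ^ omega_star m) ^ l" by simp
      have "real (2 * s m) * real (2 * s m + 1) \<le> (2 * sqrt X) * (3 * sqrt X)"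
      proof (rule mult_mono)
        show "real (2 * s m) \<le> 2 * sqrt X" "real (2 * s m + 1) \<le> 3 * sqrt X" using sX by linarith+
      qed (use sX in auto)
      then have 2: "real (2 * s m) * real (2 * s m + 1) \<le> 6 * X" using X by simp
      show ?thesis by (rule mult_mono[OF mult_left_mono[OF 1 Bd] 2]) (use Bd in auto)
    qed
    finally show "(\<Sum>W\<in>Ws m. \<Sum>e\<in>Ds m. real (card (sift Y (s m) e W))) \<le> 6 * Bd * x * ((4 * 2 ^ omega_star m) ^ l * (1 / real m))"
      by (simp add: X_def mult_ac)
  qed
  also have "\<dots> = 6 * Bd * x * (\<Sum>m\<in>Ms. (4 * 2 ^ omega_star m) ^ l * (1 / real m))"
    by (simp add: sum_distrib_left)
  \<comment> \<open>For \<open>k = 0\<close> natural subtraction gives \<open>k - 1 = 0\<close>, and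
    the index set collapses to a single element.\<close>
  also have "(\<Sum>m\<in>Ms. (4 * 2 ^ omega_star m) ^ l * (1 / real m)) =
     (\<Sum>j\<in>{k - 1, k}. \<Sum>m\<in>{m\<in>Ms. omega_star m = j}. (4 * 2 ^ omega_star m) ^ l * (1 / real m))"
    by (rule sum.group[symmetric]) (use finMs in \<open>auto simp: Ms_def\<close>)
  also have "6 * Bd * x * \<dots> \<le> 6 * Bd * x * (\<Sum>j\<in>{k - 1, k}. (4 * 2 ^ j) ^ l * (\<Sum>m\<in>norm_set (nat \<lfloor>x\<rfloor>) j. 1 / real m))"
  proof (intro mult_left_mono sum_mono)
    fix j assume "j \<in> {k - 1, k}"
    have "(\<Sum>m\<in>{m\<in>Ms. omega_star m = j}. (4 * 2 ^ omega_star m) ^ l * (1 / real m)) =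
        (4 * 2 ^ j) ^ l * (\<Sum>m\<in>{m\<in>Ms. omega_star m = j}. 1 / real m)"
      unfolding sum_distrib_left by (rule sum.cong) auto
    also have "\<dots> \<le> (4 * 2 ^ j) ^ l * (\<Sum>m\<in>norm_set (nat \<lfloor>x\<rfloor>) j. 1 / real m)"
      using finite_norm_set Ms_norm by (intro mult_left_mono sum_mono2) auto
    finally show "(\<Sum>m\<in>{m\<in>Ms. omega_star m = j}. (4 * 2 ^ omega_star m) ^ l * (1 / real m))
      \<le> (4 * 2 ^ j) ^ l * (\<Sum>m\<in>norm_set (nat \<lfloor>x\<rfloor>) j. 1 / real m)" .
  qed (use Bd x in auto)
  finally show ?thesis by (simp add: cardI)
qed

section \<open>The final estimate\<close>

lemma card_bounded_subsets_le:
  assumes "finite A"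
  shows "card {T. T \<subseteq> A \<and> card T \<le> K} \<le> (card A + 1) ^ K"
proof (induction K)
  case 0
  have "{T. T \<subseteq> A \<and> card T \<le> 0} \<subseteq> {{}}" using assms by (auto dest: finite_subset simp: card_eq_0_iff)
  then show ?case using card_mono[of "{{}}" "{T. T \<subseteq> A \<and> card T \<le> 0}"] by simp
next
  case (Suc K)
  have "{T. T \<subseteq> A \<and> card T \<le> Suc K} = {T. T \<subseteq> A \<and> card T \<le> K} \<union> {T. T \<subseteq> A \<and> card T = Suc K}" by auto
  then have "card {T. T \<subseteq> A \<and> card T \<le> Suc K} \<le> card {T. T \<subseteq> A \<and> card T \<le> K} + card {T. T \<subseteq> A \<and> card T = Suc K}"
    by (simp only: card_Un_le)
  also have "\<dots> \<le> (card A + 1) ^ K + card A * (card A + 1) ^ K"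
  proof (rule add_mono[OF Suc])
    have "card {T. T \<subseteq> A \<and> card T = Suc K} = card A choose Suc K" by (rule n_subsets[OF assms])
    also have "\<dots> \<le> card A * card A ^ K" using binomial_le_power[of "card A" "Suc K"] by simp
    also have "\<dots> \<le> card A * (card A + 1) ^ K" by (intro mult_left_mono power_mono) auto
    finally show "card {T. T \<subseteq> A \<and> card T = Suc K} \<le> card A * (card A + 1) ^ K" .
  qed
  finally show ?case by simp
qed

lemma card_prime_factors_le: "n > 0 \<Longrightarrow> card (prime_factors n) \<le> Suc (omega_star n)"
proof -
  assume n: "n > 0"
  let ?Q = "{p. prime p \<and> odd p \<and> p dvd n}"
  have fin: "finite ?Q" by (rule finite_odd_prime_divisors[OF n])
  have "prime_factors n \<subseteq> insert 2 ?Q"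
  proof
    fix p assume "p \<in> prime_factors n"
    then have p: "prime p" "p dvd n" by (auto simp: in_prime_factors_iff)
    then show "p \<in> insert 2 ?Q" using prime_odd_nat[of p] prime_ge_2_nat[of p] by (cases "p = 2") auto
  qed
  then have "card (prime_factors n) \<le> card (insert 2 ?Q)" using fin by (intro card_mono) auto
  also have "\<dots> \<le> Suc (card ?Q)" using fin by (simp add: card_insert_if)
  finally show ?thesis by (simp add: omega_star_def)
qed

text \<open>Such an \<open>n\<close> is determined by its set of pairs (prime, exponent), taken from
  a box of about \<open>Y * ln x\<close> points. There are at most \<open>k + 1\<close> pairs, since
  \<open>omega_star\<close> ignores the prime 2.\<close>

lemma card_smooth_le:
  fixes x Y :: real
  assumes x: "x \<ge> 1"
  shows "card {n. 0 < n \<and> real n \<le> x \<and> omega_star n = k \<and> \<not> (\<exists>p. prime p \<and> real p \<ge> Y \<and> p dvd n)}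
     \<le> ((nat \<lfloor>Y\<rfloor> + 1) * (nat \<lfloor>2 * ln x\<rfloor> + 1) + 1) ^ (k + 1)"
    (is "card ?S \<le> _")
proof -
  let ?A = "{..nat \<lfloor>Y\<rfloor>} \<times> {..nat \<lfloor>2 * ln x\<rfloor>}"
  define g where "g = (\<lambda>n::nat. (\<lambda>p. (p, multiplicity p n)) ` prime_factors n)"
  have g_prod: "n = (\<Prod>(p, e)\<in>g n. p ^ e)" if "n > 0" for n
  proof -
    have "inj_on (\<lambda>p. (p, multiplicity p n)) (prime_factors n)" by (auto simp: inj_on_def)
    then show ?thesis unfolding g_def using prime_factorization_nat[OF that] by (simp add: prod.reindex)
  qed
  have inj: "inj_on g ?S"
  proof (rule inj_onI)
    fix n n' assume n: "n \<in> ?S" "n' \<in> ?S" "g n = g n'"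
    then have "n > 0" "n' > 0" by auto
    then show "n = n'" using g_prod[of n] g_prod[of n'] n(3) by simp
  qed
  have img: "g ` ?S \<subseteq> {T. T \<subseteq> ?A \<and> card T \<le> k + 1}"
  proof
    fix T assume "T \<in> g ` ?S"
    then obtain n where n: "T = g n" "n > 0" "real n \<le> x" "omega_star n = k"
        and sm: "\<And>p. prime p \<Longrightarrow> p dvd n \<Longrightarrow> real p < Y"
      by (auto simp: not_le)
    have "card T \<le> card (prime_factors n)" unfolding n(1) g_def by (intro card_image_le) simp
    then have "card T \<le> k + 1" using card_prime_factors_le[OF n(2)] n(4) by simp
    moreover have "(p, multiplicity p n) \<in> ?A" if p: "p \<in> prime_factors n" for p
    proof -
      have pp: "prime p" "p dvd n" using p by (auto simp: in_prime_factors_iff)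
      have "real p < Y" by (rule sm[OF pp])
      then have "p \<le> nat \<lfloor>Y\<rfloor>" by (simp add: le_nat_iff le_floor_iff)
      moreover have "multiplicity p n \<le> nat \<lfloor>2 * ln x\<rfloor>"
      proof -
        have "2 ^ multiplicity p n \<le> p ^ multiplicity p n" using prime_ge_2_nat[OF pp(1)] by (intro power_mono) auto
        also have "\<dots> \<le> n" using n(2) by (intro dvd_imp_le multiplicity_dvd)
        finally have "real (2 ^ multiplicity p n) \<le> real n" by (simp only: of_nat_le_iff)
        then have "real (2 ^ multiplicity p n) \<le> x" using n(3) by linarith
        then have "(2::real) ^ multiplicity p n \<le> x" by simp
        then have "ln ((2::real) ^ multiplicity p n) \<le> ln x" by (intro ln_mono) auto
        then have "real (multiplicity p n) * ln 2 \<le> ln x" by (simp add: ln_realpow)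
        moreover have "real (multiplicity p n) * (1/2) \<le> real (multiplicity p n) * ln 2"
          using ln2_ge by (intro mult_left_mono) auto
        ultimately have "real (multiplicity p n) \<le> 2 * ln x" by linarith
        then show ?thesis using x by (simp add: le_nat_iff le_floor_iff)
      qed
      ultimately show ?thesis by simp
    qed
    then have "T \<subseteq> ?A" unfolding n(1) g_def by blast
    ultimately show "T \<in> {T. T \<subseteq> ?A \<and> card T \<le> k + 1}" by simp
  qed
  have "card ?S \<le> card {T. T \<subseteq> ?A \<and> card T \<le> k + 1}"
    by (rule card_inj_on_le[OF inj img]) (rule finite_subset[of _ "Pow ?A"], auto)
  also have "\<dots> \<le> (card ?A + 1) ^ (k + 1)" by (rule card_bounded_subsets_le) simp
  also have "card ?A = (nat \<lfloor>Y\<rfloor> + 1) * (nat \<lfloor>2 * ln x\<rfloor> + 1)" by (simp add: card_cartesian_product)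
  finally show ?thesis .
qed

section \<open>Comparison of the powers of \<open>L\<close> and the final bound\<close>

lemma sum_inverse_pred_primes_1_mod_4_le:
  fixes x :: real
  assumes "x \<ge> 3"
  shows "(\<Sum>p | prime p \<and> p \<le> nat \<lfloor>x\<rfloor> \<and> p mod 4 = 1. 1 / (real p - 1)) \<le> ln (ln x) / 2 + 17"
proof -
  define y where "y = nat \<lfloor>x\<rfloor>"
  have y: "y \<ge> 3" "real y \<le> x" using assms by (auto simp: y_def le_nat_iff le_floor_iff)
  let ?P = "{p. prime p \<and> p \<le> y \<and> p mod 4 = 1}"
  have "(\<Sum>p\<in>?P. 1 / (real p - 1)) = (\<Sum>p\<in>?P. 1 / real p + 1 / (real p * (real p - 1)))"
  proof (rule sum.cong[OF refl])
    fix p assume "p \<in> ?P"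
    then have "p \<ge> 2" by (simp add: prime_ge_2_nat)
    then show "1 / (real p - 1) = 1 / real p + 1 / (real p * (real p - 1))" by (simp add: divide_simps)
  qed
  also have "\<dots> = (\<Sum>p\<in>?P. 1 / real p) + (\<Sum>p\<in>?P. 1 / (real p * (real p - 1)))" by (rule sum.distrib)
  also have "(\<Sum>p\<in>?P. 1 / (real p * (real p - 1))) \<le> (\<Sum>p\<in>{2..y}. 1 / (real p * (real p - 1)))"
    by (rule sum_mono2) (auto simp: prime_ge_2_nat)
  also have "\<dots> \<le> 1" using sum_inverse_mult_pred[of y] y by simp
  also have "(\<Sum>p\<in>?P. 1 / real p) \<le> ln (ln (real y)) / 2 + 16"
    using mertens_mod_4(1)[of y] y by (simp add: abs_le_iff)
  also have "ln (ln (real y)) \<le> ln (ln x)"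
  proof -
    have "ln (real y) \<le> ln x" "ln (real y) > 0" using y by (auto intro!: ln_mono)
    then show ?thesis by (rule ln_mono)
  qed
  finally show ?thesis unfolding y_def by simp
qed

text \<open>The bounded error in Mertens' estimate sits under a \<open>k\<close>-th power; for
  \<open>k \<le> C * L\<close> it costs only a constant factor, as
  \<open>1 + c / L \<le> exp (c / L)\<close>.\<close>

lemma power_add_const_le:
  fixes D L c C :: real
  assumes "D \<ge> 0" "L > 0" "c \<ge> 0" "real k \<le> C * L"
  shows "(D * (L + c)) ^ k \<le> exp (c * C) * (D * L) ^ k"
proof -
  have "(D * (L + c)) ^ k = (1 + c / L) ^ k * (D * L) ^ k"
  proof -
    have "D * (L + c) = (1 + c / L) * (D * L)" using assms by (simp add: field_simps)
    then show ?thesis by (simp only: power_mult_distrib)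
  qed
  also have "\<dots> \<le> exp (c * C) * (D * L) ^ k"
  proof (rule mult_right_mono)
    have "(1 + c / L) ^ k \<le> exp (c / L) ^ k" using assms by (intro power_mono) auto
    also have "\<dots> = exp (real k * (c / L))" by (rule exp_of_nat_mult[symmetric])
    also have "real k * (c / L) \<le> C * L * (c / L)" using assms by (intro mult_right_mono) auto
    also have "C * L * (c / L) = c * C" using assms by simp
    finally show "(1 + c / L) ^ k \<le> exp (c * C)" by simp
  qed (use assms in auto)
  finally show ?thesis .
qed

text \<open>From \<open>fact k \<le> k ^ k \<le> (C * L) ^ k\<close>. With
  \<open>L = ln (ln x)\<close> the left side is a fixed negative power of \<open>ln x\<close>, so
  contributions of order \<open>sqrt x\<close> times powers of \<open>ln x\<close> fit under the
  claimed bound.\<close>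

lemma power_div_fact_ge:
  fixes D L C :: real
  assumes "D \<ge> 1" "L > 0" "C \<ge> 1" "real k \<le> C * L"
  shows "exp (- (C * ln C * L)) \<le> (D * L) ^ k / fact k"
proof -
  have "exp (- (C * ln C * L)) \<le> exp (- (real k * ln C))"
    using mult_right_mono[OF assms(4), of "ln C"] assms(3) by (simp add: mult_ac)
  also have "\<dots> = 1 / C ^ k" using assms by (simp add: exp_minus exp_of_nat_mult divide_inverse)
  also have "\<dots> = L ^ k / (C * L) ^ k" using assms by (simp add: power_mult_distrib)
  also have "\<dots> \<le> (D * L) ^ k / fact k"
  proof (rule frac_le)
    show "L ^ k \<le> (D * L) ^ k" using assms by (intro power_mono) auto
    have "fact k \<le> real k ^ k" using fact_le_power[of k, where ?'a = real] by simp
    also have "\<dots> \<le> (C * L) ^ k" using assms by (intro power_mono) auto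
    finally show "fact k \<le> (C * L) ^ k" .
  qed (use assms in auto)
  finally show ?thesis .
qed

theorem theorem7p2p1:
  fixes l :: nat and C :: real
  assumes "l \<ge> 1" and "C > 0"
  shows "\<exists>K A x0 :: real. K > 0 \<and> A > 0 \<and> x0 > 0 \<and>
    (\<forall>x :: real. x \<ge> x0 \<longrightarrow> (\<forall>k :: nat. real k \<le> C * ln (ln x) \<longrightarrow>
      real (\<Sum>n | 0 < n \<and> real n \<le> x \<and> omega_star n = k. r_star R_prime n choose l)
        \<le> K * (x * ln (ln x) powr A / ln x powr ((real l + 1) / 2))
            * ((2 ^ (l - 1) * ln (ln x)) ^ k / fact k)))"
proof -
  \<comment> \<open>With \<open>C1 \<ge> 1\<close> one has \<open>ln C1 \<ge> 0\<close> and
    \<open>k + 1 \<le> 2 * C1 * L\<close>. The 8 in \<open>\<eta>\<close> then gives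
    \<open>(k + 1) * (2 * \<eta> * ln x / L) \<le> ln x / 2\<close>, so at most
    \<open>sqrt x\<close> integers lack a large prime factor.\<close>
  define C1 where "C1 = max C 1"
  have C1: "C1 \<ge> 1" "C \<le> C1" by (auto simp: C1_def)
  define \<eta> where "\<eta> = 1 / (8 * C1)"
  have \<eta>: "\<eta> > 0" using C1 by (simp add: \<eta>_def)
  define \<kappa> where "\<kappa> = real l + 1"
  define G where "G = 6 * (1 + real l + (real l)\<^sup>2)"
  obtain K A x1 where K: "K > 0" and A: "A > 0" and sieve:
    "\<And>x N E \<Omega>. \<lbrakk>x \<ge> x1; exp (\<eta> * ln x / (2 * ln (ln x))) \<le> real N; finite E; \<And>q. q \<in> E \<Longrightarrow> prime q;
        real (card E) \<le> G * ln x;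
        \<And>q. \<lbrakk>prime q; odd q; real q < exp (\<eta> * ln x / ln (ln x)); q \<notin> E\<rbrakk> \<Longrightarrow>
           \<Omega> q \<subseteq> {..<q} \<and> (if q mod 4 = 1 then 2 else l - 1) \<le> card (\<Omega> q)\<rbrakk> \<Longrightarrow>
      real (card {i. i < N \<and> (\<forall>q. prime q \<and> odd q \<and> real q < exp (\<eta> * ln x / ln (ln x)) \<and> q \<notin> E \<longrightarrow> i mod q \<notin> \<Omega> q)})
        \<le> K * real N * ln (ln x) powr A / ln x powr ((real l + 1) / 2)"
    using sieve_mod_4[OF assms(1) \<eta>, of G] by blast
  define D :: real where "D = 2 ^ (l - 1)"
  have D1: "D \<ge> 1" by (simp add: D_def)
  have D2: "2 ^ l = 2 * D" using assms(1) by (cases l) (auto simp: D_def)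
  \<comment> \<open>9 is \<open>6 * 3/2\<close>, 34 is twice the 17 from the sum over primes 1
    modulo 4, \<open>1 + C1\<close> covers the terms \<open>k\<close> and \<open>k - 1\<close>, and
    the last 1 the integers without a large prime.\<close>
  define K' where "K' = 9 * 4 ^ l * K * exp (34 * C1) * (1 + C1) + 1"
  have "eventually (\<lambda>x::real. x \<ge> x1) at_top" by (rule eventually_ge_at_top)
  moreover have "eventually (\<lambda>x::real. x \<ge> 3) at_top" by (rule eventually_ge_at_top)
  moreover have "eventually (\<lambda>x::real. ln (ln x) \<ge> 1) at_top" by real_asymp
  moreover have "eventually (\<lambda>x::real. exp (\<eta> * ln x / ln (ln x)) > 2) at_top" using \<eta> by real_asymp
  moreover have "eventually (\<lambda>x::real. (exp (\<eta> * ln x / ln (ln x)) + 1) * (2 * ln x + 1) + 1 \<le> exp (2 * \<eta> * ln x / ln (ln x))) at_top"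
    using \<eta> by real_asymp
  moreover have "eventually (\<lambda>x::real. real l * ln 4 + (real l * C1 + C1 * ln C1 + \<kappa> / 2) * ln (ln x) \<le> ln x / 2) at_top"
    by real_asymp
  ultimately have "eventually (\<lambda>x::real. x \<ge> x1 \<and> x \<ge> 3 \<and> ln (ln x) \<ge> 1 \<and> exp (\<eta> * ln x / ln (ln x)) > 2 \<and>
     (exp (\<eta> * ln x / ln (ln x)) + 1) * (2 * ln x + 1) + 1 \<le> exp (2 * \<eta> * ln x / ln (ln x)) \<and>
     real l * ln 4 + (real l * C1 + C1 * ln C1 + \<kappa> / 2) * ln (ln x) \<le> ln x / 2) at_top"
    by eventually_elim blast
  then obtain x2 where x2: "\<And>x. x \<ge> x2 \<Longrightarrow> x \<ge> x1 \<and> x \<ge> 3 \<and> ln (ln x) \<ge> 1 \<and> exp (\<eta> * ln x / ln (ln x)) > 2 \<and>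
     (exp (\<eta> * ln x / ln (ln x)) + 1) * (2 * ln x + 1) + 1 \<le> exp (2 * \<eta> * ln x / ln (ln x)) \<and>
     real l * ln 4 + (real l * C1 + C1 * ln C1 + \<kappa> / 2) * ln (ln x) \<le> ln x / 2"
    unfolding eventually_at_top_linorder by blast
  have main: "real (\<Sum>n | 0 < n \<and> real n \<le> x \<and> omega_star n = k. r_star R_prime n choose l)
        \<le> K' * (x * ln (ln x) powr A / ln x powr ((real l + 1) / 2)) * ((2 ^ (l - 1) * ln (ln x)) ^ k / fact k)"
    if xx2: "x \<ge> x2" and k: "real k \<le> C * ln (ln x)" for x :: real and k :: nat
  proof -
    define u where "u = ln x"
    define L where "L = ln u"
    define Y where "Y = exp (\<eta> * u / L)"
    define Bd where "Bd = K * L powr A / u powr (\<kappa> / 2)"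
    define Q where "Q = (D * L) ^ k / fact k"
    have x: "x \<ge> x1" "x \<ge> 3" and L1: "L \<ge> 1" and Y2: "Y > 2"
      and Y3: "(Y + 1) * (2 * u + 1) + 1 \<le> exp (2 * \<eta> * u / L)"
      and big: "real l * ln 4 + (real l * C1 + C1 * ln C1 + \<kappa> / 2) * L \<le> u / 2"
      using x2[OF xx2] by (auto simp: u_def L_def Y_def)
    have u0: "u > 0" using x by (simp add: u_def)
    have xu: "x = exp u" using x by (simp add: u_def)
    have k1: "real k \<le> C1 * L"
      using k C1(2) L1 mult_right_mono[of C C1 L] unfolding L_def u_def by linarith
    have Bd0: "Bd \<ge> 0" using K by (simp add: Bd_def)
    have Q0: "Q \<ge> 0" using D1 L1 by (simp add: Q_def)
    let ?S = "{n. 0 < n \<and> real n \<le> x \<and> omega_star n = k}"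
    define Gd where "Gd = {n\<in>?S. \<exists>p. prime p \<and> real p \<ge> Y \<and> p dvd n}"
    define Sm where "Sm = {n. 0 < n \<and> real n \<le> x \<and> omega_star n = k \<and> \<not> (\<exists>p. prime p \<and> real p \<ge> Y \<and> p dvd n)}"
    have finS: "finite ?S"
      by (rule finite_subset[of _ "{..nat \<lfloor>x\<rfloor>}"]) (auto simp: le_nat_iff le_floor_iff)
    have S_eq: "?S = Gd \<union> Sm" "Gd \<inter> Sm = {}" by (auto simp: Gd_def Sm_def)
    have finGd: "finite Gd" and finSm: "finite Sm" using finS S_eq(1) by (metis finite_Un)+
    have good: "real (\<Sum>n\<in>Gd. r_star R_prime n choose l)
       \<le> 6 * Bd * x * (\<Sum>j\<in>{k - 1, k}. (4 * 2 ^ j) ^ l * (\<Sum>m\<in>norm_set (nat \<lfloor>x\<rfloor>) j. 1 / real m))"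
    proof (rule sum_choose_le[OF assms(1) Y2 _ Bd0 finGd])
      fix m s :: nat and d :: int and W :: "(int \<times> int) set"
      assume m: "m > 0" "real m * Y \<le> x" and s: "s = nat \<lfloor>sqrt (x / real m)\<rfloor>" and d: "d \<noteq> 0" "\<bar>d\<bar> \<le> int s"
        and W: "W \<subseteq> prim_reps m" "card W = l" "\<And>a b. (a, b) \<in> W \<Longrightarrow> (- a, - b) \<notin> W"
      have "real m \<le> real m * Y" using Y2 mult_left_mono[of 1 Y "real m"] by simp
      then have mx: "real m \<le> x" using m by linarith
      have X1: "1 \<le> x / real m" "x / real m \<le> x" using mx m x mult_left_mono[of 1 "real m" x] by (auto simp: field_simps)
      have s1: "real s \<le> sqrt (x / real m)" "sqrt (x / real m) \<le> real s + 1" unfolding s using X1 by (auto, linarith?)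
      have "sqrt (x / real m) \<le> sqrt (x * x)" using X1 x mult_left_mono[of 1 x x] by (intro real_sqrt_le_mono) linarith
      then have "real s \<le> x" using s1 x by simp
      then have dx: "real_of_int \<bar>d\<bar> \<le> x" using d(2) by linarith
      \<comment> \<open>The interval for \<open>c\<close> is at least as long as
        \<open>sqrt (x / m) \<ge> sqrt Y\<close>, which explains the halved exponent in the sieve's
        condition on \<open>N\<close>.\<close>
      have N: "exp (\<eta> * ln x / (2 * ln (ln x))) \<le> real (2 * s + 1)"
      proof -
        have "exp (\<eta> * ln x / (2 * ln (ln x))) = sqrt Y"
        proof -
          have "exp (\<eta> * u / (2 * L)) ^ 2 = Y" unfolding Y_def exp_double[symmetric] using L1 by simp
          then show ?thesis unfolding u_def[symmetric] L_def[symmetric] by (metis exp_ge_zero real_sqrt_unique)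
        qed
        also have "\<dots> \<le> sqrt (x / real m)" using m by (intro real_sqrt_le_mono) (simp add: field_simps)
        also have "\<dots> \<le> real (2 * s + 1)" using s1 by simp
        finally show ?thesis .
      qed
      have "x \<ge> 2" using x(2) by simp
      then show "real (card (sift Y s d W)) \<le> Bd * real (2 * s + 1)"
      proof (rule sieve_setup[OF m(1) mx d(1) dx _ W, where s = s and Y = Y])
        fix E \<Omega>
        assume E: "finite E" "\<And>q. q \<in> E \<Longrightarrow> prime q" "real (card E) \<le> 6 * (1 + real l + (real l)\<^sup>2) * ln x"
          and \<Omega>: "\<And>q. \<lbrakk>prime q; odd q; real q < Y; q \<notin> E\<rbrakk> \<Longrightarrow> \<Omega> q \<subseteq> {..<q} \<and> (if q mod 4 = 1 then 2 else l - 1) \<le> card (\<Omega> q)"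
          and le: "card (sift Y s d W) \<le> card {i. i < 2 * s + 1 \<and> (\<forall>q. prime q \<and> odd q \<and> real q < Y \<and> q \<notin> E \<longrightarrow> i mod q \<notin> \<Omega> q)}"
        have "real (card {i. i < 2 * s + 1 \<and> (\<forall>q. prime q \<and> odd q \<and> real q < exp (\<eta> * ln x / ln (ln x)) \<and> q \<notin> E \<longrightarrow> i mod q \<notin> \<Omega> q)})
          \<le> K * real (2 * s + 1) * ln (ln x) powr A / ln x powr ((real l + 1) / 2)"
        proof (rule sieve[OF x(1) N E(1) _ E(3)[folded G_def]])
          show "prime q" if "q \<in> E" for q using E(2) that .
          show "\<Omega> q \<subseteq> {..<q} \<and> (if q mod 4 = 1 then 2 else l - 1) \<le> card (\<Omega> q)"
            if "prime q" "odd q" "real q < exp (\<eta> * ln x / ln (ln x))" "q \<notin> E" for q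
            using \<Omega>[of q] that unfolding Y_def u_def L_def by blast
        qed
        then have "real (card (sift Y s d W)) \<le> K * real (2 * s + 1) * ln (ln x) powr A / ln x powr ((real l + 1) / 2)"
          using le unfolding Y_def u_def L_def by linarith
        then show "real (card (sift Y s d W)) \<le> Bd * real (2 * s + 1)"
          by (simp add: Bd_def u_def L_def \<kappa>_def mult_ac)
      qed
    qed (use x in \<open>auto simp: Gd_def\<close>)
    define Z where "Z = 4 ^ l * (3 / 2) * (exp (34 * C1) * Q)"
    define f where "f = (\<lambda>j. (4 * 2 ^ j) ^ l * (\<Sum>m\<in>norm_set (nat \<lfloor>x\<rfloor>) j. 1 / real m))"
    have Z0: "Z \<ge> 0" using Q0 by (simp add: Z_def)
    have f_le: "f j \<le> 4 ^ l * (3 / 2) * ((D * (L + 34)) ^ j / fact j)" for j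
    proof -
      define S where "S = (\<Sum>p | prime p \<and> p \<le> nat \<lfloor>x\<rfloor> \<and> p mod 4 = 1. 1 / (real p - 1))"
      have S: "S \<le> L / 2 + 17" unfolding S_def L_def u_def by (rule sum_inverse_pred_primes_1_mod_4_le[OF x(2)])
      have S0: "S \<ge> 0" unfolding S_def using prime_ge_2_nat by (intro sum_nonneg) fastforce
      have "f j \<le> (4 * 2 ^ j) ^ l * (3 / 2 * S ^ j / fact j)"
        unfolding f_def S_def by (intro mult_left_mono sum_inverse_norm_set_le) auto
      also have "\<dots> = 4 ^ l * (3 / 2) * ((2 ^ l * S) ^ j / fact j)"
        by (simp add: power_mult_distrib power_mult[symmetric] mult.commute)
      also have "\<dots> \<le> 4 ^ l * (3 / 2) * ((D * (L + 34)) ^ j / fact j)"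
      proof (intro mult_left_mono divide_right_mono power_mono)
        \<comment> \<open>Here \<open>2 ^ l\<close> drops to \<open>D = 2 ^ (l - 1)\<close>:
          \<open>S\<close> runs over the primes 1 modulo 4 only and grows like
          \<open>L / 2\<close>.\<close>
        have "2 ^ l * S \<le> 2 ^ l * (L / 2 + 17)" using S by (intro mult_left_mono) auto
        then show "2 ^ l * S \<le> D * (L + 34)" by (simp add: D2 algebra_simps)
      qed (use S0 in auto)
      finally show ?thesis .
    qed
    have Dk: "(D * (L + 34)) ^ k / fact k \<le> exp (34 * C1) * Q"
      using power_add_const_le[of D L 34 k C1] D1 L1 k1 by (simp add: Q_def divide_right_mono)
    have fk: "f k \<le> Z"
      using f_le[of k] Dk unfolding Z_def by (meson mult_left_mono order_trans zero_le_power mult_nonneg_nonneg zero_le_numeral divide_nonneg_nonneg)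
    have sum_f: "(\<Sum>j\<in>{k - 1, k}. f j) \<le> (1 + C1) * Z"
    proof (cases k)
      case 0
      then show ?thesis using fk Z0 C1 mult_right_mono[of 1 "1 + C1" Z] by simp
    next
      case (Suc k')
      have pos: "D * (L + 34) > 0" using D1 L1 by simp
      \<comment> \<open>The term for \<open>k - 1\<close> is that for \<open>k\<close> times
        \<open>k / (D * (L + 34))\<close>, which is at most \<open>C1\<close> because
        \<open>k \<le> C1 * L\<close>.\<close>
      have "(D * (L + 34)) ^ k' / fact k' = (D * (L + 34)) ^ k / fact k * (real k / (D * (L + 34)))"
      proof -
        define X where "X = D * (L + 34)"
        have "X \<noteq> 0" using pos unfolding X_def by linarith
        then show ?thesis unfolding Suc X_def[symmetric] by (simp add: field_simps del: of_nat_Suc)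
      qed
      also have "\<dots> \<le> (exp (34 * C1) * Q) * C1"
      proof (rule mult_mono[OF Dk])
        have "real k \<le> C1 * (D * (L + 34))"
        proof -
          have "1 * L \<le> D * (L + 34)" using D1 L1 by (intro mult_mono) auto
          then have "C1 * L \<le> C1 * (D * (L + 34))" using C1 by (intro mult_left_mono) auto
          then show ?thesis using k1 by linarith
        qed
        then show "real k / (D * (L + 34)) \<le> C1" using pos by (simp add: divide_le_eq)
      qed (use Q0 pos in auto)
      finally have "4 ^ l * (3 / 2) * ((D * (L + 34)) ^ k' / fact k') \<le> 4 ^ l * (3 / 2) * ((exp (34 * C1) * Q) * C1)"
        by (intro mult_left_mono) auto
      then have "f k' \<le> C1 * Z" using f_le[of k'] by (simp add: Z_def mult_ac)
      then show ?thesis using fk Suc by (simp add: algebra_simps)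
    qed
    have "6 * Bd * x * (\<Sum>j\<in>{k - 1, k}. f j) \<le> 6 * Bd * x * ((1 + C1) * Z)"
      using sum_f Bd0 x by (intro mult_left_mono) auto
    also have "\<dots> = (9 * 4 ^ l * K * exp (34 * C1) * (1 + C1)) * (x * L powr A / u powr (\<kappa> / 2)) * Q"
      by (simp add: Z_def Bd_def)
    finally have good': "real (\<Sum>n\<in>Gd. r_star R_prime n choose l) \<le> (9 * 4 ^ l * K * exp (34 * C1) * (1 + C1)) * (x * L powr A / u powr (\<kappa> / 2)) * Q"
      using good unfolding f_def by linarith
    have smooth: "real (\<Sum>n\<in>Sm. r_star R_prime n choose l) \<le> x * L powr A / u powr (\<kappa> / 2) * Q"
    proof -
      \<comment> \<open>For these \<open>n\<close> the trivial bound
        \<open>r_star R_prime n \<le> 4 * 2 ^ k\<close> suffices: its \<open>l\<close>-th power is a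
        power of \<open>ln x\<close> up to a constant, against at most \<open>sqrt x\<close>
        integers.\<close>
      have "(\<Sum>n\<in>Sm. r_star R_prime n choose l) \<le> (\<Sum>n\<in>Sm. (4 * 2 ^ k) ^ l)"
      proof (rule sum_mono)
        fix n assume n: "n \<in> Sm"
        have "r_star R_prime n choose l \<le> r_star R_prime n ^ l" by (rule binomial_le_power)
        also have "\<dots> \<le> (4 * 2 ^ k) ^ l" using r_star_le[of n] n by (intro power_mono) (auto simp: Sm_def)
        finally show "r_star R_prime n choose l \<le> (4 * 2 ^ k) ^ l" .
      qed
      then have "real (\<Sum>n\<in>Sm. r_star R_prime n choose l) \<le> real (card Sm * (4 * 2 ^ k) ^ l)"
        by (simp only: of_nat_le_iff sum_constant) simp
      also have "\<dots> = real (card Sm) * (4 ^ l * 2 ^ (k * l))" by (simp add: power_mult_distrib power_mult)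
      also have "\<dots> \<le> exp (u / 2) * exp (real l * ln 4 + real l * C1 * L)"
      proof (rule mult_mono)
        define N0 where "N0 = (nat \<lfloor>Y\<rfloor> + 1) * (nat \<lfloor>2 * ln x\<rfloor> + 1) + 1"
        have "card Sm \<le> N0 ^ (k + 1)" unfolding Sm_def N0_def by (rule card_smooth_le) (use x in auto)
        then have "real (card Sm) \<le> real N0 ^ (k + 1)" by (metis of_nat_le_iff of_nat_power)
        also have "\<dots> \<le> exp (2 * \<eta> * u / L) ^ (k + 1)"
        proof (rule power_mono)
          have "real (nat \<lfloor>Y\<rfloor>) \<le> Y" "real (nat \<lfloor>2 * ln x\<rfloor>) \<le> 2 * u" using Y2 u0 by (auto simp: u_def)
          then have "(real (nat \<lfloor>Y\<rfloor>) + 1) * (real (nat \<lfloor>2 * ln x\<rfloor>) + 1) \<le> (Y + 1) * (2 * u + 1)"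
            using Y2 u0 by (intro mult_mono) auto
          moreover have "real N0 = (real (nat \<lfloor>Y\<rfloor>) + 1) * (real (nat \<lfloor>2 * ln x\<rfloor>) + 1) + 1"
            unfolding N0_def by (simp only: of_nat_add of_nat_mult of_nat_1)
          ultimately have "real N0 \<le> (Y + 1) * (2 * u + 1) + 1" by linarith
          then show "real N0 \<le> exp (2 * \<eta> * u / L)" using Y3 by linarith
        qed simp
        also have "\<dots> = exp (real (k + 1) * (2 * \<eta> * u / L))" by (simp only: exp_of_nat_mult)
        also have "\<dots> \<le> exp (u / 2)"
        proof -
          have "1 \<le> C1 * L" using C1 L1 mult_mono[of 1 C1 1 L] by simp
          then have "real (k + 1) \<le> 2 * C1 * L" using k1 by simp
          then have "real (k + 1) * (2 * \<eta> * u / L) \<le> 2 * C1 * L * (2 * \<eta> * u / L)"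
            using \<eta> u0 L1 by (intro mult_right_mono) auto
          also have "\<dots> = u / 2" using C1 L1 by (simp add: \<eta>_def)
          finally show ?thesis by simp
        qed
        finally show "real (card Sm) \<le> exp (u / 2)" .
        have "(2::real) ^ (k * l) \<le> exp 1 ^ (k * l)" using exp_ge_add_one_self[of 1] by (intro power_mono) auto
        also have "\<dots> = exp (real k * real l)" by (simp flip: exp_of_nat_mult)
        also have "\<dots> \<le> exp (real l * C1 * L)" using mult_right_mono[OF k1, of "real l"] by (simp add: mult_ac)
        finally have "(2::real) ^ (k * l) \<le> exp (real l * C1 * L)" .
        moreover have "(4::real) ^ l = exp (real l * ln 4)" by (simp add: exp_of_nat_mult)
        ultimately show "4 ^ l * 2 ^ (k * l) \<le> exp (real l * ln 4 + real l * C1 * L)" by (simp add: exp_add)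
      qed auto
      also have "\<dots> = exp (u / 2 + real l * ln 4 + real l * C1 * L)" by (simp add: exp_add)
      also have "\<dots> \<le> exp (u - \<kappa> / 2 * L - C1 * ln C1 * L)" using big by (simp add: algebra_simps)
      also have "\<dots> = x * 1 / exp (\<kappa> / 2 * L) * exp (- (C1 * ln C1 * L))" 
        unfolding diff_conv_add_uminus exp_add xu[symmetric] exp_minus[of "\<kappa> / 2 * L"]
        by (simp only: mult_1_right divide_inverse[of x])
      also have "\<dots> \<le> x * L powr A / u powr (\<kappa> / 2) * Q"
      proof (rule mult_mono)
        have "u powr (\<kappa> / 2) = exp (\<kappa> / 2 * L)" using u0 by (simp add: L_def powr_def)
        moreover have "1 \<le> L powr A" using L1 A by (simp add: ge_one_powr_ge_zero)
        ultimately show "x * 1 / exp (\<kappa> / 2 * L) \<le> x * L powr A / u powr (\<kappa> / 2)"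
          using x by (simp add: divide_right_mono)
        show "exp (- (C1 * ln C1 * L)) \<le> Q" unfolding Q_def using D1 L1 C1 k1 by (intro power_div_fact_ge) auto
      qed (use x in auto)
      finally show ?thesis .
    qed
    have "real (\<Sum>n\<in>?S. r_star R_prime n choose l) = real (\<Sum>n\<in>Gd. r_star R_prime n choose l) + real (\<Sum>n\<in>Sm. r_star R_prime n choose l)"
      unfolding S_eq(1) by (subst sum.union_disjoint[OF finGd finSm S_eq(2)]) simp
    also have "\<dots> \<le> K' * (x * L powr A / u powr (\<kappa> / 2)) * Q"
      using good' smooth by (simp add: K'_def algebra_simps)
    finally show ?thesis by (simp add: u_def L_def Q_def D_def \<kappa>_def)
  qed
  have "K' > 0" using K C1 by (simp add: K'_def add_nonneg_pos)
  then show ?thesis using main A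
    by (intro exI[of _ K'] exI[of _ A] exI[of _ "max x2 1"]) auto
qed

end
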